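(* Let $k$ be a field of characteristic $\neq 2$ and let $F(T) = T^6 + a_5T^5 + \cdots + a_1T + a_0 \in k[T]$ be a separable, monic polynomial of degree six, where $a_0 = c^2$ for some $c \in k^*$. (a) There exist exactly two pairs $(g,h)$ of binary quadratic forms over $k$ such that $\det M(1,T) = -F(T)$, for $$M(s,t) := \begin{pmatrix} -st+t^2 & st & g(s,t) \\ st & s^2 & t^2 \\ g(s,t) & t^2 & h(s,t) \end{pmatrix}.$$ For these, one has $g(1,0) = \pm c$. (b) Let $(g,h)$ be the one of the pairs as in (a) with $g(1,0) = c$. Then the equation $$(T_0\; T_1\; T_2)\, M(s,t) \begin{pmatrix} T_0 \\ T_1 \\ T_2 \end{pmatrix} = 0$$ defines a hypersurface $B_{F,c}$ of bidegree $(2,2)$ in $\mathbf{P}^1 \times \mathbf{P}^2$, with the following properties. (i) The generic fibre of the projection $\mathrm{pr}_1\colon B_{F,c} \to \mathbf{P}^1$ is a conic. Degenerate fibres occur exactly over the roots of $F$. (ii) Each of the six reducible fibres geometrically splits into two lines. The irreducible components are defined over the splitting field $l$ of $F(T^2)$ and permuted by $\mathrm{Gal}(l/k)$ in the same way as the roots of $F(T^2)$. (iii) The projection $\mathrm{pr}_2\colon B_{F,c} \to \mathbf{P}^2$ is a double cover of $\mathbf{P}^2$, ramified at a quartic curve $C_{F,c}$. For a generic choice of the polynomial $F$, the curve $C_{F,c}$ is nonsingular.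
   Context: $(s:t)$ are homogeneous coordinates on $\mathbf{P}^1$ and $(T_0:T_1:T_2)$ are homogeneous coordinates on $\mathbf{P}^2$; a root $t_0$ of $F$ is identified with the point $(1:t_0) \in \mathbf{P}^1$. Writing the left hand side of the equation of $B_{F,c}$ as $Q_0s^2 + Q_1st + Q_2t^2$ with ternary quadratic forms $Q_0, Q_1, Q_2$ in $T_0,T_1,T_2$, the quartic $C_{F,c}$ is the vanishing locus of the discriminant $Q_1^2 - 4Q_0Q_2$. "Permuted in the same way" means that there is a $\mathrm{Gal}(l/k)$-equivariant bijection between the twelve irreducible components of the reducible fibres and the twelve roots of $F(T^2)$. "Generic choice of $F$" refers to the parameters $(c,a_1,\dots,a_5)$ lying outside the zero set of a nonzero polynomial.
   Formalization: In (iii), "double cover" allows finitely many points of the quartic (none if it is nonsingular) over which the fibre of pr_2 is all of P^1; this does occur, e.g. for F = T^6-T^5-2T^3+1, c = 1, where h = 0 and the point is (0:0:1). *)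

theory Defs
  imports
    "HOL-Library.Poly_Mapping"
    "HOL-Computational_Algebra.Computational_Algebra"
    "HOL-Algebra.Generated_Fields"
    "HOL-Algebra.Algebraic_Closure_Type"
    "HOL-Analysis.Determinants"
begin

section \<open>Multivariate polynomials\<close>

text \<open>
  Polynomials in variables indexed by \<^typ>\<open>'v\<close>. The value \<open>meval \<iota> x p\<close> is that of \<open>p\<close> at \<open>x\<close>
  in a ring \<open>R\<close> that is an algebra over the coefficients via \<open>\<iota>\<close>.
\<close>

type_synonym ('v, 'a) mpoly = "('v \<Rightarrow>\<^sub>0 nat) \<Rightarrow>\<^sub>0 'a"

definition mvar :: "'v \<Rightarrow> ('v, 'a::comm_ring_1) mpoly" where
  "mvar v = Poly_Mapping.single (Poly_Mapping.single v 1) 1"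

definition mconst :: "'a \<Rightarrow> ('v, 'a::comm_ring_1) mpoly" where
  "mconst c = Poly_Mapping.single 0 c"

definition meval :: "('a \<Rightarrow> 'r::comm_ring_1) \<Rightarrow> ('v \<Rightarrow> 'r) \<Rightarrow> ('v, 'a::comm_ring_1) mpoly \<Rightarrow> 'r" where
  "meval \<iota> x p = (\<Sum>m\<in>Poly_Mapping.keys p. \<iota> (Poly_Mapping.lookup p m) *
      (\<Prod>v\<in>Poly_Mapping.keys m. x v ^ Poly_Mapping.lookup m v))"

definition mpderiv :: "'v \<Rightarrow> ('v, 'a::comm_ring_1) mpoly \<Rightarrow> ('v, 'a) mpoly" where
  "mpderiv v p = (\<Sum>m\<in>Poly_Mapping.keys p.
      Poly_Mapping.single (m - Poly_Mapping.single v 1)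
        (of_nat (Poly_Mapping.lookup m v) * Poly_Mapping.lookup p m))"

text \<open>The zero polynomial is homogeneous of every degree.\<close>

definition homogeneous :: "nat \<Rightarrow> ('v::finite, 'a::comm_ring_1) mpoly \<Rightarrow> bool" where
  "homogeneous d p \<longleftrightarrow>
     (\<forall>m\<in>Poly_Mapping.keys p. (\<Sum>v\<in>UNIV. Poly_Mapping.lookup m v) = d)"

definition bihomogeneous ::
    "nat \<Rightarrow> nat \<Rightarrow> ('v::finite + 'w::finite, 'a::comm_ring_1) mpoly \<Rightarrow> bool" where
  "bihomogeneous d e p \<longleftrightarrow>
     (\<forall>m\<in>Poly_Mapping.keys p. (\<Sum>v\<in>UNIV. Poly_Mapping.lookup m (Inl v)) = d \<and>
        (\<Sum>w\<in>UNIV. Poly_Mapping.lookup m (Inr w)) = e)"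


section \<open>Projective geometry over an algebraically closed field\<close>

text \<open>A point of projective space is the set of its homogeneous coordinate vectors.\<close>

definition proj_pt :: "'b::field ^ 'n \<Rightarrow> ('b ^ 'n) set" where
  "proj_pt x = {c *s x | c. c \<noteq> 0}"

definition proj_space :: "('b::field ^ 'n) set set" where
  "proj_space = {proj_pt x | x. x \<noteq> 0}"

text \<open>
  Homogeneous coordinates are numbered as by \<^const>\<open>vector\<close>: on the line, \<open>s\<close> and \<open>t\<close> have the
  indices 1 and 2; on the plane, \<open>T\<^sub>0, T\<^sub>1, T\<^sub>2\<close> have the indices 1, 2, 3. In the bihomogeneous
  coordinate ring of the product the former are tagged \<^const>\<open>Inl\<close>, the latter \<^const>\<open>Inr\<close>.
\<close>

type_synonym 'a biform = "(2 + 3, 'a) mpoly"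
type_synonym 'b line_plane = "(('b ^ 2) set \<times> ('b ^ 3) set) set"

definition zero_locus :: "'b::field biform set \<Rightarrow> 'b line_plane" where
  "zero_locus S = {(proj_pt x, proj_pt y) | x y. x \<noteq> 0 \<and> y \<noteq> 0 \<and>
      (\<forall>f\<in>S. meval id (case_sum (($) x) (($) y)) f = 0)}"

definition zariski_closed :: "'b::alg_closed_field line_plane \<Rightarrow> bool" where
  "zariski_closed Z \<longleftrightarrow> (\<exists>S. (\<forall>f\<in>S. \<exists>d e. bihomogeneous d e f) \<and> Z = zero_locus S)"

definition zariski_irreducible :: "'b::alg_closed_field line_plane \<Rightarrow> bool" where
  "zariski_irreducible Z \<longleftrightarrow> Z \<noteq> {} \<and>
     (\<forall>A B. zariski_closed A \<and> zariski_closed B \<and> Z \<subseteq> A \<union> B \<longrightarrow> Z \<subseteq> A \<or> Z \<subseteq> B)"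

definition irreducible_components :: "'b::alg_closed_field line_plane \<Rightarrow> 'b line_plane set" where
  "irreducible_components Y =
     {Z. Z \<subseteq> Y \<and> zariski_closed Z \<and> zariski_irreducible Z \<and>
         (\<forall>Z'. zariski_closed Z' \<and> zariski_irreducible Z' \<and> Z \<subseteq> Z' \<and> Z' \<subseteq> Y \<longrightarrow> Z' = Z)}"

definition fibre1 :: "'b::field line_plane \<Rightarrow> ('b ^ 2) set \<Rightarrow> 'b line_plane" where
  "fibre1 B p = {z \<in> B. fst z = p}"

definition fibre2 :: "'b::field line_plane \<Rightarrow> ('b ^ 3) set \<Rightarrow> 'b line_plane" where
  "fibre2 B q = {z \<in> B. snd z = q}"

text \<open>The line with equation \<open>a\<^sub>1 T\<^sub>0 + a\<^sub>2 T\<^sub>1 + a\<^sub>3 T\<^sub>2 = 0\<close> in the plane over the point \<open>x\<close>.\<close>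

definition vertical_line :: "'b::field ^ 2 \<Rightarrow> 'b ^ 3 \<Rightarrow> 'b line_plane" where
  "vertical_line x a = {(proj_pt x, proj_pt y) | y. y \<noteq> 0 \<and> (\<Sum>i\<in>UNIV. a $ i * y $ i) = 0}"

definition is_conic :: "(3, 'a::field) mpoly \<Rightarrow> bool" where
  "is_conic q \<longleftrightarrow> q \<noteq> 0 \<and> homogeneous 2 q"

definition is_quartic :: "(3, 'a::field) mpoly \<Rightarrow> bool" where
  "is_quartic q \<longleftrightarrow> q \<noteq> 0 \<and> homogeneous 4 q"

definition nonsingular_curve :: "(3, 'b::alg_closed_field) mpoly \<Rightarrow> bool" where
  "nonsingular_curve f \<longleftrightarrow>
     (\<forall>y. y \<noteq> 0 \<and> meval id (($) y) f = 0 \<longrightarrow> (\<exists>i. meval id (($) y) (mpderiv i f) \<noteq> 0))"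


section \<open>The fibres of a hypersurface in the product\<close>

text \<open>
  The equation of the fibre of the first (second) projection over the point \<open>x\<close> (\<open>y\<close>), whose
  coordinates lie in an extension of the ground field given by \<open>\<iota>\<close>.
\<close>

definition fibre1_form ::
    "('a::field \<Rightarrow> 'b::field) \<Rightarrow> 'a biform \<Rightarrow> 'b ^ 2 \<Rightarrow> (3, 'b) mpoly" where
  "fibre1_form \<iota> f x = meval (\<lambda>a. mconst (\<iota> a)) (case_sum (\<lambda>i. mconst (x $ i)) mvar) f"

definition fibre2_form ::
    "('a::field \<Rightarrow> 'b::field) \<Rightarrow> 'a biform \<Rightarrow> 'b ^ 3 \<Rightarrow> (2, 'b) mpoly" where
  "fibre2_form \<iota> f y = meval (\<lambda>a. mconst (\<iota> a)) (case_sum mvar (\<lambda>j. mconst (y $ j))) f"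

text \<open>
  For \<open>f = Q\<^sub>0 s\<^sup>2 + Q\<^sub>1 s t + Q\<^sub>2 t\<^sup>2\<close>, the forms \<open>Q\<^sub>0, Q\<^sub>1, Q\<^sub>2\<close> are read off after regarding \<open>f\<close> as a
  polynomial in \<open>s, t\<close> over the polynomial ring in \<open>T\<^sub>0, T\<^sub>1, T\<^sub>2\<close>.
\<close>

definition as_binary :: "'a::field biform \<Rightarrow> (2, (3, 'a) mpoly) mpoly" where
  "as_binary f = meval (\<lambda>a. mconst (mconst a)) (case_sum mvar (\<lambda>j. mconst (mvar j))) f"

definition discriminant_form :: "'a::field biform \<Rightarrow> (3, 'a) mpoly" where
  "discriminant_form f =
    (let Q = Poly_Mapping.lookup (as_binary f);
         Q0 = Q (Poly_Mapping.single 1 2);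
         Q1 = Q (Poly_Mapping.single 1 1 + Poly_Mapping.single 2 1);
         Q2 = Q (Poly_Mapping.single 2 2)
     in Q1 ^ 2 - 4 * Q0 * Q2)"

abbreviation over_closure :: "('v, 'a::field) mpoly \<Rightarrow> ('v, 'a alg_closure) mpoly" where
  "over_closure \<equiv> Poly_Mapping.map to_ac"

abbreviation geom_points :: "'a::field biform \<Rightarrow> 'a alg_closure line_plane" where
  "geom_points f \<equiv> zero_locus {over_closure f}"

text \<open>
  The second projection of the hypersurface \<open>f = 0\<close>, with \<open>f\<close> quadratic in \<open>s, t\<close>, is a double cover
  with branch locus \<open>C\<close>. Its fibre over \<open>y\<close> is cut out of the line by the binary quadratic form
  \<open>fibre2_form to_ac f y\<close>, hence is a scheme of length two unless that form vanishes identically.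
  The latter may occur for special equations; it is allowed over finitely many points, all on \<open>C\<close>
  and none of them present if \<open>C\<close> is nonsingular. Thus the projection is in general only generically
  finite of degree two, and it is finite of degree two if \<open>C\<close> is nonsingular.
\<close>

definition double_cover_branched_along :: "'a::field biform \<Rightarrow> (3, 'a) mpoly \<Rightarrow> bool" where
  "double_cover_branched_along f C \<longleftrightarrow>
     finite {proj_pt y | y. y \<noteq> 0 \<and> fibre2_form to_ac f y = 0} \<and>
     (nonsingular_curve (over_closure C) \<longrightarrow> (\<forall>y. y \<noteq> 0 \<longrightarrow> fibre2_form to_ac f y \<noteq> 0)) \<and>
     (\<forall>y. y \<noteq> 0 \<longrightarrow>
        homogeneous 2 (fibre2_form to_ac f y) \<and>
        (if fibre2_form to_ac f y = 0
         then meval id (($) y) (over_closure C) = 0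
         else card (fibre2 (geom_points f) (proj_pt y)) =
                (if meval id (($) y) (over_closure C) = 0 then 1 else 2)))"


section \<open>Galois action\<close>

definition roots_in_closure :: "'a::field poly \<Rightarrow> 'a alg_closure set" where
  "roots_in_closure p = {u. poly (map_poly to_ac p) u = 0}"

definition splitting_field :: "'a::field poly \<Rightarrow> 'a alg_closure set" where
  "splitting_field p = generate_field ring_of_type_algebra (range to_ac \<union> roots_in_closure p)"

text \<open>Only the values on \<open>l\<close> of an element of the Galois group matter.\<close>

definition galois_group :: "'a::field alg_closure set \<Rightarrow> ('a alg_closure \<Rightarrow> 'a alg_closure) set" where
  "galois_group l = {\<sigma>. bij_betw \<sigma> l l \<and>
     (\<forall>x\<in>l. \<forall>y\<in>l. \<sigma> (x + y) = \<sigma> x + \<sigma> y \<and> \<sigma> (x * y) = \<sigma> x * \<sigma> y) \<and>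
     (\<forall>a. \<sigma> (to_ac a) = to_ac a)}"

definition line_over :: "'b::field set \<Rightarrow> 'b line_plane \<Rightarrow> bool" where
  "line_over l Z \<longleftrightarrow> (\<exists>x a. x \<noteq> 0 \<and> a \<noteq> 0 \<and> (\<forall>i. x $ i \<in> l) \<and> (\<forall>i. a $ i \<in> l) \<and>
     Z = vertical_line x a)"

text \<open>
  \<open>Z'\<close> is the image of the line \<open>Z\<close>, defined over \<open>l\<close>, under \<open>\<sigma>\<close>, i.e. it is given by the
  conjugates of equations for \<open>Z\<close>. As these are unique up to factors in \<open>l\<close>, \<open>Z'\<close> is unique.
\<close>

definition galois_image ::
    "'b::field set \<Rightarrow> ('b \<Rightarrow> 'b) \<Rightarrow> 'b line_plane \<Rightarrow> 'b line_plane \<Rightarrow> bool" where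
  "galois_image l \<sigma> Z Z' \<longleftrightarrow>
    (\<exists>x a. x \<noteq> 0 \<and> a \<noteq> 0 \<and> (\<forall>i. x $ i \<in> l) \<and> (\<forall>i. a $ i \<in> l) \<and>
       Z = vertical_line x a \<and> Z' = vertical_line (\<chi> i. \<sigma> (x $ i)) (\<chi> i. \<sigma> (a $ i)))"


section \<open>The matrix and the hypersurface\<close>

definition M_matrix ::
    "('a::field \<Rightarrow> 'r::comm_ring_1) \<Rightarrow> (2, 'a) mpoly \<Rightarrow> (2, 'a) mpoly \<Rightarrow> 'r \<Rightarrow> 'r \<Rightarrow> 'r ^ 3 ^ 3" where
  "M_matrix \<iota> g h s t =
    (let gst = meval \<iota> (($) (vector [s, t])) g;
         hst = meval \<iota> (($) (vector [s, t])) h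
     in vector [vector [- (s * t) + t ^ 2, s * t, gst],
                vector [s * t, s ^ 2, t ^ 2],
                vector [gst, t ^ 2, hst]])"

definition B_equation :: "(2, 'a::field) mpoly \<Rightarrow> (2, 'a) mpoly \<Rightarrow> 'a biform" where
  "B_equation g h = (\<Sum>i\<in>UNIV. \<Sum>j\<in>UNIV.
     mvar (Inr i) * M_matrix mconst g h (mvar (Inl 1)) (mvar (Inl 2)) $ i $ j * mvar (Inr j))"

text \<open>
  Separability is tested in an algebraically closed extension given by \<open>\<kappa>\<close>.
\<close>

definition sextic_datum ::
    "('a::field \<Rightarrow> 'b::alg_closed_field) \<Rightarrow> 'a poly \<Rightarrow> 'a \<Rightarrow> bool" where
  "sextic_datum \<kappa> F c \<longleftrightarrow> Polynomial.degree F = 6 \<and> lead_coeff F = 1 \<and>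
     rsquarefree (map_poly \<kappa> F) \<and> coeff F 0 = c ^ 2 \<and> c \<noteq> 0"

definition form_pairs :: "'a::field poly \<Rightarrow> ((2, 'a) mpoly \<times> (2, 'a) mpoly) set" where
  "form_pairs F = {(g, h). homogeneous 2 g \<and> homogeneous 2 h \<and>
     det (M_matrix (\<lambda>a. [:a:]) g h 1 [:0, 1:]) = - F}"

abbreviation value_at_10 :: "(2, 'a::field) mpoly \<Rightarrow> 'a" where
  "value_at_10 g \<equiv> meval id (($) (vector [1, 0])) g"

definition selected_pair ::
    "'a::field poly \<Rightarrow> 'a \<Rightarrow> (2, 'a) mpoly \<Rightarrow> (2, 'a) mpoly \<Rightarrow> bool" where
  "selected_pair F c g h \<longleftrightarrow> (g, h) \<in> form_pairs F \<and> value_at_10 g = c"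

text \<open>The parameters \<open>(c, a\<^sub>1, \<dots>, a\<^sub>5)\<close> are \<open>x 0, x 1, \<dots>, x 5\<close>.\<close>

definition sextic_of_params :: "(6 \<Rightarrow> 'a::field) \<Rightarrow> 'a poly" where
  "sextic_of_params x =
     monom 1 6 + (\<Sum>i\<in>{1..5}. monom (x (of_nat i)) i) + [:(x 0) ^ 2:]"

text \<open>
  Parameters in an extension \<open>K\<close> of \<open>k\<close> given by \<open>\<iota>\<close>; \<open>\<kappa>\<close> embeds \<open>K\<close> in an algebraically closed
  field.
\<close>

definition nonsingular_outside ::
    "('k::field \<Rightarrow> 'a::field) \<Rightarrow> ('a \<Rightarrow> 'b::alg_closed_field) \<Rightarrow> (6, 'k) mpoly \<Rightarrow> bool" where
  "nonsingular_outside \<iota> \<kappa> P \<longleftrightarrow>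
     (\<forall>x g h. meval \<iota> x P \<noteq> 0 \<and> sextic_datum \<kappa> (sextic_of_params x) (x 0) \<and>
        selected_pair (sextic_of_params x) (x 0) g h \<longrightarrow>
        nonsingular_curve (Poly_Mapping.map \<kappa> (discriminant_form (B_equation g h))))"

text \<open>
  The base point \<open>(1 : T)\<close> of the generic fibre has coordinates in the function field of the line.
\<close>

definition generic_fibre_form :: "'a::field biform \<Rightarrow> (3, 'a poly fract) mpoly" where
  "generic_fibre_form f =
     fibre1_form (\<lambda>a. to_fract [:a:]) f (vector [1, to_fract [:0, 1:]])"

abbreviation root_points :: "'a::field poly \<Rightarrow> ('a alg_closure ^ 2) set set" where
  "root_points F \<equiv> {proj_pt (vector [1, t0]) | t0. t0 \<in> roots_in_closure F}"

abbreviation reducible_fibre_points :: "'a::field biform \<Rightarrow> ('a alg_closure ^ 2) set set" where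
  "reducible_fibre_points f \<equiv>
     {p \<in> proj_space. \<not> zariski_irreducible (fibre1 (geom_points f) p)}"

end

theory Submission
  imports Defs
begin

text \<open>
  At \<open>(1, T)\<close>, the determinant of \<open>M\<close> is \<open>T\<^sup>5 - (T\<^sup>3 - g)\<^sup>2 - T h\<close>. Comparing coefficients with \<open>- F\<close>
  gives \<open>g(1, 0)\<^sup>2 = c\<^sup>2\<close> and then determines all other coefficients of \<open>g\<close> and \<open>h\<close> successively.
  Where \<open>F(t) \<noteq> 0\<close>, the fibre is a smooth conic, any two points of which lie on a rational curve in the
  conic; so it is irreducible. Where \<open>t = u\<^sup>2\<close> is a root of \<open>F\<close>, the equation of the fibre is a
  difference of two squares. Up to scaling, its two linear factors are obtained by evaluating the same
  polynomials over the ground field at \<open>u\<close> and \<open>- u\<close>, which makes the bijection with the roots of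
  \<open>F(T\<^sup>2)\<close> equivariant. As \<open>F\<close> is separable, the surface is smooth, so that the branch quartic can be singular
  only at a common zero of \<open>Q\<^sub>0, Q\<^sub>1, Q\<^sub>2\<close>. There is none if a certain resultant, a nonzero polynomial
  in the parameters, does not vanish.
\<close>

text \<open>The entry \<open>s ^ 2\<close> of \<open>M\<close> permits completing the square: at
  \<open>s = 1\<close> the form is
  \<open>L^2 - (t T0^2 + 2 (t^3 - g) T0 T2 + (t^4 - h) T2^2)\<close> with
  \<open>L = t T0 + T1 + t^2 T2\<close>. The binary form in brackets has determinant
  \<open>- F(t)\<close> and leading coefficient \<open>t\<close>. At a root of \<open>F\<close> it
  is therefore \<open>t\<close> times a square, and the two lines differ by the sign of the square
  root of \<open>t\<close>; this is why \<open>F(T^2)\<close> governs the Galois action. The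
  condition \<open>c \<noteq> 0\<close> keeps 0 away from the roots, so that six roots have twelve
  square roots. The same identities are needed over \<open>k\<close>, \<open>k[T]\<close>, its
  fraction field, algebraic closures and polynomial rings. They are therefore stated over arbitrary
  rings and transported along ring homomorphisms. Irreducibility concerns sets of closed points.
  Pulling equations back along explicit rational curves reduces it to the fact that a univariate
  polynomial ring is a domain.\<close>

no_notation fps_nth (infixl "$" 75)

section \<open>Evaluation and differentiation of polynomials\<close>

locale comm_ring_1_hom =
  fixes \<iota> :: "'a::comm_ring_1 \<Rightarrow> 'r::comm_ring_1"
  assumes hom_one: "\<iota> 1 = 1"
    and hom_add: "\<iota> (a + b) = \<iota> a + \<iota> b"
    and hom_mult: "\<iota> (a * b) = \<iota> a * \<iota> b"
begin

lemma hom_zero: "\<iota> 0 = 0"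
  using hom_add[of 0 0] by simp

lemma hom_uminus: "\<iota> (- a) = - \<iota> a"
  using hom_add[of a "- a"] by (simp add: hom_zero eq_neg_iff_add_eq_0 add.commute)

lemma hom_minus: "\<iota> (a - b) = \<iota> a - \<iota> b"
  using hom_add[of a "- b"] by (simp add: hom_uminus)

lemma hom_power: "\<iota> (a ^ n) = \<iota> a ^ n"
  by (induction n) (simp_all add: hom_one hom_mult)

lemma hom_sum: "\<iota> (sum f A) = (\<Sum>x\<in>A. \<iota> (f x))"
  by (induction A rule: infinite_finite_induct) (simp_all add: hom_zero hom_add)

lemma hom_of_nat: "\<iota> (of_nat n) = of_nat n"
  by (induction n) (simp_all add: hom_zero hom_one hom_add)

lemma hom_numeral: "\<iota> (numeral n) = numeral n"
  using hom_of_nat[of "numeral n"] by simp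

lemmas hom_simps = hom_zero hom_one hom_add hom_mult hom_uminus hom_minus hom_power hom_numeral

end

lemma comm_ring_1_hom_id: "comm_ring_1_hom id"
  by unfold_locales auto

lemma comm_ring_1_hom_compose:
  assumes "comm_ring_1_hom \<iota>" "comm_ring_1_hom \<kappa>"
  shows "comm_ring_1_hom (\<lambda>a. \<kappa> (\<iota> a))"
  using assms by (simp add: comm_ring_1_hom_def)

lemma comm_ring_1_hom_to_ac: "comm_ring_1_hom to_ac"
  by unfold_locales auto

lemma comm_ring_1_hom_pconst: "comm_ring_1_hom (\<lambda>a. [:a:])"
  by unfold_locales (auto simp: one_pCons)

lemma comm_ring_1_hom_mconst: "comm_ring_1_hom mconst"
  by unfold_locales (simp_all add: mconst_def single_add mult_single)

lemmas mconst_simps = comm_ring_1_hom.hom_simps[OF comm_ring_1_hom_mconst]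

section \<open>Evaluation of multivariate polynomials\<close>

definition monom_eval :: "('v \<Rightarrow> 'r::comm_ring_1) \<Rightarrow> ('v \<Rightarrow>\<^sub>0 nat) \<Rightarrow> 'r" where
  "monom_eval x m = (\<Prod>v\<in>Poly_Mapping.keys m. x v ^ Poly_Mapping.lookup m v)"

lemma monom_eval_superset:
  assumes "finite A" "Poly_Mapping.keys m \<subseteq> A"
  shows "monom_eval x m = (\<Prod>v\<in>A. x v ^ Poly_Mapping.lookup m v)"
  unfolding monom_eval_def using assms
  by (intro prod.mono_neutral_left) (auto simp: in_keys_iff)

lemma monom_eval_add: "monom_eval x (m + n) = monom_eval x m * monom_eval x n"
proof -
  define A where "A = Poly_Mapping.keys m \<union> Poly_Mapping.keys n"
  have A: "finite A" "Poly_Mapping.keys m \<subseteq> A" "Poly_Mapping.keys n \<subseteq> A"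
    "Poly_Mapping.keys (m + n) \<subseteq> A"
    using keys_add[of m n] by (auto simp: A_def)
  show ?thesis
    by (simp add: monom_eval_superset[OF A(1)] A lookup_add power_add prod.distrib)
qed

lemma monom_eval_zero [simp]: "monom_eval x 0 = 1"
  by (simp add: monom_eval_def)

lemma monom_eval_single [simp]: "monom_eval x (Poly_Mapping.single v n) = x v ^ n"
  by (simp add: monom_eval_def)

lemma mpoly_induct [case_names single add]:
  fixes p :: "('v, 'a::comm_ring_1) mpoly"
  assumes "\<And>m a. P (Poly_Mapping.single m a)"
    and "\<And>p q. P p \<Longrightarrow> P q \<Longrightarrow> P (p + q)"
  shows "P p"
proof (induction p rule: update_induct)
  case const
  show ?case using assms(1)[of 0 0] by simp
next
  case (update p m a)
  have "Poly_Mapping.update m a p = p + Poly_Mapping.single m a"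
    using update.hyps
    by (intro poly_mapping_eqI) (auto simp: lookup_update lookup_add lookup_single when_def in_keys_iff)
  then show ?case
    using assms update.IH by simp
qed

text \<open>The key sets of \<open>p\<close> and \<open>q\<close> may overlap and coefficients may
  cancel in \<open>p + q\<close>; additivity of the summand in the coefficient absorbs both. This
  serves evaluation as well as differentiation.\<close>

lemma sum_keys_add:
  fixes f :: "('v \<Rightarrow>\<^sub>0 nat) \<Rightarrow> 'a::comm_ring_1 \<Rightarrow> 'b::comm_monoid_add"
  assumes "\<And>m. f m 0 = 0" "\<And>m a b. f m (a + b) = f m a + f m b"
  shows "(\<Sum>m\<in>Poly_Mapping.keys (p + q). f m (Poly_Mapping.lookup (p + q) m)) =
    (\<Sum>m\<in>Poly_Mapping.keys p. f m (Poly_Mapping.lookup p m)) +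
    (\<Sum>m\<in>Poly_Mapping.keys q. f m (Poly_Mapping.lookup q m))"
  using assms by (rule setsum_keys_plus_distrib)

context comm_ring_1_hom
begin

lemma meval_altdef:
  "meval \<iota> x p = (\<Sum>m\<in>Poly_Mapping.keys p. \<iota> (Poly_Mapping.lookup p m) * monom_eval x m)"
  by (simp add: meval_def monom_eval_def)

lemma meval_add: "meval \<iota> x (p + q) = meval \<iota> x p + meval \<iota> x q"
  unfolding meval_altdef
  by (rule sum_keys_add) (auto simp: hom_zero hom_add algebra_simps)

lemma meval_single: "meval \<iota> x (Poly_Mapping.single m a) = \<iota> a * monom_eval x m"
  by (simp add: meval_altdef hom_zero)

lemma meval_mult: "meval \<iota> x (p * q) = meval \<iota> x p * meval \<iota> x q"
proof (induction p rule: mpoly_induct)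
  case (single m a)
  show ?case
    by (induction q rule: mpoly_induct)
      (simp_all add: mult_single meval_single monom_eval_add hom_mult meval_add algebra_simps)
qed (simp add: meval_add algebra_simps)

lemma comm_ring_1_hom_meval: "comm_ring_1_hom (meval \<iota> x)"
proof unfold_locales
  show "meval \<iota> x 1 = 1"
    using meval_single[of x 0 1] by (simp add: hom_one)
qed (simp_all add: meval_add meval_mult)

lemma meval_mvar: "meval \<iota> x (mvar v) = x v"
  by (simp add: mvar_def meval_single hom_one)

lemma meval_mconst: "meval \<iota> x (mconst a) = \<iota> a"
  by (simp add: mconst_def meval_single)

lemmas meval_simps = comm_ring_1_hom.hom_simps[OF comm_ring_1_hom_meval] meval_mvar meval_mconst

end

text \<open>Uniqueness in the universal property of the polynomial ring: every monomial is a product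
  of powers of variables. This replaces computations with coefficients in the changes of base
  below.\<close>

lemma mpoly_hom_eqI:
  assumes "comm_ring_1_hom \<Phi>" "comm_ring_1_hom \<Psi>"
    and "\<And>a. \<Phi> (mconst a) = \<Psi> (mconst a)" "\<And>v. \<Phi> (mvar v) = \<Psi> (mvar v)"
  shows "\<Phi> p = \<Psi> (p :: ('v, 'a::comm_ring_1) mpoly)"
proof (induction p rule: mpoly_induct)
  interpret \<Phi>: comm_ring_1_hom \<Phi> by fact
  interpret \<Psi>: comm_ring_1_hom \<Psi> by fact
  case (single m a)
  have 1: "\<Phi> (Poly_Mapping.single m 1) = \<Psi> (Poly_Mapping.single m 1)"
  proof (induction m rule: update_induct)
    case const
    then show ?case by (simp add: \<Phi>.hom_one \<Psi>.hom_one)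
  next
    case (update m v n)
    have eq: "Poly_Mapping.update v n m = m + Poly_Mapping.single v n"
      using update.hyps
      by (intro poly_mapping_eqI) (auto simp: lookup_update lookup_add lookup_single when_def in_keys_iff)
    have pow: "Poly_Mapping.single (Poly_Mapping.single v n) 1 = (mvar v :: ('v, 'a) mpoly) ^ n" for n
    proof (induction n)
      case (Suc n)
      have "Poly_Mapping.single (Poly_Mapping.single v (Suc n)) 1 =
          (mvar v :: ('v, 'a) mpoly) * Poly_Mapping.single (Poly_Mapping.single v n) 1"
        by (simp add: mvar_def mult_single flip: single_add)
      then show ?case by (simp add: Suc)
    qed simp
    have "Poly_Mapping.single (Poly_Mapping.update v n m) 1 =
        Poly_Mapping.single m 1 * (mvar v :: ('v, 'a) mpoly) ^ n"
      by (simp add: eq mult_single flip: pow)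
    then show ?case
      by (simp add: \<Phi>.hom_simps \<Psi>.hom_simps assms update.IH)
  qed
  have "Poly_Mapping.single m a = mconst a * Poly_Mapping.single m 1"
    by (simp add: mconst_def mult_single)
  then show ?case
    by (simp add: \<Phi>.hom_simps \<Psi>.hom_simps assms 1)
next
  case (add p q)
  with assms(1,2) show ?case by (simp add: comm_ring_1_hom.hom_add)
qed

lemma meval_mconst_mvar: "meval mconst mvar p = p"
  by (rule mpoly_hom_eqI[of "meval mconst mvar" id, simplified])
    (simp_all add: comm_ring_1_hom.comm_ring_1_hom_meval comm_ring_1_hom_mconst
      comm_ring_1_hom_id comm_ring_1_hom.meval_simps)

lemma hom_meval:
  assumes \<Phi>: "comm_ring_1_hom \<Phi>" and \<iota>: "comm_ring_1_hom \<iota>"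
  shows "\<Phi> (meval \<iota> x p) = meval (\<lambda>a. \<Phi> (\<iota> a)) (\<lambda>v. \<Phi> (x v)) p"
proof (rule mpoly_hom_eqI)
  note * = comm_ring_1_hom_compose[OF \<iota> \<Phi>]
  show "comm_ring_1_hom (\<lambda>p. \<Phi> (meval \<iota> x p))"
    by (intro comm_ring_1_hom_compose[OF _ \<Phi>] comm_ring_1_hom.comm_ring_1_hom_meval \<iota>)
  show "comm_ring_1_hom (meval (\<lambda>a. \<Phi> (\<iota> a)) (\<lambda>v. \<Phi> (x v)))"
    by (intro comm_ring_1_hom.comm_ring_1_hom_meval *)
qed (simp_all add: comm_ring_1_hom.meval_simps[OF \<iota>]
    comm_ring_1_hom.meval_simps[OF comm_ring_1_hom_compose[OF \<iota> \<Phi>]])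

text \<open>Seen as an evaluation, the coefficientwise map inherits multiplicativity.\<close>

lemma map_mpoly_eq_meval:
  assumes \<kappa>: "comm_ring_1_hom \<kappa>"
  shows "Poly_Mapping.map \<kappa> p = meval (\<lambda>a. mconst (\<kappa> a)) mvar p"
proof (induction p rule: mpoly_induct)
  have h: "comm_ring_1_hom (\<lambda>a. mconst (\<kappa> a) :: ('v, 'b) mpoly)"
    using \<kappa> comm_ring_1_hom_mconst by (rule comm_ring_1_hom_compose)
  interpret \<kappa>: comm_ring_1_hom \<kappa> by fact
  interpret h: comm_ring_1_hom "\<lambda>a. mconst (\<kappa> a) :: ('v, 'b) mpoly" by fact
  {
    case (single m a)
    have "meval mconst mvar (Poly_Mapping.single m (\<kappa> a)) = mconst (\<kappa> a) * monom_eval mvar m"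
      by (rule comm_ring_1_hom.meval_single[OF comm_ring_1_hom_mconst])
    then show ?case
      by (simp add: h.meval_single meval_mconst_mvar \<kappa>.hom_zero)
  next
    case (add p q)
    have "Poly_Mapping.map \<kappa> (p + q) = Poly_Mapping.map \<kappa> p + Poly_Mapping.map \<kappa> q"
      by (intro poly_mapping_eqI)
        (auto simp: Poly_Mapping.map.rep_eq lookup_add when_def \<kappa>.hom_zero simp flip: \<kappa>.hom_add)
    with add show ?case by (simp add: h.meval_add)
  }
qed

lemma comm_ring_1_hom_map_mpoly:
  assumes \<kappa>: "comm_ring_1_hom \<kappa>"
  shows "comm_ring_1_hom (Poly_Mapping.map \<kappa> :: ('v, _) mpoly \<Rightarrow> _)"
proof -
  have "(Poly_Mapping.map \<kappa> :: ('v, _) mpoly \<Rightarrow> _) = meval (\<lambda>a. mconst (\<kappa> a)) mvar"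
    by (rule ext) (rule map_mpoly_eq_meval[OF \<kappa>])
  then show ?thesis
    by (simp add: comm_ring_1_hom.comm_ring_1_hom_meval
      comm_ring_1_hom_compose[OF \<kappa> comm_ring_1_hom_mconst])
qed

lemma meval_map_mpoly:
  assumes \<kappa>: "comm_ring_1_hom \<kappa>" and \<iota>: "comm_ring_1_hom \<iota>"
  shows "meval \<iota> x (Poly_Mapping.map \<kappa> p) = meval (\<lambda>a. \<iota> (\<kappa> a)) x p"
  by (simp add: map_mpoly_eq_meval[OF \<kappa>] comm_ring_1_hom.meval_simps[OF \<iota>]
    hom_meval[OF comm_ring_1_hom.comm_ring_1_hom_meval[OF \<iota>]
      comm_ring_1_hom_compose[OF \<kappa> comm_ring_1_hom_mconst]])

lemma map_mpoly_mconst_mvar: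
  assumes \<kappa>: "comm_ring_1_hom \<kappa>"
  shows "Poly_Mapping.map \<kappa> (mconst a) = mconst (\<kappa> a)" "Poly_Mapping.map \<kappa> (mvar v) = mvar v"
  by (simp_all add: mconst_def mvar_def comm_ring_1_hom.hom_simps[OF \<kappa>])

lemmas map_mpoly_simps =
  comm_ring_1_hom.hom_simps[OF comm_ring_1_hom_map_mpoly] map_mpoly_mconst_mvar

section \<open>Formal partial derivatives\<close>

lemma mpderiv_add: "mpderiv v (p + q) = mpderiv v p + mpderiv v q"
  unfolding mpderiv_def
  by (rule sum_keys_add) (auto simp: algebra_simps single_add)

lemma mpderiv_single:
  "mpderiv v (Poly_Mapping.single m a) =
    Poly_Mapping.single (m - Poly_Mapping.single v 1) (of_nat (Poly_Mapping.lookup m v) * a)"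
  by (simp add: mpderiv_def)

lemma mpderiv_mult: "mpderiv v (p * q) = mpderiv v p * q + p * mpderiv v q"
proof (induction p rule: mpoly_induct)
  case (single m a)
  show ?case
  proof (induction q rule: mpoly_induct)
    case (single n b)
    let ?e = "Poly_Mapping.single v (Suc 0)"
    \<comment> \<open>Exponents are natural numbers, so subtracting \<open>?e\<close> commutes with
      adding \<open>n\<close> only if \<open>v\<close> occurs in \<open>m\<close>. Otherwise the
      factor \<open>of_nat (Poly_Mapping.lookup m v)\<close> is zero and the term
      disappears.\<close>
    have sub: "m + n - ?e = (m - ?e) + n" if "Poly_Mapping.lookup m v \<noteq> 0" for m n :: "'a \<Rightarrow>\<^sub>0 nat"
      using that by (intro poly_mapping_eqI) (auto simp: lookup_add lookup_minus lookup_single when_def)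
    have 1: "Poly_Mapping.single (m + n - ?e) (of_nat (Poly_Mapping.lookup m v) * (a * b)) =
        Poly_Mapping.single (m - ?e + n) (of_nat (Poly_Mapping.lookup m v) * (a * b))"
      by (cases "Poly_Mapping.lookup m v = 0") (simp_all add: sub)
    have 2: "Poly_Mapping.single (m + n - ?e) (of_nat (Poly_Mapping.lookup n v) * (a * b)) =
        Poly_Mapping.single (m + (n - ?e)) (of_nat (Poly_Mapping.lookup n v) * (a * b))"
      using sub[of n m] by (cases "Poly_Mapping.lookup n v = 0") (simp_all add: add.commute)
    show ?case
      by (simp add: mult_single mpderiv_single lookup_add distrib_right single_add mult.assoc
        1[simplified mult.assoc] 2[simplified mult.assoc] mult.left_commute[of a])
  qed (simp add: mpderiv_add algebra_simps)
qed (simp add: mpderiv_add algebra_simps)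

lemma mpderiv_mconst [simp]: "mpderiv v (mconst a) = 0"
  by (simp add: mconst_def mpderiv_single)

lemma mpderiv_mvar: "mpderiv v (mvar w) = (if v = w then 1 else 0)"
  by (simp add: mvar_def mpderiv_single lookup_single)

lemma mpderiv_uminus: "mpderiv v (- p) = - mpderiv v p"
proof -
  have "mpderiv v 0 = (0 :: ('a, 'b) mpoly)"
    by (simp add: mpderiv_def)
  then have "mpderiv v p + mpderiv v (- p) = 0"
    by (simp flip: mpderiv_add)
  then show ?thesis by (simp add: add_eq_0_iff)
qed

lemma mpderiv_minus: "mpderiv v (p - q) = mpderiv v p - mpderiv v q"
  using mpderiv_add[of v p "- q"] by (simp add: mpderiv_uminus)

lemma mpderiv_numeral [simp]: "mpderiv v (numeral n) = 0"
  using mpderiv_mconst[of v "numeral n"] by (simp only: mconst_simps)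

lemmas mpderiv_simps = mpderiv_add mpderiv_mult mpderiv_minus mpderiv_mvar mpderiv_mconst
  mpderiv_numeral power2_eq_square

section \<open>Homogeneous and bihomogeneous polynomials\<close>

lemma homogeneous_add: "homogeneous d p \<Longrightarrow> homogeneous d q \<Longrightarrow> homogeneous d (p + q)"
  using keys_add[of p q] by (fastforce simp: homogeneous_def)

lemma homogeneous_uminus: "homogeneous d p \<Longrightarrow> homogeneous d (- p)"
  by (simp add: homogeneous_def)

lemma homogeneous_minus: "homogeneous d p \<Longrightarrow> homogeneous d q \<Longrightarrow> homogeneous d (p - q)"
  using homogeneous_add[of d p "- q"] by (simp add: homogeneous_uminus)

lemma homogeneous_mult: "homogeneous d p \<Longrightarrow> homogeneous e q \<Longrightarrow> homogeneous (d + e) (p * q)"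
  unfolding homogeneous_def using keys_mult[of p q]
  by (fastforce simp: lookup_add sum.distrib)

lemma homogeneous_mconst: "homogeneous 0 (mconst a)"
  by (simp add: homogeneous_def mconst_def)

lemma homogeneous_mvar: "homogeneous 1 (mvar v)"
  by (simp add: homogeneous_def mvar_def lookup_single when_def)

lemma bihomogeneous_add: "bihomogeneous d e p \<Longrightarrow> bihomogeneous d e q \<Longrightarrow> bihomogeneous d e (p + q)"
  using keys_add[of p q] by (fastforce simp: bihomogeneous_def)

lemma bihomogeneous_uminus: "bihomogeneous d e p \<Longrightarrow> bihomogeneous d e (- p)"
  by (simp add: bihomogeneous_def)

lemma bihomogeneous_minus:
  "bihomogeneous d e p \<Longrightarrow> bihomogeneous d e q \<Longrightarrow> bihomogeneous d e (p - q)"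
  using bihomogeneous_add[of d e p "- q"] by (simp add: bihomogeneous_uminus)

lemma bihomogeneous_mult:
  "bihomogeneous d e p \<Longrightarrow> bihomogeneous d' e' q \<Longrightarrow> bihomogeneous (d + d') (e + e') (p * q)"
  unfolding bihomogeneous_def using keys_mult[of p q]
  by (fastforce simp: lookup_add sum.distrib)

lemma bihomogeneous_mconst: "bihomogeneous 0 0 (mconst a)"
  by (simp add: bihomogeneous_def mconst_def)

lemma bihomogeneous_mvar_Inl: "bihomogeneous 1 0 (mvar (Inl v))"
  by (simp add: bihomogeneous_def mvar_def lookup_single when_def)

lemma bihomogeneous_mvar_Inr: "bihomogeneous 0 1 (mvar (Inr v))"
  by (simp add: bihomogeneous_def mvar_def lookup_single when_def)

lemma meval_bihomogeneous_scale:
  assumes \<iota>: "comm_ring_1_hom \<iota>" and f: "bihomogeneous d e f"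
  shows "meval \<iota> (case_sum (\<lambda>i. a * x i) (\<lambda>j. b * y j)) f =
    a ^ d * b ^ e * meval \<iota> (case_sum x y) f"
proof -
  interpret \<iota>: comm_ring_1_hom \<iota> by fact
  have "monom_eval (case_sum (\<lambda>i. a * x i) (\<lambda>j. b * y j)) m = a ^ d * b ^ e * monom_eval (case_sum x y) m"
    if "m \<in> Poly_Mapping.keys f" for m
  proof -
    have "monom_eval z m = (\<Prod>v\<in>UNIV. z (Inl v) ^ Poly_Mapping.lookup m (Inl v)) *
        (\<Prod>v\<in>UNIV. z (Inr v) ^ Poly_Mapping.lookup m (Inr v))" for z :: "_ \<Rightarrow> 'b"
      unfolding monom_eval_superset[OF finite subset_UNIV]
      unfolding UNIV_sum
      by (subst prod.union_disjoint) (auto simp: prod.reindex)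
    moreover have "d = (\<Sum>v\<in>UNIV. Poly_Mapping.lookup m (Inl v))"
      "e = (\<Sum>v\<in>UNIV. Poly_Mapping.lookup m (Inr v))"
      using f that by (auto simp: bihomogeneous_def)
    ultimately show ?thesis
      by (simp add: power_mult_distrib prod.distrib power_sum mult_ac)
  qed
  then show ?thesis
    by (simp add: \<iota>.meval_altdef sum_distrib_left mult_ac)
qed

section \<open>Zariski topology and lines\<close>

text \<open>Euclid's argument: over a finite field, one plus the product of all \<open>X - a\<close>
  has positive degree but takes the value 1 everywhere.\<close>

lemma infinite_UNIV_alg_closed_field: "infinite (UNIV :: 'a::alg_closed_field set)"
proof
  assume fin: "finite (UNIV :: 'a set)"
  define p :: "'a poly" where "p = (\<Prod>a\<in>UNIV. [:- a, 1:]) + 1"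
  have "poly (\<Prod>a\<in>UNIV. [:- a, 1:]) x = 0" for x :: 'a
    using fin by (auto simp: poly_prod)
  then have "poly p x = 1" for x
    by (simp add: p_def)
  moreover have "0 < Polynomial.degree (\<Prod>a\<in>(UNIV :: 'a set). [:- a, 1:])"
    using fin by (subst degree_prod_eq_sum_degree) (auto simp: card_gt_0_iff)
  then have "Polynomial.degree p > 0"
    unfolding p_def by (subst degree_add_eq_left) auto
  ultimately show False
    using alg_closed_imp_poly_has_root[of p] by auto
qed

section \<open>Points of projective space and zero loci\<close>

lemma proj_pt_eq_iff: "proj_pt x = proj_pt y \<longleftrightarrow> (\<exists>c. c \<noteq> 0 \<and> x = c *s y)"
proof
  assume "proj_pt x = proj_pt y"
  moreover have "x \<in> proj_pt x"
    unfolding proj_pt_def by (auto intro!: exI[of _ 1])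
  ultimately show "\<exists>c. c \<noteq> 0 \<and> x = c *s y"
    by (auto simp: proj_pt_def)
next
  assume "\<exists>c. c \<noteq> 0 \<and> x = c *s y"
  then obtain c where c: "c \<noteq> 0" "x = c *s y" by blast
  show "proj_pt x = proj_pt y"
  proof (intro subset_antisym subsetI)
    fix z assume "z \<in> proj_pt x"
    then obtain d where "d \<noteq> 0" "z = d *s x" by (auto simp: proj_pt_def)
    then show "z \<in> proj_pt y"
      using c by (auto simp: proj_pt_def intro!: exI[of _ "d * c"])
  next
    fix z assume "z \<in> proj_pt y"
    then obtain d where "d \<noteq> 0" "z = d *s y" by (auto simp: proj_pt_def)
    then show "z \<in> proj_pt x"
      using c by (auto simp: proj_pt_def intro!: exI[of _ "d / c"])
  qed
qed

lemma proj_pt_scale: "c \<noteq> 0 \<Longrightarrow> proj_pt (c *s x) = proj_pt x"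
  by (auto simp: proj_pt_eq_iff)

lemma vec2_nonzero: "(x :: 'a::zero ^ 2) \<noteq> 0 \<longleftrightarrow> x $ 1 \<noteq> 0 \<or> x $ 2 \<noteq> 0"
  by (auto simp: vec_eq_iff forall_2)

lemma vec3_nonzero: "(x :: 'a::zero ^ 3) \<noteq> 0 \<longleftrightarrow> x $ 1 \<noteq> 0 \<or> x $ 2 \<noteq> 0 \<or> x $ 3 \<noteq> 0"
  by (auto simp: vec_eq_iff forall_3)

lemma proj_pt_eq_iff_line:
  assumes "x \<noteq> 0" "y \<noteq> 0"
  shows "proj_pt x = proj_pt (y :: 'a::field ^ 2) \<longleftrightarrow> y $ 2 * x $ 1 = y $ 1 * x $ 2"
proof
  assume "proj_pt x = proj_pt y"
  then show "y $ 2 * x $ 1 = y $ 1 * x $ 2"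
    by (auto simp: proj_pt_eq_iff)
next
  assume eq: "y $ 2 * x $ 1 = y $ 1 * x $ 2"
  define c where "c = (if y $ 1 = 0 then x $ 2 / y $ 2 else x $ 1 / y $ 1)"
  have "x = c *s y" "c \<noteq> 0"
    using assms eq by (auto simp: c_def vec_eq_iff forall_2 field_simps vec2_nonzero split: if_splits)
  then show "proj_pt x = proj_pt y"
    by (auto simp: proj_pt_eq_iff)
qed

lemma meval_bihomogeneous_scale_vec:
  fixes x :: "'b::field ^ 2" and y :: "'b ^ 3"
  assumes "comm_ring_1_hom \<iota>" "bihomogeneous d e f"
  shows "meval \<iota> (case_sum (($) (a *s x)) (($) (b *s y))) f =
    a ^ d * b ^ e * meval \<iota> (case_sum (($) x) (($) y)) f"
  using meval_bihomogeneous_scale[OF assms, of a "($) x" b "($) y"]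
  by (simp add: vector_smult_component[abs_def])

text \<open>\<open>zero_locus\<close> only asks for some representative at which the equations hold.
  By bihomogeneity a change of representative multiplies each value by a scalar, so any
  representative may be tested.\<close>

lemma mem_zero_locus_iff:
  fixes x :: "'b::field ^ 2" and y :: "'b ^ 3"
  assumes S: "\<forall>f\<in>S. \<exists>d e. bihomogeneous d e f" and nz: "x \<noteq> 0" "y \<noteq> 0"
  shows "(proj_pt x, proj_pt y) \<in> zero_locus S \<longleftrightarrow>
    (\<forall>f\<in>S. meval id (case_sum (($) x) (($) y)) f = 0)"
proof
  assume "(proj_pt x, proj_pt y) \<in> zero_locus S"
  then obtain x' y' where eq: "proj_pt x = proj_pt x'" "proj_pt y = proj_pt y'"
    and 0: "\<forall>f\<in>S. meval id (case_sum (($) x') (($) y')) f = 0"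
    by (auto simp: zero_locus_def)
  from eq obtain a b where "x = a *s x'" "y = b *s y'"
    by (auto simp: proj_pt_eq_iff)
  then show "\<forall>f\<in>S. meval id (case_sum (($) x) (($) y)) f = 0"
    using S 0 by (metis meval_bihomogeneous_scale_vec[OF comm_ring_1_hom_id] mult_zero_right)
qed (use nz in \<open>auto simp: zero_locus_def\<close>)

text \<open>
  If \<open>Z\<close> is covered by \<open>A \<union> B\<close> with \<open>f = 0\<close> on \<open>A\<close>, \<open>k = 0\<close> on \<open>B\<close>, then the product of the
  pullbacks of \<open>f\<close> and \<open>k\<close> to a rational curve in \<open>Z\<close> vanishes; hence one of them does.
\<close>

lemma zariski_irreducible_rational_curves:
  fixes x :: "'b::alg_closed_field ^ 2"
  assumes x: "x \<noteq> 0" and ne: "\<exists>y. y \<noteq> 0 \<and> P y"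
    and curve: "\<And>y1 y2. y1 \<noteq> 0 \<Longrightarrow> P y1 \<Longrightarrow> y2 \<noteq> 0 \<Longrightarrow> P y2 \<Longrightarrow>
      \<exists>Y :: 'b poly ^ 3. (\<forall>\<tau>. P (\<chi> i. poly (Y $ i) \<tau>)) \<and>
        (\<exists>\<tau> c. c \<noteq> 0 \<and> (\<chi> i. poly (Y $ i) \<tau>) = c *s y1) \<and>
        (\<exists>\<tau> c. c \<noteq> 0 \<and> (\<chi> i. poly (Y $ i) \<tau>) = c *s y2)"
  shows "zariski_irreducible {(proj_pt x, proj_pt y) | y. y \<noteq> 0 \<and> P y}" (is "zariski_irreducible ?Z")
  unfolding zariski_irreducible_def
proof (intro conjI allI impI)
  show "?Z \<noteq> {}" using ne by blast
next
  fix A B assume *: "zariski_closed A \<and> zariski_closed B \<and> ?Z \<subseteq> A \<union> B"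
  then obtain S T where S: "\<forall>f\<in>S. \<exists>d e. bihomogeneous d e f" "A = zero_locus S"
    and T: "\<forall>f\<in>T. \<exists>d e. bihomogeneous d e f" "B = zero_locus T"
    by (auto simp: zariski_closed_def)
  show "?Z \<subseteq> A \<or> ?Z \<subseteq> B"
  proof (rule ccontr)
    assume "\<not> (?Z \<subseteq> A \<or> ?Z \<subseteq> B)"
    then obtain y1 y2 where y1: "y1 \<noteq> 0" "P y1" "(proj_pt x, proj_pt y1) \<notin> A"
      and y2: "y2 \<noteq> 0" "P y2" "(proj_pt x, proj_pt y2) \<notin> B"
      by blast
    obtain f where f: "f \<in> S" "meval id (case_sum (($) x) (($) y1)) f \<noteq> 0"
      using y1 x S by (auto simp: mem_zero_locus_iff)
    obtain k where k: "k \<in> T" "meval id (case_sum (($) x) (($) y2)) k \<noteq> 0"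
      using y2 x T by (auto simp: mem_zero_locus_iff)
    obtain Y :: "'b poly ^ 3" and \<tau>1 c1 \<tau>2 c2 where Y: "\<And>\<tau>. P (\<chi> i. poly (Y $ i) \<tau>)"
      and 1: "c1 \<noteq> 0" "(\<chi> i. poly (Y $ i) \<tau>1) = c1 *s y1"
      and 2: "c2 \<noteq> 0" "(\<chi> i. poly (Y $ i) \<tau>2) = c2 *s y2"
      using curve[OF y1(1,2) y2(1,2)] by blast
    define pull :: "'b biform \<Rightarrow> 'b poly"
      where "pull = meval (\<lambda>a. [:a:]) (case_sum (\<lambda>i. [:x $ i:]) (($) Y))"
    have pull: "poly (pull p) \<tau> = meval id (case_sum (($) x) (($) (\<chi> i. poly (Y $ i) \<tau>))) p" for p \<tau>
    proof -
      have hom: "comm_ring_1_hom (\<lambda>p. poly p \<tau>)"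
        by unfold_locales auto
      have "(\<lambda>v. poly (case v of Inl i \<Rightarrow> [:x $ i:] | Inr j \<Rightarrow> Y $ j) \<tau>) =
          case_sum (($) x) (($) (\<chi> i. poly (Y $ i) \<tau>))"
        by (auto simp: fun_eq_iff split: sum.split)
      then show ?thesis
        unfolding pull_def by (simp add: hom_meval[OF hom comm_ring_1_hom_pconst] id_def)
    qed
    obtain d e where "bihomogeneous d e f" using S f by blast
    from meval_bihomogeneous_scale_vec[OF comm_ring_1_hom_id this, of 1 x c1 y1]
    have "poly (pull f) \<tau>1 \<noteq> 0" using f 1 by (simp add: pull)
    then have "pull f \<noteq> 0" by auto
    moreover obtain d e where "bihomogeneous d e k" using T k by blast
    from meval_bihomogeneous_scale_vec[OF comm_ring_1_hom_id this, of 1 x c2 y2]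
    have "poly (pull k) \<tau>2 \<noteq> 0" using k 2 by (simp add: pull)
    then have "pull k \<noteq> 0" by auto
    moreover obtain i where "y1 $ i \<noteq> 0" using y1(1) by (auto simp: vec_eq_iff)
    with 1 have "poly (Y $ i) \<tau>1 \<noteq> 0" by (auto simp: vec_eq_iff)
    then have "Y $ i \<noteq> 0" by auto
    \<comment> \<open>The factor \<open>Y $ i\<close> makes sure that the point of the curve chosen
      below is not the zero vector, which \<open>P\<close> does not exclude.\<close>
    ultimately have "pull f * pull k * Y $ i \<noteq> 0" by simp
    then have "finite {\<tau>. poly (pull f * pull k * Y $ i) \<tau> = 0}"
      by (rule poly_roots_finite)
    then have "{\<tau>. poly (pull f * pull k * Y $ i) \<tau> = 0} \<noteq> UNIV"
      using infinite_UNIV_alg_closed_field[where 'a='b] by metis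
    then obtain \<tau> where \<tau>: "poly (pull f * pull k * Y $ i) \<tau> \<noteq> 0"
      by blast
    define y :: "'b ^ 3" where "y = (\<chi> i. poly (Y $ i) \<tau>)"
    have "y $ i \<noteq> 0" using \<tau> by (simp add: y_def)
    then have "y \<noteq> 0" by auto
    moreover have "P y" using Y by (simp add: y_def)
    ultimately have "(proj_pt x, proj_pt y) \<in> A \<union> B" using * by blast
    then have "poly (pull f) \<tau> = 0 \<or> poly (pull k) \<tau> = 0"
      using x \<open>y \<noteq> 0\<close> S T f(1) k(1) by (auto simp: mem_zero_locus_iff pull simp flip: y_def)
    with \<tau> show False by auto
  qed
qed

text \<open>An irreducible subset of a union of two closed sets lies in one of them, which leaves
  only \<open>L1\<close> and \<open>L2\<close> as maximal ones.\<close>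

lemma irreducible_components_Un:
  assumes "zariski_closed L1" "zariski_irreducible L1" "zariski_closed L2" "zariski_irreducible L2"
    and "\<not> L1 \<subseteq> L2" "\<not> L2 \<subseteq> L1"
  shows "irreducible_components (L1 \<union> L2) = {L1, L2}"
proof -
  have *: "Z \<subseteq> L1 \<or> Z \<subseteq> L2" if "zariski_irreducible Z" "Z \<subseteq> L1 \<union> L2" for Z
    using that assms(1,3) unfolding zariski_irreducible_def by blast
  show ?thesis
  proof (intro subset_antisym subsetI)
    fix Z assume "Z \<in> irreducible_components (L1 \<union> L2)"
    then have Z: "Z \<subseteq> L1 \<union> L2" "zariski_irreducible Z"
      and max: "\<And>Z'. zariski_closed Z' \<Longrightarrow> zariski_irreducible Z' \<Longrightarrow> Z \<subseteq> Z' \<Longrightarrow>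
        Z' \<subseteq> L1 \<union> L2 \<Longrightarrow> Z' = Z"
      unfolding irreducible_components_def by blast+
    from *[OF Z(2,1)] show "Z \<in> {L1, L2}"
      using max[of L1] max[of L2] assms by blast
  next
    fix Z assume "Z \<in> {L1, L2}"
    then show "Z \<in> irreducible_components (L1 \<union> L2)"
      using assms * unfolding irreducible_components_def by fast
  qed
qed

lemma not_zariski_irreducible_Un:
  assumes "zariski_closed L1" "zariski_closed L2" "\<not> L1 \<subseteq> L2" "\<not> L2 \<subseteq> L1"
  shows "\<not> zariski_irreducible (L1 \<union> L2)"
  using assms unfolding zariski_irreducible_def by blast

section \<open>Lines in the fibres\<close>

lemma mem_vertical_line_iff:
  assumes "y \<noteq> 0"
  shows "(p, proj_pt y) \<in> vertical_line x a \<longleftrightarrow> p = proj_pt x \<and> (\<Sum>i\<in>UNIV. a $ i * y $ i) = 0"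
proof
  assume "(p, proj_pt y) \<in> vertical_line x a"
  then obtain y' where p: "p = proj_pt x" and "proj_pt y = proj_pt y'" and
    0: "(\<Sum>i\<in>UNIV. a $ i * y' $ i) = 0"
    by (auto simp: vertical_line_def)
  then obtain c where "y = c *s y'" by (auto simp: proj_pt_eq_iff)
  then have "(\<Sum>i\<in>UNIV. a $ i * y $ i) = c * (\<Sum>i\<in>UNIV. a $ i * y' $ i)"
    by (simp add: sum_distrib_left mult_ac)
  with p 0 show "p = proj_pt x \<and> (\<Sum>i\<in>UNIV. a $ i * y $ i) = 0" by simp
qed (use assms in \<open>auto simp: vertical_line_def\<close>)

lemma zariski_closed_vertical_line:
  fixes x :: "'b::alg_closed_field ^ 2"
  assumes x: "x \<noteq> 0"
  shows "zariski_closed (vertical_line x a)"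
proof -
  define p :: "'b biform"
    where "p = mconst (x $ 2) * mvar (Inl 1) - mconst (x $ 1) * mvar (Inl 2)"
  define q :: "'b biform"
    where "q = mconst (a $ 1) * mvar (Inr 1) + mconst (a $ 2) * mvar (Inr 2) + mconst (a $ 3) * mvar (Inr 3)"
  \<comment> \<open>The degrees remain unevaluated sums so that they match the rule for
    products.\<close>
  have bi: "bihomogeneous (0 + 1) (0 + 0) p" "bihomogeneous (0 + 0) (0 + 1) q"
    unfolding p_def q_def
    by (intro bihomogeneous_minus bihomogeneous_add bihomogeneous_mult bihomogeneous_mconst
      bihomogeneous_mvar_Inl bihomogeneous_mvar_Inr)+
  have ev: "meval id (case_sum (($) x') (($) y)) p = x $ 2 * x' $ 1 - x $ 1 * x' $ 2"
    "meval id (case_sum (($) x') (($) y)) q = (\<Sum>i\<in>UNIV. a $ i * y $ i)" for x' y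
    by (simp_all add: p_def q_def comm_ring_1_hom.meval_simps[OF comm_ring_1_hom_id] sum_3)
  have "vertical_line x a = zero_locus {p, q}"
  proof (intro subset_antisym subsetI)
    fix z assume "z \<in> vertical_line x a"
    then show "z \<in> zero_locus {p, q}"
      using x by (auto simp: vertical_line_def zero_locus_def ev mult.commute)
  next
    fix z assume "z \<in> zero_locus {p, q}"
    then obtain x' y where z: "z = (proj_pt x', proj_pt y)" and nz: "x' \<noteq> 0" "y \<noteq> 0"
      and eqs: "x $ 2 * x' $ 1 = x $ 1 * x' $ 2" "(\<Sum>i\<in>UNIV. a $ i * y $ i) = 0"
      unfolding zero_locus_def by (auto simp: ev)
    from eqs(1) have "proj_pt x' = proj_pt x"
      using x nz by (simp add: proj_pt_eq_iff_line)
    with z nz eqs show "z \<in> vertical_line x a"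
      by (simp add: mem_vertical_line_iff)
  qed
  moreover have "\<forall>f\<in>{p, q}. \<exists>d e. bihomogeneous d e f"
    using bi by blast
  ultimately show ?thesis
    unfolding zariski_closed_def by (intro exI[of _ "{p, q}"] conjI)
qed

lemma zariski_irreducible_vertical_line:
  fixes x :: "'b::alg_closed_field ^ 2"
  assumes x: "x \<noteq> 0"
  shows "zariski_irreducible (vertical_line x a)"
  unfolding vertical_line_def
proof (rule zariski_irreducible_rational_curves[OF x])
  define y :: "'b ^ 3"
    where "y = (if a $ 1 = 0 \<and> a $ 2 = 0 then vector [1, 0, 0] else vector [- a $ 2, a $ 1, 0])"
  have "y \<noteq> 0 \<and> (\<Sum>i\<in>UNIV. a $ i * y $ i) = 0"
    by (auto simp: y_def vec3_nonzero sum_3)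
  then show "\<exists>y. y \<noteq> 0 \<and> (\<Sum>i\<in>UNIV. a $ i * y $ i) = 0" by blast
next
  fix y1 y2 :: "'b ^ 3"
  assume y: "(\<Sum>i\<in>UNIV. a $ i * y1 $ i) = 0" "(\<Sum>i\<in>UNIV. a $ i * y2 $ i) = 0"
  \<comment> \<open>The affine line joining the two representatives, with \<open>y1\<close> at 0 and
    \<open>y2\<close> at 1.\<close>
  define Y :: "'b poly ^ 3" where "Y = (\<chi> i. [:y1 $ i, y2 $ i - y1 $ i:])"
  have "(\<Sum>i\<in>UNIV. a $ i * poly (Y $ i) \<tau>) =
      (1 - \<tau>) * (\<Sum>i\<in>UNIV. a $ i * y1 $ i) + \<tau> * (\<Sum>i\<in>UNIV. a $ i * y2 $ i)" for \<tau>
    by (simp add: Y_def sum_distrib_left algebra_simps flip: sum.distrib sum_subtractf)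
  then have "\<forall>\<tau>. (\<Sum>i\<in>UNIV. a $ i * (\<chi> i. poly (Y $ i) \<tau>) $ i) = 0"
    by (simp add: y)
  moreover have "\<exists>\<tau> c. c \<noteq> 0 \<and> (\<chi> i. poly (Y $ i) \<tau>) = c *s y1"
    by (rule exI[of _ 0], rule exI[of _ 1]) (simp add: Y_def vec_eq_iff)
  moreover have "\<exists>\<tau> c. c \<noteq> 0 \<and> (\<chi> i. poly (Y $ i) \<tau>) = c *s y2"
    by (rule exI[of _ 1], rule exI[of _ 1]) (simp add: Y_def vec_eq_iff)
  ultimately show "\<exists>Y :: 'b poly ^ 3. (\<forall>\<tau>. (\<Sum>i\<in>UNIV. a $ i * (\<chi> i. poly (Y $ i) \<tau>) $ i) = 0) \<and>
        (\<exists>\<tau> c. c \<noteq> 0 \<and> (\<chi> i. poly (Y $ i) \<tau>) = c *s y1) \<and>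
        (\<exists>\<tau> c. c \<noteq> 0 \<and> (\<chi> i. poly (Y $ i) \<tau>) = c *s y2)"
    by (intro exI[of _ Y] conjI)
qed

section \<open>Ternary quadratic forms and their matrices\<close>

definition quad_val :: "'a::comm_ring_1 ^ 3 ^ 3 \<Rightarrow> 'a ^ 3 \<Rightarrow> 'a" where
  "quad_val A y = (\<Sum>i\<in>UNIV. \<Sum>j\<in>UNIV. y $ i * A $ i $ j * y $ j)"

definition quad_form :: "'a::comm_ring_1 ^ 3 ^ 3 \<Rightarrow> (3, 'a) mpoly" where
  "quad_form A = (\<Sum>i\<in>UNIV. \<Sum>j\<in>UNIV. mvar i * mconst (A $ i $ j) * mvar j)"

lemma meval_quad_form: "meval id (($) y) (quad_form A) = quad_val A y"
  by (simp add: quad_form_def quad_val_def sum_3 comm_ring_1_hom.meval_simps[OF comm_ring_1_hom_id])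

lemma meval_mpderiv_quad_form:
  assumes "transpose A = A"
  shows "meval id (($) y) (mpderiv i (quad_form A)) = 2 * (A *v y) $ i"
proof -
  have "transpose A $ i $ j = A $ i $ j" for i j
    by (simp add: assms)
  then have sym: "A $ 2 $ 1 = A $ 1 $ 2" "A $ 3 $ 1 = A $ 1 $ 3" "A $ 3 $ 2 = A $ 2 $ 3"
    by (simp_all add: transpose_def)
  consider "i = 1" | "i = 2" | "i = 3"
    using exhaust_3[of i] by blast
  then show ?thesis
    by cases (simp_all add: quad_form_def sum_3 mpderiv_simps matrix_vector_mult_def sym
      comm_ring_1_hom.meval_simps[OF comm_ring_1_hom_id] algebra_simps)
qed

lemma quad_val_eq: "quad_val A y = (\<Sum>i\<in>UNIV. y $ i * (A *v y) $ i)"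
  by (simp add: quad_val_def matrix_vector_mult_def sum_distrib_left mult_ac)

lemma det_eq_0_iff_kernel:
  fixes A :: "'a::field ^ 'n ^ 'n"
  shows "det A = 0 \<longleftrightarrow> (\<exists>x. x \<noteq> 0 \<and> A *v x = 0)"
  using matrix_left_invertible_ker[of A] invertible_det_nz[of A] invertible_left_inverse[of A]
  by auto

text \<open>The gradient at \<open>y\<close> is \<open>2 A y\<close>, and kernel vectors of
  \<open>A\<close> lie on the conic automatically. So the singular points are exactly the nonzero
  kernel vectors.\<close>

lemma nonsingular_curve_quad_form_iff:
  fixes A :: "'b::alg_closed_field ^ 3 ^ 3"
  assumes two: "(2 :: 'b) \<noteq> 0" and sym: "transpose A = A"
  shows "nonsingular_curve (quad_form A) \<longleftrightarrow> det A \<noteq> 0"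
proof -
  have "(\<exists>i. meval id (($) y) (mpderiv i (quad_form A)) \<noteq> 0) \<longleftrightarrow> A *v y \<noteq> 0" for y
    using two by (auto simp: meval_mpderiv_quad_form[OF sym] vec_eq_iff)
  moreover have "quad_val A y = 0" if "A *v y = 0" for y
    using that by (simp add: quad_val_eq)
  ultimately show ?thesis
    unfolding nonsingular_curve_def det_eq_0_iff_kernel meval_quad_form by metis
qed

section \<open>Binary quadratic forms\<close>

definition bform :: "'a::comm_ring_1 \<Rightarrow> 'a \<Rightarrow> 'a \<Rightarrow> (2, 'a) mpoly" where
  "bform a b c = mconst a * mvar 1 ^ 2 + mconst b * (mvar 1 * mvar 2) + mconst c * mvar 2 ^ 2"

lemma meval_bform:
  assumes "comm_ring_1_hom \<iota>"
  shows "meval \<iota> x (bform a b c) = \<iota> a * x 1 ^ 2 + \<iota> b * (x 1 * x 2) + \<iota> c * x 2 ^ 2"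
  by (simp add: bform_def comm_ring_1_hom.meval_simps[OF assms])

lemma bform_eq_single:
  "bform a b c = Poly_Mapping.single (Poly_Mapping.single 1 2) a +
    Poly_Mapping.single (Poly_Mapping.single 1 1 + Poly_Mapping.single 2 1) b +
    Poly_Mapping.single (Poly_Mapping.single 2 2) c"
  by (simp add: bform_def mconst_def mvar_def mult_single power2_eq_square numeral_2_eq_2 flip: single_add)

lemma homogeneous_bform: "homogeneous 2 (bform a b c)"
proof -
  have "homogeneous (0 + (1 + 1)) (bform a b c)"
    unfolding bform_def power2_eq_square
    by (intro homogeneous_add homogeneous_mult homogeneous_mconst homogeneous_mvar)
  then show ?thesis by (simp add: numeral_2_eq_2)
qed

lemma binary_monomial_eq_iff:
  "m = n \<longleftrightarrow> Poly_Mapping.lookup m 1 = Poly_Mapping.lookup n 1 \<and>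
    Poly_Mapping.lookup m 2 = Poly_Mapping.lookup (n :: 2 \<Rightarrow>\<^sub>0 nat) 2"
  by (metis exhaust_2 poly_mapping_eqI)

lemma lookup_bform:
  "Poly_Mapping.lookup (bform a b c) (Poly_Mapping.single 1 2) = a"
  "Poly_Mapping.lookup (bform a b c) (Poly_Mapping.single 1 1 + Poly_Mapping.single 2 1) = b"
  "Poly_Mapping.lookup (bform a b c) (Poly_Mapping.single 2 2) = c"
  by (simp_all add: bform_eq_single lookup_add lookup_single binary_monomial_eq_iff when_def)

lemma bform_eq_iff: "bform a b c = bform a' b' c' \<longleftrightarrow> a = a' \<and> b = b' \<and> c = c'"
  by (metis lookup_bform)

lemma bform_eq_0_iff: "bform a b c = 0 \<longleftrightarrow> a = 0 \<and> b = 0 \<and> c = 0"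
  using bform_eq_iff[of a b c 0 0 0] by (simp add: bform_def mconst_simps)

lemma homogeneous_2_imp_bform:
  assumes "homogeneous 2 p"
  shows "\<exists>a b c. p = bform a b c"
proof -
  let ?L = "Poly_Mapping.lookup p"
  have "p = bform (?L (Poly_Mapping.single 1 2))
    (?L (Poly_Mapping.single 1 1 + Poly_Mapping.single 2 1)) (?L (Poly_Mapping.single 2 2))"
    (is "_ = ?q")
  proof (rule poly_mapping_eqI)
    fix m :: "2 \<Rightarrow>\<^sub>0 nat"
    consider "m = Poly_Mapping.single 1 2"
      | "m = Poly_Mapping.single 1 1 + Poly_Mapping.single 2 1"
      | "m = Poly_Mapping.single 2 2"
      | "Poly_Mapping.lookup m 1 + Poly_Mapping.lookup m 2 \<noteq> 2"
      by (force simp: binary_monomial_eq_iff lookup_add lookup_single when_def)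
    then show "?L m = Poly_Mapping.lookup ?q m"
    proof cases
      case 4
      then have "m \<notin> Poly_Mapping.keys p" "m \<notin> Poly_Mapping.keys ?q"
        using assms homogeneous_bform unfolding homogeneous_def sum_2 by blast+
      then show ?thesis by (simp add: in_keys_iff)
    qed (simp_all only: lookup_bform)
  qed
  then show ?thesis by blast
qed

lemma card_zeros_binary_quadratic:
  fixes A B C :: "'b::alg_closed_field"
  assumes two: "(2 :: 'b) \<noteq> 0" and nz: "\<not> (A = 0 \<and> B = 0 \<and> C = 0)"
  shows "card {proj_pt x | x :: 'b ^ 2. x \<noteq> 0 \<and> A * x $ 1 ^ 2 + B * (x $ 1 * x $ 2) + C * x $ 2 ^ 2 = 0} =
    (if B ^ 2 - 4 * A * C = 0 then 1 else 2)" (is "card ?S = _")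
proof -
  let ?q = "\<lambda>x :: 'b ^ 2. A * x $ 1 ^ 2 + B * (x $ 1 * x $ 2) + C * x $ 2 ^ 2"
  obtain d where d: "d ^ 2 = B ^ 2 - 4 * A * C"
    using nth_root_exists[of 2] by auto
  \<comment> \<open>The zeros from the quadratic formula, cleared of denominators. For
    \<open>A = 0\<close> the form is \<open>t (B s + C t)\<close>, with zeros \<open>(1 : 0)\<close>
    and \<open>(C : - B)\<close>, and \<open>d\<close> is \<open>B\<close> up to sign. In both cases
    the zeros coincide exactly if \<open>d = 0\<close>.\<close>
  define u v :: "'b ^ 2"
    where "u = (if A = 0 then vector [1, 0] else vector [- B + d, 2 * A])"
      and "v = (if A = 0 then vector [C, - B] else vector [- B - d, 2 * A])"
  have uv: "u \<noteq> 0" "v \<noteq> 0"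
    using two nz by (auto simp: u_def v_def vec2_nonzero)
  have "?q x = 0 \<longleftrightarrow> proj_pt x = proj_pt u \<or> proj_pt x = proj_pt v" if "x \<noteq> 0" for x
  proof -
    have "4 * A * ?q x = (2 * A * x $ 1 - (- B + d) * x $ 2) * (2 * A * x $ 1 - (- B - d) * x $ 2)"
    proof -
      have "(2 * A * x $ 1 - (- B + d) * x $ 2) * (2 * A * x $ 1 - (- B - d) * x $ 2) =
          4 * A * ?q x + (B ^ 2 - 4 * A * C - d ^ 2) * x $ 2 ^ 2"
        by (simp add: power2_eq_square algebra_simps)
      with d show ?thesis by simp
    qed
    moreover have "4 * A \<noteq> 0" if "A \<noteq> 0"
    proof -
      have "4 * A = 2 * (2 * A)" by simp
      then show ?thesis using two that by (metis mult_eq_0_iff)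
    qed
    ultimately have "?q x = 0 \<longleftrightarrow> 2 * A * x $ 1 = (- B + d) * x $ 2 \<or> 2 * A * x $ 1 = (- B - d) * x $ 2"
      if "A \<noteq> 0"
      using that by (metis mult_eq_0_iff eq_iff_diff_eq_0)
    moreover have "?q x = 0 \<longleftrightarrow> x $ 2 = 0 \<or> - B * x $ 1 = C * x $ 2" if "A = 0"
    proof -
      have "?q x = x $ 2 * (C * x $ 2 + B * x $ 1)"
        using that by (simp add: power2_eq_square algebra_simps)
      then show ?thesis
        by (simp add: neg_eq_iff_add_eq_0 add.commute)
    qed
    ultimately show ?thesis
      using that uv by (simp add: proj_pt_eq_iff_line) (auto simp: u_def v_def)
  qed
  then have "?S = {proj_pt u, proj_pt v}"
    using uv by auto
  moreover have "proj_pt u = proj_pt v \<longleftrightarrow> d = 0"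
  proof -
    have "d = - d \<longleftrightarrow> d = 0"
      using two by (metis eq_neg_iff_add_eq_0 mult_2 mult_eq_0_iff)
    then have "2 * A * (- B + d) = (- B - d) * (2 * A) \<longleftrightarrow> d = 0" if "A \<noteq> 0"
      using two that by (simp add: mult.commute)
    moreover have "d = 0 \<longleftrightarrow> B = 0" if "A = 0"
    proof -
      from d that have "d ^ 2 = B ^ 2" by simp
      then show ?thesis by (auto simp: power2_eq_iff)
    qed
    ultimately show ?thesis
      using uv by (simp add: proj_pt_eq_iff_line) (simp add: u_def v_def)
  qed
  moreover have "d = 0 \<longleftrightarrow> B ^ 2 - 4 * A * C = 0"
      by (simp flip: d)
  ultimately show ?thesis by auto
qed

section \<open>Smooth conics\<close>

definition cross_vec :: "'a::comm_ring_1 ^ 3 \<Rightarrow> 'a ^ 3 \<Rightarrow> 'a ^ 3" where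
  "cross_vec u v = vector [u $ 2 * v $ 3 - u $ 3 * v $ 2,
     u $ 3 * v $ 1 - u $ 1 * v $ 3, u $ 1 * v $ 2 - u $ 2 * v $ 1]"

definition dot :: "'a::comm_ring_1 ^ 3 \<Rightarrow> 'a ^ 3 \<Rightarrow> 'a" where
  "dot u v = (\<Sum>i\<in>UNIV. u $ i * v $ i)"

lemma dot_commute: "dot u v = dot v u"
  by (simp add: dot_def mult.commute)

lemma dot_linear:
  "dot (u + v) w = dot u w + dot v w" "dot w (u + v) = dot w u + dot w v"
  "dot (c *s u) w = c * dot u w" "dot w (c *s u) = c * dot w u"
  "dot (u - v) w = dot u w - dot v w" "dot w (u - v) = dot w u - dot w v"
  by (simp_all add: dot_def sum.distrib sum_subtractf sum_distrib_left algebra_simps)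

lemma dot_matrix_symmetric:
  assumes "transpose A = (A :: 'a::comm_ring_1 ^ 3 ^ 3)"
  shows "dot u (A *v v) = dot (A *v u) v"
proof -
  have "transpose A $ i $ j = A $ i $ j" for i j
    by (simp add: assms)
  then have sym: "A $ 2 $ 1 = A $ 1 $ 2" "A $ 3 $ 1 = A $ 1 $ 3" "A $ 3 $ 2 = A $ 2 $ 3"
    by (simp_all add: transpose_def)
  show ?thesis
    by (simp add: dot_def sum_3 matrix_vector_mult_def sym algebra_simps)
qed

text \<open>The cross product of \<open>A u\<close> and \<open>A v\<close> is the cofactor matrix of
  \<open>A\<close> applied to that of \<open>u\<close> and \<open>v\<close>. For symmetric
  \<open>A\<close> the cofactor matrix is the adjugate, whose product with \<open>A\<close> is
  \<open>det A\<close>.\<close>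

lemma matrix_mult_cross_vec:
  assumes "transpose A = (A :: 'a::comm_ring_1 ^ 3 ^ 3)"
  shows "A *v cross_vec (A *v u) (A *v v) = det A *s cross_vec u v"
proof -
  have "transpose A $ i $ j = A $ i $ j" for i j
    by (simp add: assms)
  then have sym: "A $ 2 $ 1 = A $ 1 $ 2" "A $ 3 $ 1 = A $ 1 $ 3" "A $ 3 $ 2 = A $ 2 $ 3"
    by (simp_all add: transpose_def)
  show ?thesis
    by (simp add: vec_eq_iff forall_3 cross_vec_def sum_3 matrix_vector_mult_def det_3 sym)
      (intro conjI; simp add: algebra_simps)
qed

lemma dot_cross_vec_cross_vec:
  "dot (cross_vec a b) (cross_vec c d) = dot a c * dot b d - dot a d * dot b c"
  by (simp add: dot_def cross_vec_def sum_3 algebra_simps)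

lemma dot_cross_vec_self: "dot u (cross_vec u v) = 0" "dot v (cross_vec u v) = 0"
  by (simp_all add: dot_def cross_vec_def sum_3 algebra_simps)

lemma cross_vec_cross_vec: "cross_vec u (cross_vec v w) = dot u w *s v - dot u v *s w"
  by (simp add: vec_eq_iff forall_3 dot_def cross_vec_def sum_3 algebra_simps)

lemma cross_vec_eq_0_imp_proportional:
  fixes u v :: "'a::field ^ 3"
  assumes "cross_vec u v = 0" "u \<noteq> 0"
  shows "\<exists>c. v = c *s u"
proof -
  have eq: "u $ 2 * v $ 3 = u $ 3 * v $ 2" "u $ 3 * v $ 1 = u $ 1 * v $ 3" "u $ 1 * v $ 2 = u $ 2 * v $ 1"
    using assms(1) by (simp_all add: vec_eq_iff forall_3 cross_vec_def)
  obtain k where k: "u $ k \<noteq> 0"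
    using assms(2) by (auto simp: vec_eq_iff)
  have "v $ j * u $ k = v $ k * u $ j" for j
    using exhaust_3[of j] exhaust_3[of k] eq by (elim disjE) (simp_all add: mult.commute)
  then have "v = (v $ k / u $ k) *s u"
    using k by (simp add: vec_eq_iff field_simps)
  then show ?thesis by blast
qed

text \<open>A nondegenerate ternary form has no totally isotropic plane. If \<open>A u\<close> and
  \<open>A v\<close> were independent, the vectors orthogonal to both would form the line spanned by
  \<open>n\<close>, and this line contains \<open>u\<close> and \<open>v\<close>.\<close>

lemma isotropic_pair:
  fixes A :: "'a::field ^ 3 ^ 3"
  assumes sym: "transpose A = A" and det: "det A \<noteq> 0"
    and u: "dot u (A *v u) = 0" "u \<noteq> 0" and v: "dot v (A *v v) = 0" "v \<noteq> 0"
    and uv: "dot u (A *v v) = 0"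
  shows "\<exists>c. v = c *s u"
proof -
  have ker: "x = 0" if "A *v x = 0" for x
    using det that by (auto simp: det_eq_0_iff_kernel)
  define n where "n = cross_vec (A *v u) (A *v v)"
  show ?thesis
  proof (cases "n = 0")
    case True
    then obtain c where "A *v v = c *s (A *v u)"
      using cross_vec_eq_0_imp_proportional[of "A *v u" "A *v v"] ker u unfolding n_def by blast
    then have "A *v (v - c *s u) = 0"
      by (simp add: matrix_vector_mult_diff_distrib vector_scalar_commute)
    from ker[OF this] show ?thesis by auto
  next
    case False
    have vu: "dot v (A *v u) = 0"
      using uv dot_matrix_symmetric[OF sym, of v u] by (simp add: dot_commute)
    have "cross_vec u n = 0" "cross_vec v n = 0"
      by (simp_all add: n_def cross_vec_cross_vec u v uv vu)
    moreover have anti: "cross_vec n x = - cross_vec x n" for x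
      by (simp add: cross_vec_def vec_eq_iff forall_3)
    ultimately obtain a b where "u = a *s n" "v = b *s n"
      using False cross_vec_eq_0_imp_proportional[of n] by (metis neg_equal_0_iff_equal)
    then have "v = (b / a) *s u" using u(2) by auto
    then show ?thesis by blast
  qed
qed

lemma quad_val_dot: "quad_val A y = dot y (A *v y)"
  by (simp add: quad_val_eq dot_def)

text \<open>On the line \<open>T2 = 0\<close> the form restricts to a binary quadratic form, which
  has a zero.\<close>

lemma exists_isotropic:
  fixes A :: "'b::alg_closed_field ^ 3 ^ 3"
  assumes two: "(2 :: 'b) \<noteq> 0" and sym: "transpose A = A"
  shows "\<exists>y. y \<noteq> 0 \<and> quad_val A y = 0"
proof -
  have "transpose A $ 2 $ 1 = A $ 2 $ 1"
    by (simp add: assms)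
  then have s: "A $ 2 $ 1 = A $ 1 $ 2"
    by (simp add: transpose_def)
  have "\<exists>x :: 'b ^ 2. x \<noteq> 0 \<and> A $ 1 $ 1 * x $ 1 ^ 2 + 2 * A $ 1 $ 2 * (x $ 1 * x $ 2) + A $ 2 $ 2 * x $ 2 ^ 2 = 0"
  proof (cases "A $ 1 $ 1 = 0 \<and> 2 * A $ 1 $ 2 = 0 \<and> A $ 2 $ 2 = 0")
    case True
    have "(vector [1, 0] :: 'b ^ 2) \<noteq> 0"
      by (simp add: vec2_nonzero)
    with True show ?thesis
      by (intro exI[of _ "vector [1, 0]"]) simp
  next
    case False
    let ?S = "{proj_pt x | x :: 'b ^ 2. x \<noteq> 0 \<and>
      A $ 1 $ 1 * x $ 1 ^ 2 + 2 * A $ 1 $ 2 * (x $ 1 * x $ 2) + A $ 2 $ 2 * x $ 2 ^ 2 = 0}"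
    have "card ?S \<noteq> 0"
      using card_zeros_binary_quadratic[OF two False] by simp
    then have "?S \<noteq> {}" by force
    then show ?thesis by blast
  qed
  then obtain x :: "'b ^ 2" where x: "x \<noteq> 0"
    "A $ 1 $ 1 * x $ 1 ^ 2 + 2 * A $ 1 $ 2 * (x $ 1 * x $ 2) + A $ 2 $ 2 * x $ 2 ^ 2 = 0"
    by blast
  define y :: "'b ^ 3" where "y = vector [x $ 1, x $ 2, 0]"
  have "quad_val A y = A $ 1 $ 1 * x $ 1 ^ 2 + 2 * A $ 1 $ 2 * (x $ 1 * x $ 2) + A $ 2 $ 2 * x $ 2 ^ 2"
    by (simp add: quad_val_def sum_3 y_def s power2_eq_square algebra_simps)
  moreover have "y \<noteq> 0"
    using x(1) by (auto simp: y_def vec2_nonzero vec3_nonzero)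
  ultimately show ?thesis
    using x(2) by auto
qed

text \<open>
  With \<open>w = A y\<^sub>1 \<times> A y\<^sub>2\<close>, orthogonal to \<open>y\<^sub>1\<close> and \<open>y\<^sub>2\<close>, the residual intersection points of the lines
  through \<open>y\<^sub>1\<close> in the directions \<open>(1 - \<tau>) w + \<tau> y\<^sub>2\<close> trace out a rational curve through \<open>y\<^sub>1\<close>
  (\<open>\<tau> = 0\<close>, the tangent direction) and \<open>y\<^sub>2\<close> (\<open>\<tau> = 1\<close>).
\<close>

lemma zariski_irreducible_smooth_conic:
  fixes A :: "'b::alg_closed_field ^ 3 ^ 3" and x :: "'b ^ 2"
  assumes two: "(2 :: 'b) \<noteq> 0" and sym: "transpose A = A" and det: "det A \<noteq> 0" and x: "x \<noteq> 0"
  shows "zariski_irreducible {(proj_pt x, proj_pt y) | y. y \<noteq> 0 \<and> quad_val A y = 0}"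
proof (rule zariski_irreducible_rational_curves[OF x exists_isotropic[OF two sym]])
  fix y1 y2 :: "'b ^ 3"
  assume y1: "y1 \<noteq> 0" "quad_val A y1 = 0" and y2: "y2 \<noteq> 0" "quad_val A y2 = 0"
  show "\<exists>Y :: 'b poly ^ 3. (\<forall>\<tau>. quad_val A (\<chi> i. poly (Y $ i) \<tau>) = 0) \<and>
        (\<exists>\<tau> c. c \<noteq> 0 \<and> (\<chi> i. poly (Y $ i) \<tau>) = c *s y1) \<and>
        (\<exists>\<tau> c. c \<noteq> 0 \<and> (\<chi> i. poly (Y $ i) \<tau>) = c *s y2)"
  proof (cases "dot y1 (A *v y2) = 0")
    case True
    \<comment> \<open>The two vectors represent the same point, so a constant curve
      suffices.\<close>
    then obtain c where c: "y2 = c *s y1"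
      using isotropic_pair[OF sym det] y1 y2 by (metis quad_val_dot)
    with y2 have "c \<noteq> 0" by auto
    define Y :: "'b poly ^ 3" where "Y = (\<chi> i. [:y1 $ i:])"
    have "(\<chi> i. poly (Y $ i) \<tau>) = y1" for \<tau>
      by (simp add: Y_def vec_eq_iff)
    moreover have "y1 = 1 *s y1" "y1 = (1 / c) *s y2"
      using c \<open>c \<noteq> 0\<close> by simp_all
    moreover have "1 / c \<noteq> 0"
      using \<open>c \<noteq> 0\<close> by simp
    ultimately show ?thesis
      using y1(2) by (intro exI[of _ Y]) (metis one_neq_zero)
  next
    case False
    define \<beta> where "\<beta> = dot y1 (A *v y2)"
    define w where "w = cross_vec (A *v y1) (A *v y2)"
    define \<kappa> where "\<kappa> = dot w (A *v w)"
    have q: "dot y1 (A *v y1) = 0" "dot y2 (A *v y2) = 0"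
      using y1 y2 by (simp_all add: quad_val_dot)
    have \<beta>': "dot y2 (A *v y1) = \<beta>"
      unfolding \<beta>_def using dot_matrix_symmetric[OF sym, of y2 y1] by (simp add: dot_commute)
    have w: "dot y1 (A *v w) = 0" "dot y2 (A *v w) = 0"
      by (simp_all add: w_def matrix_mult_cross_vec[OF sym] dot_linear dot_cross_vec_self)
    then have w': "dot w (A *v y1) = 0" "dot w (A *v y2) = 0"
      using dot_matrix_symmetric[OF sym, of w] by (simp_all add: dot_commute)
    \<comment> \<open>\<open>A w\<close> is \<open>det A\<close> times the cross product of
      \<open>y1\<close> and \<open>y2\<close>. Its product with \<open>w\<close> involves the 2 by 2
      determinant pairing \<open>A y1\<close>, \<open>A y2\<close> with \<open>y1\<close>,
      \<open>y2\<close>, whose diagonal vanishes by isotropy.\<close>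
    have "\<kappa> = - det A * \<beta> ^ 2"
      by (simp add: \<kappa>_def w_def matrix_mult_cross_vec[OF sym] dot_linear dot_cross_vec_cross_vec
        dot_matrix_symmetric[OF sym, symmetric] q \<beta>' power2_eq_square flip: \<beta>_def)
    then have \<kappa>: "\<kappa> \<noteq> 0"
      using det False by (simp add: \<beta>_def)
    \<comment> \<open>Write \<open>b\<close> for the bilinear form of \<open>A\<close>,
      \<open>q\<close> for its quadratic form and \<open>d = (1 - \<tau>) w + \<tau> y2\<close>. The
      curve is \<open>q(d) y1 - 2 b(y1, d) d\<close>, up to scaling the reflection of
      \<open>y1\<close> along \<open>d\<close>, hence on the conic. Orthogonality gives
      \<open>q(d) = (1 - \<tau>)^2 \<kappa>\<close> and
      \<open>b(y1, d) = \<tau> \<beta>\<close>.\<close>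
    define Y :: "'b poly ^ 3" where "Y = (\<chi> i. [:1, - 1:] ^ 2 * [:\<kappa> * y1 $ i:] -
      [:0, 2 * \<beta>:] * ([:1, - 1:] * [:w $ i:] + [:0, 1:] * [:y2 $ i:]))"
    have Y: "(\<chi> i. poly (Y $ i) \<tau>) = ((1 - \<tau>) ^ 2 * \<kappa>) *s y1 - (2 * \<beta> * \<tau> * (1 - \<tau>)) *s w - (2 * \<beta> * \<tau> ^ 2) *s y2"
      for \<tau>
      by (simp add: Y_def vec_eq_iff power2_eq_square algebra_simps)
    have "quad_val A (\<chi> i. poly (Y $ i) \<tau>) = 0" for \<tau>
      by (simp add: Y quad_val_dot matrix_vector_mult_diff_distrib vector_scalar_commute dot_linear
        q w w' \<beta>' \<beta>_def[symmetric] \<kappa>_def[symmetric] power2_eq_square algebra_simps)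
    moreover have "(\<chi> i. poly (Y $ i) 0) = \<kappa> *s y1" "(\<chi> i. poly (Y $ i) 1) = (- 2 * \<beta>) *s y2"
      by (simp_all only: Y) (simp_all add: vec_eq_iff)
    moreover have "- 2 * \<beta> \<noteq> 0"
      using two False by (simp add: \<beta>_def)
    ultimately show ?thesis
      using \<kappa> by (intro exI[of _ Y] conjI allI) blast+
  qed
qed

section \<open>The equation of the surface\<close>

lemma comm_ring_1_hom_to_fract: "comm_ring_1_hom (to_fract :: 'a::idom \<Rightarrow> 'a fract)"
  by unfold_locales auto

lemma two_neq_0_hom:
  assumes "comm_ring_1_hom (\<iota> :: 'a::field \<Rightarrow> 'b::field)" "(2 :: 'a) \<noteq> 0"
  shows "(2 :: 'b) \<noteq> 0"
proof -
  interpret comm_ring_1_hom \<iota> by fact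
  have "\<iota> 2 * \<iota> (1 / 2) = 1"
    using assms(2) hom_one by (simp flip: hom_mult)
  then show ?thesis by (auto simp: hom_numeral)
qed

lemma hom_eq_0_iff:
  assumes "comm_ring_1_hom (\<iota> :: 'a::field \<Rightarrow> 'b::field)"
  shows "\<iota> a = 0 \<longleftrightarrow> a = 0"
proof -
  interpret comm_ring_1_hom \<iota> by fact
  have "\<iota> a * \<iota> (1 / a) = 1" if "a \<noteq> 0"
    using that hom_one by (simp flip: hom_mult)
  then show ?thesis using hom_zero by force
qed

lemma hom_det_3:
  assumes "comm_ring_1_hom \<Phi>"
  shows "\<Phi> (det (A :: 'a::comm_ring_1 ^ 3 ^ 3)) = det (\<chi> i j. \<Phi> (A $ i $ j))"
  by (simp add: det_3 comm_ring_1_hom.hom_simps[OF assms])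

lemma M_matrix_nth:
  "M_matrix \<iota> g h s t $ 1 $ 1 = - (s * t) + t ^ 2"
  "M_matrix \<iota> g h s t $ 1 $ 2 = s * t"
  "M_matrix \<iota> g h s t $ 1 $ 3 = meval \<iota> (($) (vector [s, t])) g"
  "M_matrix \<iota> g h s t $ 2 $ 1 = s * t"
  "M_matrix \<iota> g h s t $ 2 $ 2 = s ^ 2"
  "M_matrix \<iota> g h s t $ 2 $ 3 = t ^ 2"
  "M_matrix \<iota> g h s t $ 3 $ 1 = meval \<iota> (($) (vector [s, t])) g"
  "M_matrix \<iota> g h s t $ 3 $ 2 = t ^ 2"
  "M_matrix \<iota> g h s t $ 3 $ 3 = meval \<iota> (($) (vector [s, t])) h"
  by (simp_all add: M_matrix_def Let_def)

lemma transpose_M_matrix: "transpose (M_matrix \<iota> g h s t) = M_matrix \<iota> g h s t"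
  by (simp add: transpose_def vec_eq_iff forall_3 M_matrix_nth)

lemma hom_M_matrix:
  assumes \<Phi>: "comm_ring_1_hom \<Phi>" and \<iota>: "comm_ring_1_hom \<iota>"
  shows "\<Phi> (M_matrix \<iota> g h s t $ i $ j) = M_matrix (\<lambda>a. \<Phi> (\<iota> a)) g h (\<Phi> s) (\<Phi> t) $ i $ j"
proof -
  have "(\<lambda>v. \<Phi> ((vector [s, t] :: _ ^ 2) $ v)) = ($) (vector [\<Phi> s, \<Phi> t])"
    by (simp add: fun_eq_iff forall_2)
  then have "\<forall>i j. \<Phi> (M_matrix \<iota> g h s t $ i $ j) = M_matrix (\<lambda>a. \<Phi> (\<iota> a)) g h (\<Phi> s) (\<Phi> t) $ i $ j"
    by (simp add: forall_3 M_matrix_nth hom_meval[OF \<Phi> \<iota>] comm_ring_1_hom.hom_simps[OF \<Phi>])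
  then show ?thesis by blast
qed

lemma meval_B_equation:
  assumes \<iota>: "comm_ring_1_hom \<iota>"
  shows "meval \<iota> z (B_equation g h) = (\<Sum>i\<in>UNIV. \<Sum>j\<in>UNIV.
    z (Inr i) * M_matrix \<iota> g h (z (Inl 1)) (z (Inl 2)) $ i $ j * z (Inr j))"
proof -
  interpret \<iota>: comm_ring_1_hom \<iota> by fact
  interpret ev: comm_ring_1_hom "meval \<iota> z" by (rule \<iota>.comm_ring_1_hom_meval)
  have "(\<lambda>a. meval \<iota> z (mconst a)) = \<iota>"
    by (simp add: \<iota>.meval_mconst)
  then show ?thesis
    by (simp add: B_equation_def ev.hom_sum ev.hom_mult \<iota>.meval_mvar
      hom_M_matrix[OF \<iota>.comm_ring_1_hom_meval comm_ring_1_hom_mconst])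
qed

lemma fibre1_form_B_equation:
  assumes \<iota>: "comm_ring_1_hom \<iota>"
  shows "fibre1_form \<iota> (B_equation g h) x = quad_form (M_matrix \<iota> g h (x $ 1) (x $ 2))"
  by (simp add: fibre1_form_def quad_form_def hom_M_matrix[OF comm_ring_1_hom_mconst \<iota>]
    meval_B_equation[OF comm_ring_1_hom_compose[OF \<iota> comm_ring_1_hom_mconst]])

section \<open>The determinant of \<open>M\<close> and the pairs \<open>(g, h)\<close>\<close>

lemma det_M_matrix:
  "det (M_matrix \<iota> g h s t) = - (t ^ 6) + s * t ^ 5 + 2 * s * t ^ 3 * meval \<iota> (($) (vector [s, t])) g
    - s ^ 2 * meval \<iota> (($) (vector [s, t])) g ^ 2 - s ^ 3 * t * meval \<iota> (($) (vector [s, t])) h"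
proof -
  have "det (M_matrix \<iota> g h s t) = (- (s * t) + t ^ 2) * s ^ 2 * H + s * t * t ^ 2 * G + G * (s * t) * t ^ 2
      - (- (s * t) + t ^ 2) * t ^ 2 * t ^ 2 - s * t * (s * t) * H - G * s ^ 2 * G"
    if "G = meval \<iota> (($) (vector [s, t])) g" "H = meval \<iota> (($) (vector [s, t])) h" for G H
    by (simp add: det_3 M_matrix_nth that)
  then show ?thesis
    by (simp add: eval_nat_numeral algebra_simps)
qed

text \<open>The coefficients of \<open>(T^3 - g)^2 + T (h - T^4)\<close>, which is
  \<open>- det M(1, T)\<close>.\<close>

definition sextic_poly :: "'a::comm_ring_1 \<Rightarrow> 'a \<Rightarrow> 'a \<Rightarrow> 'a \<Rightarrow> 'a \<Rightarrow> 'a \<Rightarrow> 'a poly" where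
  "sextic_poly g0 g1 g2 h0 h1 h2 = [:g0 ^ 2, 2 * g0 * g1 + h0, g1 ^ 2 + 2 * g0 * g2 + h1,
     - 2 * g0 + 2 * g1 * g2 + h2, - 2 * g1 + g2 ^ 2, - 2 * g2 - 1, 1:]"

lemma poly_sextic_poly:
  "poly (sextic_poly g0 g1 g2 h0 h1 h2) t =
    (t ^ 3 - (g0 + g1 * t + g2 * t ^ 2)) ^ 2 + t * (h0 + h1 * t + h2 * t ^ 2 - t ^ 4)"
  by (simp add: sextic_poly_def eval_nat_numeral algebra_simps)

lemma map_poly_sextic_poly:
  assumes "comm_ring_1_hom \<kappa>"
  shows "map_poly \<kappa> (sextic_poly g0 g1 g2 h0 h1 h2) = sextic_poly (\<kappa> g0) (\<kappa> g1) (\<kappa> g2) (\<kappa> h0) (\<kappa> h1) (\<kappa> h2)"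
  by (simp add: sextic_poly_def map_poly_pCons comm_ring_1_hom.hom_simps[OF assms])

lemma det_M_matrix_pconst:
  "det (M_matrix (\<lambda>a. [:a:]) (bform g0 g1 g2) (bform h0 h1 h2) 1 [:0, 1:]) =
    - sextic_poly g0 g1 g2 h0 h1 h2"
  by (simp add: det_M_matrix meval_bform[OF comm_ring_1_hom_pconst] sextic_poly_def
    eval_nat_numeral numeral_poly one_pCons algebra_simps)

lemma form_pairs_bform_iff:
  "(bform g0 g1 g2, bform h0 h1 h2) \<in> form_pairs F \<longleftrightarrow> F = sextic_poly g0 g1 g2 h0 h1 h2"
  by (auto simp: form_pairs_def homogeneous_bform det_M_matrix_pconst)

lemma value_at_10_bform: "value_at_10 (bform a b c) = a"
  by (simp add: meval_bform[OF comm_ring_1_hom_id])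

lemma form_pairs_cases:
  assumes "(g, h) \<in> form_pairs F"
  obtains g0 g1 g2 h0 h1 h2 where "g = bform g0 g1 g2" "h = bform h0 h1 h2"
    "F = sextic_poly g0 g1 g2 h0 h1 h2"
proof -
  have "homogeneous 2 g" "homogeneous 2 h"
    using assms by (auto simp: form_pairs_def)
  then obtain g0 g1 g2 h0 h1 h2 where "g = bform g0 g1 g2" "h = bform h0 h1 h2"
    by (meson homogeneous_2_imp_bform)
  with assms that show ?thesis by (simp add: form_pairs_bform_iff)
qed

text \<open>The system is triangular: \<open>a5\<close> and \<open>a4\<close> yield
  \<open>g2\<close> and \<open>g1\<close> on division by 2, after which \<open>a3\<close>,
  \<open>a2\<close>, \<open>a1\<close> contain \<open>h2\<close>, \<open>h1\<close>,
  \<open>h0\<close> linearly. Only the sign of \<open>g0\<close> remains free, and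
  \<open>g1\<close>, \<open>g2\<close> do not depend on it.\<close>

lemma sextic_poly_eq_iff:
  assumes two: "(2 :: 'a::field) \<noteq> 0"
  shows "[:a0, a1, a2, a3, a4, a5, 1:] = sextic_poly g0 g1 g2 h0 h1 (h2 :: 'a) \<longleftrightarrow>
    a0 = g0 ^ 2 \<and> g2 = - (1 + a5) / 2 \<and> g1 = (g2 ^ 2 - a4) / 2 \<and> h2 = a3 + 2 * g0 - 2 * g1 * g2 \<and>
    h1 = a2 - g1 ^ 2 - 2 * g0 * g2 \<and> h0 = a1 - 2 * g0 * g1"
proof -
  have half: "g = a / 2 \<longleftrightarrow> 2 * g = a" for g a :: 'a
    using two by (simp add: nonzero_eq_divide_eq mult.commute)
  have "a5 = - u - 1 \<longleftrightarrow> u = - (1 + a5)" "a4 = - v + w \<longleftrightarrow> v = w - a4" for u v w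
    by (safe; simp)+
  from this(1)[of "2 * g2"] this(2)[of "2 * g1" "g2 ^ 2"]
  have "a5 = - 2 * g2 - 1 \<longleftrightarrow> g2 = - (1 + a5) / 2" "a4 = - 2 * g1 + g2 ^ 2 \<longleftrightarrow> g1 = (g2 ^ 2 - a4) / 2"
    unfolding half by (simp_all only: mult_minus_left)
  moreover have "a3 = - 2 * g0 + 2 * g1 * g2 + h2 \<longleftrightarrow> h2 = a3 + 2 * g0 - 2 * g1 * g2"
    "a2 = g1 ^ 2 + 2 * g0 * g2 + h1 \<longleftrightarrow> h1 = a2 - g1 ^ 2 - 2 * g0 * g2"
    "a1 = 2 * g0 * g1 + h0 \<longleftrightarrow> h0 = a1 - 2 * g0 * g1"
    by (auto simp: algebra_simps)
  ultimately show ?thesis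
    unfolding sextic_poly_def pCons_eq_iff by auto
qed

lemma poly_degree_6_monic:
  assumes "Polynomial.degree p = 6" "lead_coeff p = 1"
  shows "p = [:coeff p 0, coeff p 1, coeff p 2, coeff p 3, coeff p 4, coeff p 5, 1:]"
proof (rule poly_eqI)
  fix n :: nat
  show "coeff p n = coeff [:coeff p 0, coeff p 1, coeff p 2, coeff p 3, coeff p 4, coeff p 5, 1:] n"
    using assms by (auto simp: coeff_pCons eval_nat_numeral split: nat.splits intro!: coeff_eq_0)
qed

lemma card_form_pairs:
  fixes F :: "'k::field poly"
  assumes two: "(2 :: 'k) \<noteq> 0" and F: "sextic_datum to_ac F c"
  shows "card (form_pairs F) = 2" "(\<lambda>(g, h). value_at_10 g) ` form_pairs F = {c, - c}"
proof -
  obtain a1 a2 a3 a4 a5 where F_eq: "F = [:c ^ 2, a1, a2, a3, a4, a5, 1:]" and c: "c \<noteq> 0"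
    using F poly_degree_6_monic[of F] unfolding sextic_datum_def by metis
  define g2 g1 where "g2 = - (1 + a5) / 2" and "g1 = (g2 ^ 2 - a4) / 2"
  define pair where "pair e = (bform e g1 g2,
    bform (a1 - 2 * e * g1) (a2 - g1 ^ 2 - 2 * e * g2) (a3 + 2 * e - 2 * g1 * g2))" for e
  have "form_pairs F = {pair c, pair (- c)}"
  proof (intro subset_antisym subsetI)
    fix p assume "p \<in> form_pairs F"
    then obtain g h where p: "p = (g, h)" "(g, h) \<in> form_pairs F" by (cases p) auto
    from p(2) show "p \<in> {pair c, pair (- c)}"
    proof (cases rule: form_pairs_cases)
      case (1 e g1' g2' h0 h1 h2)
      note eqs = 1(3)[unfolded F_eq sextic_poly_eq_iff[OF two]]
      have g2: "g2' = g2" using eqs unfolding g2_def by blast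
      have g1: "g1' = g1" using eqs g2 unfolding g1_def by blast
      note eqs = eqs[unfolded g1 g2]
      then have "c ^ 2 = e ^ 2" by blast
      then have "e = c \<or> e = - c"
        unfolding power2_eq_iff by auto
      moreover have "(g, h) = pair e"
        unfolding pair_def 1(1,2) g1 g2 using eqs by blast
      ultimately show ?thesis
        using p by auto
    qed
  next
    fix p assume "p \<in> {pair c, pair (- c)}"
    then show "p \<in> form_pairs F"
      unfolding pair_def by (auto simp only: form_pairs_bform_iff F_eq sextic_poly_eq_iff[OF two]
        g1_def g2_def insert_iff empty_iff power2_minus)
  qed
  moreover have "c \<noteq> - c"
    using c two by (metis eq_neg_iff_add_eq_0 mult_2 mult_eq_0_iff)
  then have "pair c \<noteq> pair (- c)"
    by (simp add: pair_def bform_eq_iff)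
  ultimately show "card (form_pairs F) = 2"
    "(\<lambda>(g, h). value_at_10 g) ` form_pairs F = {c, - c}"
    by (auto simp: pair_def value_at_10_bform)
qed

lemma selected_pair_cases:
  assumes "selected_pair F c g h"
  obtains g1 g2 h0 h1 h2 where "g = bform c g1 g2" "h = bform h0 h1 h2"
    "F = sextic_poly c g1 g2 h0 h1 h2"
  using assms unfolding selected_pair_def
  by (metis form_pairs_cases value_at_10_bform)

section \<open>The forms \<open>Q0\<close>, \<open>Q1\<close>, \<open>Q2\<close> and the branch
  quartic\<close>

definition surface_Q0 :: "'r::comm_ring_1 \<Rightarrow> 'r \<Rightarrow> 'r \<Rightarrow> 'r \<Rightarrow> 'r \<Rightarrow> 'r" where
  "surface_Q0 g0 h0 x y z = 2 * g0 * x * z + y ^ 2 + h0 * z ^ 2"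

definition surface_Q1 :: "'r::comm_ring_1 \<Rightarrow> 'r \<Rightarrow> 'r \<Rightarrow> 'r \<Rightarrow> 'r \<Rightarrow> 'r" where
  "surface_Q1 g1 h1 x y z = 2 * x * y - x ^ 2 + 2 * g1 * x * z + h1 * z ^ 2"

definition surface_Q2 :: "'r::comm_ring_1 \<Rightarrow> 'r \<Rightarrow> 'r \<Rightarrow> 'r \<Rightarrow> 'r \<Rightarrow> 'r" where
  "surface_Q2 g2 h2 x y z = x ^ 2 + 2 * g2 * x * z + 2 * y * z + h2 * z ^ 2"

lemmas surface_Q_defs = surface_Q0_def surface_Q1_def surface_Q2_def

text \<open>The arguments are elements of any commutative ring, so one formula gives both the forms,
  at \<open>mvar 1\<close>, \<open>mvar 2\<close>, \<open>mvar 3\<close>, and their values at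
  points. This lemma passes between the two.\<close>

lemma hom_surface_Q:
  assumes "comm_ring_1_hom \<Phi>"
  shows "\<Phi> (surface_Q0 a b x y z) = surface_Q0 (\<Phi> a) (\<Phi> b) (\<Phi> x) (\<Phi> y) (\<Phi> z)"
    "\<Phi> (surface_Q1 a b x y z) = surface_Q1 (\<Phi> a) (\<Phi> b) (\<Phi> x) (\<Phi> y) (\<Phi> z)"
    "\<Phi> (surface_Q2 a b x y z) = surface_Q2 (\<Phi> a) (\<Phi> b) (\<Phi> x) (\<Phi> y) (\<Phi> z)"
  by (simp_all add: surface_Q_defs comm_ring_1_hom.hom_simps[OF assms])

lemma sum_M_matrix_bform:
  assumes "comm_ring_1_hom \<iota>"
  shows "(\<Sum>i\<in>UNIV. \<Sum>j\<in>UNIV. y i * M_matrix \<iota> (bform g0 g1 g2) (bform h0 h1 h2) s t $ i $ j * y j) =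
    surface_Q0 (\<iota> g0) (\<iota> h0) (y 1) (y 2) (y 3) * s ^ 2 +
    surface_Q1 (\<iota> g1) (\<iota> h1) (y 1) (y 2) (y 3) * (s * t) +
    surface_Q2 (\<iota> g2) (\<iota> h2) (y 1) (y 2) (y 3) * t ^ 2"
  by (simp add: sum_3 M_matrix_nth meval_bform[OF assms] surface_Q_defs power2_eq_square algebra_simps)

lemma meval_B_equation_bform:
  assumes "comm_ring_1_hom \<iota>"
  shows "meval \<iota> z (B_equation (bform g0 g1 g2) (bform h0 h1 h2)) =
    surface_Q0 (\<iota> g0) (\<iota> h0) (z (Inr 1)) (z (Inr 2)) (z (Inr 3)) * z (Inl 1) ^ 2 +
    surface_Q1 (\<iota> g1) (\<iota> h1) (z (Inr 1)) (z (Inr 2)) (z (Inr 3)) * (z (Inl 1) * z (Inl 2)) +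
    surface_Q2 (\<iota> g2) (\<iota> h2) (z (Inr 1)) (z (Inr 2)) (z (Inr 3)) * z (Inl 2) ^ 2"
  by (simp add: meval_B_equation[OF assms] sum_M_matrix_bform[OF assms])

lemma fibre2_form_B_equation:
  assumes \<iota>: "comm_ring_1_hom \<iota>"
  shows "fibre2_form \<iota> (B_equation (bform g0 g1 g2) (bform h0 h1 h2)) y =
    bform (surface_Q0 (\<iota> g0) (\<iota> h0) (y $ 1) (y $ 2) (y $ 3))
      (surface_Q1 (\<iota> g1) (\<iota> h1) (y $ 1) (y $ 2) (y $ 3))
      (surface_Q2 (\<iota> g2) (\<iota> h2) (y $ 1) (y $ 2) (y $ 3))"
  unfolding fibre2_form_def
    meval_B_equation_bform[OF comm_ring_1_hom_compose[OF \<iota> comm_ring_1_hom_mconst]]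
  by (simp add: bform_def hom_surface_Q[OF comm_ring_1_hom_mconst])

lemma as_binary_B_equation:
  "as_binary (B_equation (bform g0 g1 g2) (bform h0 h1 h2)) =
    bform (surface_Q0 (mconst g0) (mconst h0) (mvar 1) (mvar 2) (mvar 3))
      (surface_Q1 (mconst g1) (mconst h1) (mvar 1) (mvar 2) (mvar 3))
      (surface_Q2 (mconst g2) (mconst h2) (mvar 1) (mvar 2) (mvar 3))"
  unfolding as_binary_def
    meval_B_equation_bform[OF comm_ring_1_hom_compose[OF comm_ring_1_hom_mconst comm_ring_1_hom_mconst]]
  by (simp add: bform_def hom_surface_Q[OF comm_ring_1_hom_mconst])

definition branch_quartic ::
    "'a::comm_ring_1 \<Rightarrow> 'a \<Rightarrow> 'a \<Rightarrow> 'a \<Rightarrow> 'a \<Rightarrow> 'a \<Rightarrow> (3, 'a) mpoly" where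
  "branch_quartic g0 g1 g2 h0 h1 h2 =
    surface_Q1 (mconst g1) (mconst h1) (mvar 1) (mvar 2) (mvar 3) ^ 2 -
    4 * surface_Q0 (mconst g0) (mconst h0) (mvar 1) (mvar 2) (mvar 3) *
      surface_Q2 (mconst g2) (mconst h2) (mvar 1) (mvar 2) (mvar 3)"

lemma discriminant_form_B_equation:
  "discriminant_form (B_equation (bform g0 g1 g2) (bform h0 h1 h2)) = branch_quartic g0 g1 g2 h0 h1 h2"
  unfolding discriminant_form_def as_binary_B_equation Let_def lookup_bform branch_quartic_def ..

lemma map_branch_quartic:
  assumes "comm_ring_1_hom \<kappa>"
  shows "Poly_Mapping.map \<kappa> (branch_quartic g0 g1 g2 h0 h1 h2) =
    branch_quartic (\<kappa> g0) (\<kappa> g1) (\<kappa> g2) (\<kappa> h0) (\<kappa> h1) (\<kappa> h2)"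
  by (simp add: branch_quartic_def hom_surface_Q[OF comm_ring_1_hom_map_mpoly[OF assms]]
    map_mpoly_simps[OF assms])

lemma meval_branch_quartic:
  assumes "comm_ring_1_hom \<iota>"
  shows "meval \<iota> y (branch_quartic g0 g1 g2 h0 h1 h2) =
    surface_Q1 (\<iota> g1) (\<iota> h1) (y 1) (y 2) (y 3) ^ 2 -
    4 * surface_Q0 (\<iota> g0) (\<iota> h0) (y 1) (y 2) (y 3) * surface_Q2 (\<iota> g2) (\<iota> h2) (y 1) (y 2) (y 3)"
  by (simp add: branch_quartic_def comm_ring_1_hom.meval_simps[OF assms]
    hom_surface_Q[OF comm_ring_1_hom.comm_ring_1_hom_meval[OF assms]])

lemma homogeneous_surface_Q:
  "homogeneous 2 (surface_Q0 (mconst a) (mconst b) (mvar i) (mvar j) (mvar k))"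
  "homogeneous 2 (surface_Q1 (mconst a) (mconst b) (mvar i) (mvar j) (mvar k))"
  "homogeneous 2 (surface_Q2 (mconst a) (mconst b) (mvar i) (mvar j) (mvar k))"
proof -
  have 1: "homogeneous 2 (mvar i * mvar j)" for i j
    using homogeneous_mult[OF homogeneous_mvar homogeneous_mvar, of i j] by (simp only: one_add_one)
  have 2: "homogeneous 2 (mconst a * (mvar i * mvar j))" for a i j
    using homogeneous_mult[OF homogeneous_mconst 1] by (simp only: add_0)
  have 3: "homogeneous 2 (2 * (mconst a * (mvar i * mvar j)))" for a i j
    by (simp only: mult_2) (intro homogeneous_add 2)
  have 4: "homogeneous 2 (2 * (mvar i * mvar j))" for i j
    by (simp only: mult_2) (intro homogeneous_add 1)
  show "homogeneous 2 (surface_Q0 (mconst a) (mconst b) (mvar i) (mvar j) (mvar k))"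
    "homogeneous 2 (surface_Q1 (mconst a) (mconst b) (mvar i) (mvar j) (mvar k))"
    "homogeneous 2 (surface_Q2 (mconst a) (mconst b) (mvar i) (mvar j) (mvar k))"
    unfolding surface_Q_defs power2_eq_square mult.assoc
    by (intro homogeneous_add homogeneous_minus 1 2 3 4)+
qed

lemma is_quartic_branch_quartic: "is_quartic (branch_quartic g0 g1 g2 h0 h1 (h2 :: 'a::field))"
proof -
  \<comment> \<open>At \<open>(1 : 0 : 0)\<close> one has \<open>Q0 = 0\<close> and
    \<open>Q1 = - 1\<close>.\<close>
  have "meval id (\<lambda>i. if i = 1 then 1 else 0) (branch_quartic g0 g1 g2 h0 h1 h2) = 1"
    by (simp add: meval_branch_quartic[OF comm_ring_1_hom_id] surface_Q_defs)
  then have "branch_quartic g0 g1 g2 h0 h1 h2 \<noteq> 0"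
    by (auto simp: comm_ring_1_hom.meval_simps[OF comm_ring_1_hom_id])
  moreover have "homogeneous (2 + 2)
      (surface_Q1 (mconst g1) (mconst h1) (mvar 1) (mvar 2) (mvar 3) ^ 2 :: (3, 'a) mpoly)"
    unfolding power2_eq_square[of "surface_Q1 _ _ _ _ _"]
    by (intro homogeneous_mult homogeneous_surface_Q)
  moreover have "homogeneous (0 + (2 + 2)) (mconst 4 *
      (surface_Q0 (mconst g0) (mconst h0) (mvar 1) (mvar 2) (mvar 3) *
       surface_Q2 (mconst g2) (mconst h2) (mvar 1) (mvar 2) (mvar 3)) :: (3, 'a) mpoly)"
    by (intro homogeneous_mult homogeneous_surface_Q homogeneous_mconst)
  ultimately have "branch_quartic g0 g1 g2 h0 h1 h2 \<noteq> 0" "homogeneous 4 (branch_quartic g0 g1 g2 h0 h1 h2)"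
    by (simp_all add: branch_quartic_def mconst_simps mult.assoc homogeneous_minus)
  then show ?thesis by (simp add: is_quartic_def)
qed

lemma bihomogeneous_surface_Q:
  "bihomogeneous 0 2 (surface_Q0 (mconst a) (mconst b) (mvar (Inr i)) (mvar (Inr j)) (mvar (Inr k)))"
  "bihomogeneous 0 2 (surface_Q1 (mconst a) (mconst b) (mvar (Inr i)) (mvar (Inr j)) (mvar (Inr k)))"
  "bihomogeneous 0 2 (surface_Q2 (mconst a) (mconst b) (mvar (Inr i)) (mvar (Inr j)) (mvar (Inr k)))"
proof -
  have 1: "bihomogeneous 0 2 (mvar (Inr i) * mvar (Inr j))" for i j
    using bihomogeneous_mult[OF bihomogeneous_mvar_Inr bihomogeneous_mvar_Inr, of i j]
    by (simp only: one_add_one add_0)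
  have 2: "bihomogeneous 0 2 (mconst a * (mvar (Inr i) * mvar (Inr j)))" for a i j
    using bihomogeneous_mult[OF bihomogeneous_mconst 1] by (simp only: add_0)
  have 3: "bihomogeneous 0 2 (2 * (mconst a * (mvar (Inr i) * mvar (Inr j))))" for a i j
    by (simp only: mult_2) (intro bihomogeneous_add 2)
  have 4: "bihomogeneous 0 2 (2 * (mvar (Inr i) * mvar (Inr j)))" for i j
    by (simp only: mult_2) (intro bihomogeneous_add 1)
  show "bihomogeneous 0 2 (surface_Q0 (mconst a) (mconst b) (mvar (Inr i)) (mvar (Inr j)) (mvar (Inr k)))"
    "bihomogeneous 0 2 (surface_Q1 (mconst a) (mconst b) (mvar (Inr i)) (mvar (Inr j)) (mvar (Inr k)))"
    "bihomogeneous 0 2 (surface_Q2 (mconst a) (mconst b) (mvar (Inr i)) (mvar (Inr j)) (mvar (Inr k)))"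
    unfolding surface_Q_defs power2_eq_square mult.assoc
    by (intro bihomogeneous_add bihomogeneous_minus 1 2 3 4)+
qed

lemma bihomogeneous_B_equation:
  "bihomogeneous 2 2 (B_equation (bform g0 g1 g2) (bform h0 h1 (h2 :: 'a::field)))"
proof -
  have s: "bihomogeneous (1 + 1) (0 + 0) (mvar (Inl i) * mvar (Inl j) :: 'a biform)" for i j
    by (intro bihomogeneous_mult bihomogeneous_mvar_Inl)
  have s2: "bihomogeneous (1 + 1) (0 + 0) (mvar (Inl i) ^ 2 :: 'a biform)" for i
    unfolding power2_eq_square by (rule s)
  note mult = bihomogeneous_surface_Q[THEN bihomogeneous_mult]
  have "bihomogeneous (0 + (1 + 1)) (2 + (0 + 0))
      (meval mconst mvar (B_equation (bform g0 g1 g2) (bform h0 h1 h2)))"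
    unfolding meval_B_equation_bform[OF comm_ring_1_hom_mconst]
    by (intro bihomogeneous_add mult[OF s] mult[OF s2])
  then show ?thesis
    by (simp only: meval_mconst_mvar one_add_one add_0 add_0_right)
qed

lemma B_equation_nonzero: "B_equation (bform g0 g1 g2) (bform h0 h1 h2) \<noteq> (0 :: 'a::field biform)"
proof -
  \<comment> \<open>At \<open>(1 : 0)\<close> and \<open>(0 : 1 : 0)\<close> only the term
    \<open>s^2 T1^2\<close> survives.\<close>
  have "meval id (case_sum (\<lambda>i. if i = 1 then 1 else 0) (\<lambda>j. if j = 2 then 1 else 0))
      (B_equation (bform g0 g1 g2) (bform h0 h1 h2)) = 1"
    by (simp add: meval_B_equation_bform[OF comm_ring_1_hom_id] surface_Q_defs)
  then show ?thesis
    by (auto simp: comm_ring_1_hom.meval_simps[OF comm_ring_1_hom_id])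
qed

section \<open>The branch quartic\<close>

lemma rsquarefree_imp_simple_root:
  assumes "rsquarefree p" "poly p t = 0"
  shows "poly (pderiv p) t \<noteq> 0"
proof
  assume 0: "poly (pderiv p) t = 0"
  obtain q where q: "p = [:- t, 1:] * q"
    using assms(2) by (auto simp: poly_eq_0_iff_dvd)
  have "pderiv [:- t, 1:] = 1"
    by (simp add: pderiv_pCons)
  then have "pderiv p = [:- t, 1:] * pderiv q + q"
    by (simp only: q pderiv_mult mult_1_right)
  with 0 have "poly q t = 0" by simp
  then have "[:- t, 1:] ^ 2 dvd p"
    unfolding q power2_eq_square poly_eq_0_iff_dvd by (intro mult_dvd_mono dvd_refl)
  moreover have "p \<noteq> 0" "Polynomial.order t p = 1"
    using assms rsquarefree_root_order[of p t] by (auto simp: rsquarefree_def)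
  ultimately show False
    by (simp add: order_divides)
qed

lemma card_roots_rsquarefree:
  fixes p :: "'a::alg_closed_field poly"
  assumes "rsquarefree p"
  shows "card {x. poly p x = 0} = Polynomial.degree p"
proof -
  have p: "p \<noteq> 0"
    using assms by (simp add: rsquarefree_def)
  then obtain A where A: "size A = Polynomial.degree p"
    "p = smult (lead_coeff p) (\<Prod>x\<in>#A. [:- x, 1:])"
    using alg_closed_imp_factorization by blast
  have "proots p = A"
  proof -
    have "proots p = proots (smult (lead_coeff p) (\<Prod>x\<in>#A. [:- x, 1:]))"
      using A(2) by (rule arg_cong)
    also have "\<dots> = proots (\<Prod>x\<in>#A. [:- x, 1:])"
      using p by (simp add: proots_smult)
    also have "0 \<notin># image_mset (\<lambda>x. [:- x, 1:]) A"
      by (auto dest: sym)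
    from proots_prod_mset[OF this] have "proots (\<Prod>x\<in>#A. [:- x, 1:]) = A"
      by (simp add: image_mset.compositionality o_def)
    finally show ?thesis .
  qed
  moreover have "set_mset (proots p) = {x. poly p x = 0}"
    using p by simp
  moreover have "count (proots p) x = 1" if "poly p x = 0" for x
    using rsquarefree_root_order[OF assms that p] p by simp
  ultimately have "size A = card {x. poly p x = 0}"
    by (simp add: size_multiset_overloaded_eq)
  with A(1) show ?thesis by simp
qed

section \<open>Smoothness of the surface and of the branch curve\<close>

lemma pderiv_sextic_poly:
  "poly (pderiv (sextic_poly g0 g1 g2 h0 h1 h2)) t =
    2 * (t ^ 3 - (g0 + g1 * t + g2 * t ^ 2)) * (3 * t ^ 2 - (g1 + 2 * g2 * t)) +
    (h0 + h1 * t + h2 * t ^ 2 - t ^ 4) + t * (h1 + 2 * h2 * t - 4 * t ^ 3)"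
  by (simp add: sextic_poly_def pderiv_pCons eval_nat_numeral algebra_simps)

text \<open>
  The hypotheses say that \<open>(1 : t; x : y : z)\<close> is a singular point of the surface. The last one
  expresses the vanishing of the derivative in the direction of the line.
\<close>

lemma surface_smooth:
  fixes t x y z g0 g1 g2 h0 h1 h2 :: "'a::field"
  defines "G \<equiv> g0 + g1 * t + g2 * t ^ 2" and "H \<equiv> h0 + h1 * t + h2 * t ^ 2"
  assumes g0: "g0 \<noteq> 0" and sep: "rsquarefree (sextic_poly g0 g1 g2 h0 h1 h2)"
    and 1: "(t ^ 2 - t) * x + t * y + G * z = 0" and 2: "t * x + y + t ^ 2 * z = 0"
    and 3: "G * x + t ^ 2 * y + H * z = 0"
    and 4: "(2 * t - 1) * x ^ 2 + 2 * x * y + 2 * (g1 + 2 * g2 * t) * (x * z) + 4 * t * (y * z) +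
      (h1 + 2 * h2 * t) * z ^ 2 = 0"
  shows "x = 0 \<and> y = 0 \<and> z = 0"
proof (rule ccontr)
  assume nz: "\<not> ?thesis"
  \<comment> \<open>Eliminating \<open>y\<close> by the second equation amounts to completing the
    square. What remains is the kernel condition \<open>t x = e z\<close>,
    \<open>e x = - k z\<close> of a binary form, with \<open>F(t) = e^2 + t k\<close>.\<close>
  define e where "e = G - t ^ 3"
  define k where "k = H - t ^ 4"
  have y: "y = - (t * x) - t ^ 2 * z"
  proof -
    have "y = (t * x + y + t ^ 2 * z) - t * x - t ^ 2 * z" by simp
    with 2 show ?thesis by simp
  qed
  have tx: "t * x = e * z"
    using 1 unfolding y e_def by (simp add: power2_eq_square power3_eq_cube algebra_simps)
  have ex: "e * x = - (k * z)"
    using 3 unfolding y e_def k_def by (simp add: eval_nat_numeral algebra_simps eq_neg_iff_add_eq_0)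
  \<comment> \<open>With \<open>z = 0\<close> and \<open>x \<noteq> 0\<close>, the kernel condition
    gives \<open>t = 0\<close> and then \<open>g0 x = 0\<close>. This is where
    \<open>g0 \<noteq> 0\<close> enters.\<close>
  have "z \<noteq> 0"
  proof
    assume z: "z = 0"
    with nz y have x: "x \<noteq> 0" by auto
    with z tx have "t = 0" by simp
    with ex z x have "g0 = 0" by (simp add: e_def G_def)
    with g0 show False by simp
  qed
  have F: "poly (sextic_poly g0 g1 g2 h0 h1 h2) t = e ^ 2 + t * k"
    unfolding poly_sextic_poly e_def k_def G_def H_def by (simp add: power2_commute)
  have "(e ^ 2 + t * k) * z = e * (e * z) + t * (k * z)"
    by (simp add: power2_eq_square algebra_simps)
  also have "\<dots> = e * (t * x) + t * (k * z)"
    by (simp only: tx)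
  also have "\<dots> = t * (e * x) + t * (k * z)"
    by (simp add: algebra_simps)
  also have "\<dots> = 0"
    by (simp add: ex)
  finally have "poly (sextic_poly g0 g1 g2 h0 h1 h2) t = 0"
    using \<open>z \<noteq> 0\<close> F by simp
  then have F': "poly (pderiv (sextic_poly g0 g1 g2 h0 h1 h2)) t \<noteq> 0"
    using sep by (rule rsquarefree_imp_simple_root[rotated])
  define e' k' where "e' = g1 + 2 * g2 * t - 3 * t ^ 2" and "k' = h1 + 2 * h2 * t - 4 * t ^ 3"
  have "poly (pderiv (sextic_poly g0 g1 g2 h0 h1 h2)) t = 2 * e * e' + k + t * k'"
    unfolding pderiv_sextic_poly e_def k_def G_def H_def e'_def k'_def by (simp add: algebra_simps)
  moreover have "- (x ^ 2) + 2 * e' * (x * z) + k' * z ^ 2 = 0"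
    using 4 unfolding y e'_def k'_def by (simp add: eval_nat_numeral algebra_simps)
  \<comment> \<open>After multiplication by \<open>t\<close>, the relations \<open>t x = e z\<close>
    and \<open>e x = - k z\<close> apply and turn the fourth equation into
    \<open>F'(t) z^2 = 0\<close>.\<close>
  then have "- (t * x) * x + 2 * e' * ((t * x) * z) + t * k' * z ^ 2 = 0"
    by (metis (no_types, opaque_lifting) distrib_left mult.assoc mult.left_commute mult_minus_left mult_minus_right mult_zero_right power2_eq_square)
  then have "- (e * x) * z + 2 * e' * (e * z * z) + t * k' * z ^ 2 = 0"
    unfolding tx by (simp add: mult_ac)
  then have "(2 * e * e' + k + t * k') * z ^ 2 = 0"
    unfolding ex by (simp add: power2_eq_square algebra_simps)
  ultimately show False
    using F' \<open>z \<noteq> 0\<close> by simp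
qed

lemma meval_mpderiv_branch_quartic:
  fixes v :: "'a::comm_ring_1 ^ 3" and g0 g1 g2 h0 h1 h2 :: 'a
  defines "x \<equiv> v $ 1" and "y \<equiv> v $ 2" and "z \<equiv> v $ 3"
  defines "q0 \<equiv> surface_Q0 g0 h0 x y z" and "q1 \<equiv> surface_Q1 g1 h1 x y z"
    and "q2 \<equiv> surface_Q2 g2 h2 x y z"
  shows "meval id (($) v) (mpderiv 1 (branch_quartic g0 g1 g2 h0 h1 h2)) =
      2 * q1 * (2 * y - 2 * x + 2 * g1 * z) - 4 * (2 * g0 * z) * q2 - 4 * q0 * (2 * x + 2 * g2 * z)"
    "meval id (($) v) (mpderiv 2 (branch_quartic g0 g1 g2 h0 h1 h2)) =
      2 * q1 * (2 * x) - 4 * (2 * y) * q2 - 4 * q0 * (2 * z)"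
    "meval id (($) v) (mpderiv 3 (branch_quartic g0 g1 g2 h0 h1 h2)) =
      2 * q1 * (2 * g1 * x + 2 * h1 * z) - 4 * (2 * g0 * x + 2 * h0 * z) * q2 -
      4 * q0 * (2 * g2 * x + 2 * y + 2 * h2 * z)"
proof -
  interpret comm_ring_1_hom id by (rule comm_ring_1_hom_id)
  interpret ev: comm_ring_1_hom "meval id (($) v)" by (rule comm_ring_1_hom_meval)
  let ?q0 = "surface_Q0 (mconst g0) (mconst h0) (mvar 1) (mvar 2) (mvar 3) :: (3, 'a) mpoly"
  let ?q1 = "surface_Q1 (mconst g1) (mconst h1) (mvar 1) (mvar 2) (mvar 3) :: (3, 'a) mpoly"
  let ?q2 = "surface_Q2 (mconst g2) (mconst h2) (mvar 1) (mvar 2) (mvar 3) :: (3, 'a) mpoly"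
  have "mpderiv i (?q1 ^ 2 - 4 * ?q0 * ?q2) =
      2 * ?q1 * mpderiv i ?q1 - 4 * mpderiv i ?q0 * ?q2 - 4 * ?q0 * mpderiv i ?q2" for i
    by (simp add: mpderiv_simps algebra_simps)
  then have *: "meval id (($) v) (mpderiv i (branch_quartic g0 g1 g2 h0 h1 h2)) =
      2 * q1 * meval id (($) v) (mpderiv i ?q1) - 4 * meval id (($) v) (mpderiv i ?q0) * q2 -
      4 * q0 * meval id (($) v) (mpderiv i ?q2)" for i
    by (simp add: branch_quartic_def ev.hom_simps hom_surface_Q[OF comm_ring_1_hom_meval] meval_mvar
      meval_mconst q0_def q1_def q2_def x_def y_def z_def)
  have
    "meval id (($) v) (mpderiv 1 ?q0) = 2 * g0 * z"
    "meval id (($) v) (mpderiv 2 ?q0) = 2 * y"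
    "meval id (($) v) (mpderiv 3 ?q0) = 2 * g0 * x + 2 * h0 * z"
    "meval id (($) v) (mpderiv 1 ?q1) = 2 * y - 2 * x + 2 * g1 * z"
    "meval id (($) v) (mpderiv 2 ?q1) = 2 * x"
    "meval id (($) v) (mpderiv 3 ?q1) = 2 * g1 * x + 2 * h1 * z"
    "meval id (($) v) (mpderiv 1 ?q2) = 2 * x + 2 * g2 * z"
    "meval id (($) v) (mpderiv 2 ?q2) = 2 * z"
    "meval id (($) v) (mpderiv 3 ?q2) = 2 * g2 * x + 2 * y + 2 * h2 * z"
    by (simp_all add: surface_Q_defs mpderiv_simps ev.hom_simps meval_mvar meval_mconst
      x_def y_def z_def algebra_simps)
  then show "meval id (($) v) (mpderiv 1 (branch_quartic g0 g1 g2 h0 h1 h2)) =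
      2 * q1 * (2 * y - 2 * x + 2 * g1 * z) - 4 * (2 * g0 * z) * q2 - 4 * q0 * (2 * x + 2 * g2 * z)"
    "meval id (($) v) (mpderiv 2 (branch_quartic g0 g1 g2 h0 h1 h2)) =
      2 * q1 * (2 * x) - 4 * (2 * y) * q2 - 4 * q0 * (2 * z)"
    "meval id (($) v) (mpderiv 3 (branch_quartic g0 g1 g2 h0 h1 h2)) =
      2 * q1 * (2 * g1 * x + 2 * h1 * z) - 4 * (2 * g0 * x + 2 * h0 * z) * q2 -
      4 * q0 * (2 * g2 * x + 2 * y + 2 * h2 * z)"
    by (simp_all only: *)
qed

text \<open>At a common zero of the \<open>Q\<^sub>i\<close>, the whole gradient of \<open>Q\<^sub>1\<^sup>2 - 4 Q\<^sub>0 Q\<^sub>2\<close> vanishes.\<close>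

lemma nonsingular_branch_quartic_imp:
  fixes v :: "'b::alg_closed_field ^ 3"
  assumes "nonsingular_curve (branch_quartic g0 g1 g2 h0 h1 h2)" "v \<noteq> 0"
  shows "\<not> (surface_Q0 g0 h0 (v $ 1) (v $ 2) (v $ 3) = 0 \<and>
    surface_Q1 g1 h1 (v $ 1) (v $ 2) (v $ 3) = 0 \<and> surface_Q2 g2 h2 (v $ 1) (v $ 2) (v $ 3) = 0)"
proof
  assume 0: "surface_Q0 g0 h0 (v $ 1) (v $ 2) (v $ 3) = 0 \<and>
    surface_Q1 g1 h1 (v $ 1) (v $ 2) (v $ 3) = 0 \<and> surface_Q2 g2 h2 (v $ 1) (v $ 2) (v $ 3) = 0"
  then have "meval id (($) v) (branch_quartic g0 g1 g2 h0 h1 h2) = 0"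
    by (simp add: meval_branch_quartic[OF comm_ring_1_hom_id])
  with assms obtain i where "meval id (($) v) (mpderiv i (branch_quartic g0 g1 g2 h0 h1 h2)) \<noteq> 0"
    by (auto simp: nonsingular_curve_def)
  then show False
    using exhaust_3[of i] 0 by (auto simp: meval_mpderiv_branch_quartic)
qed

text \<open>
  Conversely, a singular point of the branch curve where the \<open>Q\<^sub>i\<close> do not all vanish lies under a
  singular point of the surface, but the surface is smooth as \<open>F\<close> is separable.
\<close>

lemma nonsingular_branch_quartic:
  fixes g0 g1 g2 h0 h1 h2 :: "'b::alg_closed_field"
  assumes two: "(2 :: 'b) \<noteq> 0" and g0: "g0 \<noteq> 0" and sep: "rsquarefree (sextic_poly g0 g1 g2 h0 h1 h2)"
    and nz: "\<And>x y z. surface_Q0 g0 h0 x y z = 0 \<Longrightarrow> surface_Q1 g1 h1 x y z = 0 \<Longrightarrow>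
      surface_Q2 g2 h2 x y z = 0 \<Longrightarrow> x = 0 \<and> y = 0 \<and> z = 0"
  shows "nonsingular_curve (branch_quartic g0 g1 g2 h0 h1 h2)"
  unfolding nonsingular_curve_def
proof (intro allI impI, rule ccontr)
  fix v :: "'b ^ 3"
  assume v: "v \<noteq> 0 \<and> meval id (($) v) (branch_quartic g0 g1 g2 h0 h1 h2) = 0"
    and "\<nexists>i. meval id (($) v) (mpderiv i (branch_quartic g0 g1 g2 h0 h1 h2)) \<noteq> 0"
  then have d: "meval id (($) v) (mpderiv i (branch_quartic g0 g1 g2 h0 h1 h2)) = 0" for i
    by blast
  define x y z where "x = v $ 1" and "y = v $ 2" and "z = v $ 3"
  define q0 q1 q2 where "q0 = surface_Q0 g0 h0 x y z" and "q1 = surface_Q1 g1 h1 x y z"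
    and "q2 = surface_Q2 g2 h2 x y z"
  have xyz: "\<not> (x = 0 \<and> y = 0 \<and> z = 0)"
    using v by (simp add: x_def y_def z_def vec3_nonzero)
  have disc: "q1 ^ 2 = 4 * q0 * q2"
    using v by (simp add: meval_branch_quartic[OF comm_ring_1_hom_id] q0_def q1_def q2_def x_def y_def z_def)
  note g = d[of 1] d[of 2] d[of 3]
  note g = g[unfolded meval_mpderiv_branch_quartic, folded x_def y_def z_def, folded q0_def q1_def q2_def]
  have grad: "2 * q1 * (2 * (y - x + g1 * z)) - 4 * (2 * (g0 * z)) * q2 - 4 * q0 * (2 * (x + g2 * z)) = 0"
    "2 * q1 * (2 * x) - 4 * (2 * y) * q2 - 4 * q0 * (2 * z) = 0"
    "2 * q1 * (2 * (g1 * x + h1 * z)) - 4 * (2 * (g0 * x + h0 * z)) * q2 -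
      4 * q0 * (2 * (g2 * x + y + h2 * z)) = 0"
    using g by (simp_all only: distrib_left right_diff_distrib mult.assoc)
  have four: "(4 :: 'b) \<noteq> 0"
    using two by (metis mult_2 mult_eq_0_iff numeral_Bit0)
  have eight: "(8 :: 'b) \<noteq> 0"
  proof -
    have "(8 :: 'b) = 2 * 4" by simp
    then show ?thesis using two four by (metis mult_eq_0_iff)
  qed
  show False
  proof (cases "q2 = 0")
    \<comment> \<open>The double zero lies at \<open>(0 : 1)\<close>, outside the chart
      \<open>s = 1\<close>. There the gradient equations say that the gradient of \<open>Q2\<close>
      vanishes, which forces the point to be zero.\<close>
    case True
    then have q1: "q1 = 0" using disc by simp
    with True nz[of x y z] xyz have "q0 \<noteq> 0"
      unfolding q0_def q1_def q2_def by blast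
    then have "c = 0" if "2 * q1 * (2 * b) - 4 * (2 * a) * q2 - 4 * q0 * (2 * c) = 0" for a b c
      using that True q1 eight by simp
    from this[OF grad(1)] this[OF grad(2)] this[OF grad(3)] xyz show False by auto
  next
    case False
    \<comment> \<open>\<open>(1 : t)\<close> is the double zero of the fibre form
      \<open>q0 s^2 + q1 s t + q2 t^2\<close>.\<close>
    define t where "t = - q1 / (2 * q2)"
    have q1: "q1 = - 2 * t * q2"
      using False two by (simp add: t_def)
    have "4 * (q0 * q2) = 4 * (t ^ 2 * q2 * q2)"
      using disc unfolding q1 by (auto simp: power2_eq_square mult_ac)
    then have q0: "q0 = t ^ 2 * q2"
      using False four by simp
    \<comment> \<open>For \<open>a\<close>, \<open>b\<close>, \<open>c\<close> half the partial
      derivatives of \<open>Q0\<close>, \<open>Q1\<close>, \<open>Q2\<close>, the derivative of the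
      discriminant is \<open>- 8 q2 (a + t b + t^2 c)\<close>.\<close>
    have *: "a + t * b + t ^ 2 * c = 0"
      if "2 * q1 * (2 * b) - 4 * (2 * a) * q2 - 4 * q0 * (2 * c) = 0" for a b c
    proof -
      have "2 * q1 * (2 * b) - 4 * (2 * a) * q2 - 4 * q0 * (2 * c) =
          - (2 * 4 * q2 * (a + t * b + t ^ 2 * c))"
        unfolding q1 q0 by (simp add: power2_eq_square algebra_simps)
      with that have "2 * 4 * q2 * (a + t * b + t ^ 2 * c) = 0"
        by simp
      then show ?thesis using False two four by (metis mult_eq_0_iff)
    qed
    have "x = 0 \<and> y = 0 \<and> z = 0"
    proof (rule surface_smooth[OF g0 sep])
      show "(t ^ 2 - t) * x + t * y + (g0 + g1 * t + g2 * t ^ 2) * z = 0"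
        using *[OF grad(1)]
        by (simp add: algebra_simps)
      show "t * x + y + t ^ 2 * z = 0"
        using *[OF grad(2)] by (simp add: algebra_simps)
      show "(g0 + g1 * t + g2 * t ^ 2) * x + t ^ 2 * y + (h0 + h1 * t + h2 * t ^ 2) * z = 0"
        using *[OF grad(3)]
        by (simp add: algebra_simps)
      \<comment> \<open>At a double zero the derivative along the line vanishes too.\<close>
      have "q1 + 2 * t * q2 = 0" by (simp add: q1)
      then show "(2 * t - 1) * x ^ 2 + 2 * x * y + 2 * (g1 + 2 * g2 * t) * (x * z) + 4 * t * (y * z) +
          (h1 + 2 * h2 * t) * z ^ 2 = 0"
        unfolding q1_def q2_def surface_Q_defs by (simp add: algebra_simps)
    qed
    with xyz show False by blast
  qed
qed

text \<open>
  Where \<open>z = 1\<close>, eliminating \<open>y\<close> by \<open>Q\<^sub>2 = 0\<close> turns \<open>Q\<^sub>1 = 0\<close> into the equation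
  \<open>x\<^sup>3 + (1 + 2 g\<^sub>2) x\<^sup>2 + (h\<^sub>2 - 2 g\<^sub>1) x - h\<^sub>1 = 0\<close> and \<open>4 Q\<^sub>0 = 0\<close> into
  \<open>(x\<^sup>2 + 2 g\<^sub>2 x + h\<^sub>2)\<^sup>2 + 8 g\<^sub>0 x + 4 h\<^sub>0 = 0\<close>. Their resultant is the determinant of the latter
  polynomial, evaluated at the companion matrix of the former.
\<close>

definition elim_companion :: "'a::comm_ring_1 \<Rightarrow> 'a \<Rightarrow> 'a \<Rightarrow> 'a \<Rightarrow> 'a ^ 3 ^ 3" where
  "elim_companion g1 g2 h1 h2 =
    vector [vector [0, 1, 0], vector [0, 0, 1], vector [h1, 2 * g1 - h2, - (1 + 2 * g2)]]"

definition elim_matrix :: "'a::comm_ring_1 \<Rightarrow> 'a \<Rightarrow> 'a \<Rightarrow> 'a \<Rightarrow> 'a \<Rightarrow> 'a \<Rightarrow> 'a ^ 3 ^ 3" where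
  "elim_matrix g0 g1 g2 h0 h1 h2 =
    (let A = elim_companion g1 g2 h1 h2; N = A ** A + mat (2 * g2) ** A + mat h2
     in N ** N + mat (8 * g0) ** A + mat (4 * h0))"

lemma hom_det_elim_matrix:
  assumes "comm_ring_1_hom \<Phi>"
  shows "\<Phi> (det (elim_matrix g0 g1 g2 h0 h1 h2)) =
    det (elim_matrix (\<Phi> g0) (\<Phi> g1) (\<Phi> g2) (\<Phi> h0) (\<Phi> h1) (\<Phi> h2))"
proof -
  interpret comm_ring_1_hom \<Phi> by fact
  define M where "M A = (\<chi> i j. \<Phi> (A $ i $ j))" for A :: "'a ^ 3 ^ 3"
  have M: "M (A ** B) = M A ** M B" "M (A + B) = M A + M B" "M (mat c) = mat (\<Phi> c)" for A B c
    by (auto simp: M_def vec_eq_iff matrix_matrix_mult_def mat_def hom_simps hom_sum)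
  have "M (elim_companion g1 g2 h1 h2) = elim_companion (\<Phi> g1) (\<Phi> g2) (\<Phi> h1) (\<Phi> h2)"
    by (simp add: M_def elim_companion_def vec_eq_iff forall_3 hom_simps)
  then have "M (elim_matrix g0 g1 g2 h0 h1 h2) = elim_matrix (\<Phi> g0) (\<Phi> g1) (\<Phi> g2) (\<Phi> h0) (\<Phi> h1) (\<Phi> h2)"
    by (simp add: elim_matrix_def Let_def M hom_simps)
  then show ?thesis
    by (simp add: hom_det_3[OF assms] M_def)
qed

text \<open>Here the cubic is \<open>x^3 + x^2\<close> and the quartic \<open>x^4 + 4 h0\<close>;
  the result is the product of the quartic's values at the roots 0, 0, -1. It witnesses that the
  resultant is not identically zero.\<close>

lemma det_elim_matrix_special: "det (elim_matrix 0 0 0 h0 0 0) = (4 * h0) ^ 2 * (1 + 4 * h0)"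
  by (simp add: elim_matrix_def Let_def elim_companion_def det_3 matrix_matrix_mult_def sum_3 mat_def
    power2_eq_square algebra_simps)

text \<open>A common zero \<open>(a : b : 1)\<close> makes \<open>(1, a, a^2)\<close> an eigenvector
  of the companion matrix for the eigenvalue \<open>a\<close>, hence one of
  \<open>elim_matrix\<close> for the eigenvalue \<open>4 Q0 = 0\<close>.\<close>

lemma det_elim_matrix_eq_0:
  fixes x y z :: "'a::field"
  assumes two: "(2 :: 'a) \<noteq> 0" and g0: "g0 \<noteq> 0" and nz: "\<not> (x = 0 \<and> y = 0 \<and> z = 0)"
    and Q: "surface_Q0 g0 h0 x y z = 0" "surface_Q1 g1 h1 x y z = 0" "surface_Q2 g2 h2 x y z = 0"
  shows "det (elim_matrix g0 g1 g2 h0 h1 h2) = 0"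
proof -
  \<comment> \<open>On \<open>z = 0\<close>, \<open>Q2\<close> and \<open>Q0\<close> become
    \<open>x^2\<close> and \<open>y^2\<close>.\<close>
  have z: "z \<noteq> 0"
    using Q nz by (auto simp: surface_Q_defs)
  define a b where "a = x / z" and "b = y / z"
  have xy: "x = a * z" "y = b * z"
    using z by (simp_all add: a_def b_def)
  have "z ^ 2 * surface_Q0 g0 h0 a b 1 = 0" "z ^ 2 * surface_Q1 g1 h1 a b 1 = 0"
    "z ^ 2 * surface_Q2 g2 h2 a b 1 = 0"
    using Q unfolding xy by (simp_all add: surface_Q_defs power2_eq_square algebra_simps)
  then have E: "2 * g0 * a + b ^ 2 + h0 = 0" "2 * a * b - a ^ 2 + 2 * g1 * a + h1 = 0"
    "a ^ 2 + 2 * g2 * a + 2 * b + h2 = 0"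
    using z by (simp_all add: surface_Q_defs)
  define v :: "'a ^ 3" where "v = vector [1, a, a ^ 2]"
  define A where "A = elim_companion g1 g2 h1 h2"
  define N where "N = A ** A + mat (2 * g2) ** A + mat h2"
  have mat: "mat c *v w = c *s w" for c and w :: "'a ^ 3"
    by (simp add: vec_eq_iff forall_3 matrix_vector_mult_def mat_def sum_3)
  have b: "2 * b = - (a ^ 2 + 2 * g2 * a + h2)"
    using E(3) by (simp add: eq_neg_iff_add_eq_0 algebra_simps)
  \<comment> \<open>The cubic is \<open>a Q2 - Q1\<close> at \<open>(a, b, 1)\<close>, where
    \<open>b\<close> cancels.\<close>
  have "a ^ 3 = h1 + (2 * g1 - h2) * a - (1 + 2 * g2) * a ^ 2"
  proof -
    have "a ^ 3 - (h1 + (2 * g1 - h2) * a - (1 + 2 * g2) * a ^ 2) =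
        a * (a ^ 2 + 2 * g2 * a + 2 * b + h2) - (2 * a * b - a ^ 2 + 2 * g1 * a + h1)"
      by (simp add: power2_eq_square power3_eq_cube algebra_simps)
    also have "\<dots> = 0"
      by (simp only: E) simp
    finally show ?thesis by simp
  qed
  then have A: "A *v v = a *s v"
    by (simp add: A_def v_def elim_companion_def vec_eq_iff forall_3 matrix_vector_mult_def sum_3
      power2_eq_square power3_eq_cube algebra_simps)
  define k where "k = a ^ 2 + 2 * g2 * a + h2"
  have N: "N *v v = k *s v"
    by (simp add: k_def N_def matrix_vector_mult_add_rdistrib A mat vector_scalar_commute
      power2_eq_square vec.scale_left_distrib mult_ac flip: matrix_vector_mul_assoc)
  have k: "k = - (2 * b)"
    using b by (simp add: k_def)
  have "elim_matrix g0 g1 g2 h0 h1 h2 = N ** N + mat (8 * g0) ** A + mat (4 * h0)"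
    by (simp add: elim_matrix_def Let_def A_def N_def)
  then have "elim_matrix g0 g1 g2 h0 h1 h2 *v v = (k * k + 8 * g0 * a + 4 * h0) *s v"
    by (simp add: matrix_vector_mult_add_rdistrib A N mat vector_scalar_commute
      power2_eq_square vec.scale_left_distrib distrib_left mult_ac flip: matrix_vector_mul_assoc)
  also have "k * k + 8 * g0 * a + 4 * h0 = 4 * (2 * g0 * a + b ^ 2 + h0)"
    by (simp add: k power2_eq_square algebra_simps)
  finally have "elim_matrix g0 g1 g2 h0 h1 h2 *v v = 0"
    by (simp add: E(1))
  moreover have "v \<noteq> 0"
    by (simp add: v_def vec3_nonzero)
  ultimately show ?thesis
    by (auto simp: det_eq_0_iff_kernel)
qed

section \<open>Proof of the proposition\<close>

lemma sextic_of_params_eq: "sextic_of_params x = [:x 0 ^ 2, x 1, x 2, x 3, x 4, x 5, 1:]"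
proof -
  have "{1..5 :: nat} = {1, 2, 3, 4, 5}" by auto
  then show ?thesis
    by (simp add: sextic_of_params_def monom_Suc monom_0 eval_nat_numeral)
qed

text \<open>The first argument stands for \<open>1/2\<close>, the others for \<open>c, a\<^sub>1, \<dots>, a\<^sub>5\<close>.\<close>

definition elim_of_params ::
    "'a::comm_ring_1 \<Rightarrow> 'a \<Rightarrow> 'a \<Rightarrow> 'a \<Rightarrow> 'a \<Rightarrow> 'a \<Rightarrow> 'a \<Rightarrow> 'a" where
  "elim_of_params r c a1 a2 a3 a4 a5 =
    (let g2 = - (1 + a5) * r; g1 = (g2 ^ 2 - a4) * r
     in det (elim_matrix c g1 g2 (a1 - 2 * c * g1) (a2 - g1 ^ 2 - 2 * c * g2) (a3 + 2 * c - 2 * g1 * g2)))"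

lemma hom_elim_of_params:
  assumes "comm_ring_1_hom \<Phi>"
  shows "\<Phi> (elim_of_params r c a1 a2 a3 a4 a5) =
    elim_of_params (\<Phi> r) (\<Phi> c) (\<Phi> a1) (\<Phi> a2) (\<Phi> a3) (\<Phi> a4) (\<Phi> a5)"
  by (simp add: elim_of_params_def Let_def hom_det_elim_matrix[OF assms]
    comm_ring_1_hom.hom_simps[OF assms])

text \<open>Solving for \<open>g\<close> and \<open>h\<close> divides by 2 only; with
  \<open>1 / 2\<close> as a constant of \<open>k\<close>, the resultant is a polynomial in the
  parameters over \<open>k\<close>.\<close>

definition elim_polynomial :: "(6, 'k::field) mpoly" where
  "elim_polynomial =
    elim_of_params (mconst (1 / 2)) (mvar 0) (mvar 1) (mvar 2) (mvar 3) (mvar 4) (mvar 5)"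

lemma meval_elim_polynomial:
  assumes "comm_ring_1_hom \<iota>"
  shows "meval \<iota> x elim_polynomial = elim_of_params (\<iota> (1 / 2)) (x 0) (x 1) (x 2) (x 3) (x 4) (x 5)"
  by (simp add: elim_polynomial_def comm_ring_1_hom.meval_simps[OF assms]
    hom_elim_of_params[OF comm_ring_1_hom.comm_ring_1_hom_meval[OF assms]])

lemma elim_polynomial_nonzero:
  assumes two: "(2 :: 'k::field) \<noteq> 0"
  shows "elim_polynomial \<noteq> (0 :: (6, 'k) mpoly)"
proof
  assume 0: "elim_polynomial = (0 :: (6, 'k) mpoly)"
  \<comment> \<open>With \<open>a5 = - 1\<close> and \<open>c = a2 = a3 = a4 = 0\<close>, all of
    \<open>g1\<close>, \<open>g2\<close>, \<open>h1\<close>, \<open>h2\<close> vanish and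
    \<open>h0 = a1\<close>. An indeterminate is substituted for \<open>a1\<close> because
    \<open>k\<close> may be finite.\<close>
  define x :: "6 \<Rightarrow> 'k poly" where "x i = (if i = 1 then [:0, 1:] else if i = 5 then - 1 else 0)" for i
  have "meval (\<lambda>a. [:a:]) x (elim_polynomial :: (6, 'k) mpoly) = (4 * [:0, 1:]) ^ 2 * (1 + 4 * [:0, 1:])"
    by (simp add: meval_elim_polynomial[OF comm_ring_1_hom_pconst] x_def elim_of_params_def
      det_elim_matrix_special)
  then have "(4 * [:0, 1 :: 'k:]) ^ 2 * (1 + 4 * [:0, 1:]) = 0"
    by (simp only: 0 comm_ring_1_hom.meval_simps[OF comm_ring_1_hom_pconst])
  moreover have four: "(4 :: 'k) \<noteq> 0"
    using two by (metis mult_2 mult_eq_0_iff numeral_Bit0)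
  ultimately show False
    by (simp only: mult_eq_0_iff power_eq_0_iff) (simp add: numeral_poly one_pCons)
qed

text \<open>Two homomorphisms are kept general so that one polynomial serves parameters in
  \<open>k\<close> as well as in its closure, where points outside the zero set exist even if
  \<open>k\<close> is finite.\<close>

lemma nonsingular_outside_elim_polynomial:
  fixes \<iota> :: "'k::field \<Rightarrow> 'a::field" and \<kappa> :: "'a \<Rightarrow> 'b::alg_closed_field"
  assumes two: "(2 :: 'k) \<noteq> 0" and \<iota>: "comm_ring_1_hom \<iota>" and \<kappa>: "comm_ring_1_hom \<kappa>"
  shows "nonsingular_outside \<iota> \<kappa> elim_polynomial"
  unfolding nonsingular_outside_def
proof (intro allI impI, elim conjE)
  fix x g h
  assume P: "meval \<iota> x elim_polynomial \<noteq> 0"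
    and datum: "sextic_datum \<kappa> (sextic_of_params x) (x 0)"
    and "selected_pair (sextic_of_params x) (x 0) g h"
  from this(3) obtain g1 g2 h0 h1 h2 where gh: "g = bform (x 0) g1 g2" "h = bform h0 h1 h2"
    and F: "sextic_of_params x = sextic_poly (x 0) g1 g2 h0 h1 h2"
    by (rule selected_pair_cases)
  have two': "(2 :: 'a) \<noteq> 0" "(2 :: 'b) \<noteq> 0"
    by (fact two_neq_0_hom[OF \<iota> two], fact two_neq_0_hom[OF \<kappa> two_neq_0_hom[OF \<iota> two]])
  note coeffs = F[unfolded sextic_of_params_eq sextic_poly_eq_iff[OF two'(1)]]
  have half: "\<iota> (1 / 2) = 1 / 2"
  proof -
    interpret comm_ring_1_hom \<iota> by fact
    have "2 * \<iota> (1 / 2) = 1"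
      using two hom_mult[of 2 "1 / 2"] by (simp add: hom_one hom_numeral)
    then show ?thesis
      using two' by (simp add: field_simps)
  qed
  have g: "- (1 + x 5) * \<iota> (1 / 2) = g2" "(g2 ^ 2 - x 4) * \<iota> (1 / 2) = g1"
    unfolding half times_divide_eq_right mult_1_right using coeffs by metis+
  have h: "x 1 - 2 * x 0 * g1 = h0" "x 2 - g1 ^ 2 - 2 * x 0 * g2 = h1" "x 3 + 2 * x 0 - 2 * g1 * g2 = h2"
    using coeffs by metis+
  have "meval \<iota> x elim_polynomial = det (elim_matrix (x 0) g1 g2 h0 h1 h2)"
    unfolding meval_elim_polynomial[OF \<iota>] elim_of_params_def Let_def g h ..
  with P have nz: "det (elim_matrix (\<kappa> (x 0)) (\<kappa> g1) (\<kappa> g2) (\<kappa> h0) (\<kappa> h1) (\<kappa> h2)) \<noteq> 0"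
    by (simp add: hom_eq_0_iff[OF \<kappa>] flip: hom_det_elim_matrix[OF \<kappa>])
  have c: "\<kappa> (x 0) \<noteq> 0"
    using datum by (simp add: sextic_datum_def hom_eq_0_iff[OF \<kappa>])
  have "nonsingular_curve (branch_quartic (\<kappa> (x 0)) (\<kappa> g1) (\<kappa> g2) (\<kappa> h0) (\<kappa> h1) (\<kappa> h2))"
  proof (rule nonsingular_branch_quartic[OF two'(2) c])
    show "rsquarefree (sextic_poly (\<kappa> (x 0)) (\<kappa> g1) (\<kappa> g2) (\<kappa> h0) (\<kappa> h1) (\<kappa> h2))"
      using datum by (simp add: sextic_datum_def F map_poly_sextic_poly[OF \<kappa>])
  qed (use det_elim_matrix_eq_0[OF two'(2) c] nz in blast)
  then show "nonsingular_curve (Poly_Mapping.map \<kappa> (discriminant_form (B_equation g h)))"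
    by (simp add: gh discriminant_form_B_equation map_branch_quartic[OF \<kappa>])
qed

lemma bihomogeneous_map_mpoly: "bihomogeneous d e p \<Longrightarrow> bihomogeneous d e (Poly_Mapping.map \<kappa> p)"
  by (auto simp: bihomogeneous_def in_keys_iff Poly_Mapping.map.rep_eq when_def split: if_splits)

section \<open>The splitting field and the roots of \<open>F(T^2)\<close>\<close>

lemma splitting_field_closed:
  shows "to_ac a \<in> splitting_field p" "u \<in> roots_in_closure p \<Longrightarrow> u \<in> splitting_field p"
    and "x \<in> splitting_field p \<Longrightarrow> y \<in> splitting_field p \<Longrightarrow> x + y \<in> splitting_field p"
    and "x \<in> splitting_field p \<Longrightarrow> y \<in> splitting_field p \<Longrightarrow> x * y \<in> splitting_field p"
proof -
  let ?R = "ring_of_type_algebra :: 'a alg_closure ring"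
  have ops: "x \<oplus>\<^bsub>?R\<^esub> y = x + y" "x \<otimes>\<^bsub>?R\<^esub> y = x * y" for x y
    by (simp_all add: ring_of_type_algebra_def)
  show "to_ac a \<in> splitting_field p" "u \<in> roots_in_closure p \<Longrightarrow> u \<in> splitting_field p"
    by (auto simp: splitting_field_def intro: generate_field.incl)
  show "x \<in> splitting_field p \<Longrightarrow> y \<in> splitting_field p \<Longrightarrow> x + y \<in> splitting_field p"
    using generate_field.eng_add[of x ?R _ y] by (simp add: splitting_field_def ops)
  show "x \<in> splitting_field p \<Longrightarrow> y \<in> splitting_field p \<Longrightarrow> x * y \<in> splitting_field p"
    using generate_field.eng_mult[of x ?R _ y] by (simp add: splitting_field_def ops)
qed

lemma splitting_field_power: "x \<in> splitting_field p \<Longrightarrow> x ^ n \<in> splitting_field p"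
  using splitting_field_closed(1)[of 1 p] by (induction n) (auto intro: splitting_field_closed)

lemma roots_in_closure_pcompose_square:
  "roots_in_closure (pcompose p (monom 1 2)) = {u. u ^ 2 \<in> roots_in_closure p}"
proof -
  have "poly (map_poly to_ac (pcompose p (monom 1 2))) u = poly (map_poly to_ac p) (u ^ 2)" for u :: "'a alg_closure"
  proof (induction p)
    case (pCons a p)
    have "map_poly to_ac (monom 1 2 * q) = monom 1 2 * map_poly to_ac q" for q :: "'a poly"
      by (rule poly_eqI) (simp add: coeff_map_poly coeff_monom_mult)
    moreover have "map_poly to_ac (q + r) = map_poly to_ac q + map_poly to_ac r" for q r :: "'a poly"
      by (rule poly_eqI) (simp add: coeff_map_poly)
    ultimately show ?case
      using pCons by (simp add: pcompose_pCons map_poly_pCons poly_monom)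
  qed simp
  then show ?thesis by (simp add: roots_in_closure_def)
qed

section \<open>The surface belonging to fixed \<open>g\<close> and \<open>h\<close>\<close>

locale sextic_surface =
  fixes g0 g1 g2 h0 h1 h2 :: "'k::field"
  assumes two_nonzero: "(2 :: 'k) \<noteq> 0" and g0_nonzero: "g0 \<noteq> 0"
    and separable: "rsquarefree (map_poly to_ac (sextic_poly g0 g1 g2 h0 h1 h2))"
begin

abbreviation "f \<equiv> B_equation (bform g0 g1 g2) (bform h0 h1 h2)"
abbreviation "F \<equiv> sextic_poly g0 g1 g2 h0 h1 h2"
abbreviation "fibre_matrix (x :: 'k alg_closure ^ 2) \<equiv>
  M_matrix to_ac (bform g0 g1 g2) (bform h0 h1 h2) (x $ 1) (x $ 2)"
abbreviation "R \<equiv> roots_in_closure (pcompose F (monom 1 2))"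

lemma two_nonzero_ac: "(2 :: 'k alg_closure) \<noteq> 0"
  by (rule two_neq_0_hom[OF comm_ring_1_hom_to_ac two_nonzero])

lemma neg_eq_self_iff: "(u :: 'k alg_closure) = - u \<longleftrightarrow> u = 0"
  using two_nonzero_ac by (metis eq_neg_iff_add_eq_0 mult_2 mult_eq_0_iff)

lemma mem_roots_iff:
  "t \<in> roots_in_closure F \<longleftrightarrow>
    (t ^ 3 - (to_ac g0 + to_ac g1 * t + to_ac g2 * t ^ 2)) ^ 2 +
      t * (to_ac h0 + to_ac h1 * t + to_ac h2 * t ^ 2 - t ^ 4) = 0"
  by (simp add: roots_in_closure_def map_poly_sextic_poly[OF comm_ring_1_hom_to_ac] poly_sextic_poly)

lemma zero_not_root: "0 \<notin> roots_in_closure F"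
  using g0_nonzero by (simp add: mem_roots_iff)

lemma card_roots: "card (roots_in_closure F) = 6"
proof -
  have "Polynomial.degree (map_poly to_ac F) = 6"
    by (simp add: map_poly_sextic_poly[OF comm_ring_1_hom_to_ac]) (simp add: sextic_poly_def)
  then show ?thesis
    using card_roots_rsquarefree[OF separable] by (simp add: roots_in_closure_def)
qed

lemma R_eq: "R = {u. u ^ 2 \<in> roots_in_closure F}"
  by (rule roots_in_closure_pcompose_square)

lemma R_nonzero: "u \<in> R \<Longrightarrow> u \<noteq> 0"
  using zero_not_root by (auto simp: R_eq)

lemma R_uminus: "u \<in> R \<Longrightarrow> - u \<in> R"
  by (simp add: R_eq)

text \<open>Since \<open>F(0) = g0^2\<close> is nonzero, each of the six roots has two distinct
  square roots.\<close>

lemma card_R: "card R = 12"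
proof -
  have fib: "\<exists>u. u \<noteq> - u \<and> {v. v ^ 2 = t} = {u, - u}" if "t \<in> roots_in_closure F" for t
  proof -
    obtain u where u: "u ^ 2 = t"
      using nth_root_exists[of 2 t] by auto
    have "u \<noteq> 0" using u that zero_not_root by auto
    then have "u \<noteq> - u" using neg_eq_self_iff by blast
    moreover have "{v. v ^ 2 = t} = {u, - u}"
      using u by (auto simp: power2_eq_iff)
    ultimately show ?thesis by blast
  qed
  have "finite (roots_in_closure F)"
    using card_roots card.infinite by fastforce
  have "R = (\<Union>t\<in>roots_in_closure F. {v. v ^ 2 = t})"
    by (auto simp: R_eq)
  also have "card \<dots> = (\<Sum>t\<in>roots_in_closure F. card {v :: 'k alg_closure. v ^ 2 = t})"
  proof (rule card_UN_disjoint)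
    show "\<forall>t\<in>roots_in_closure F. finite {v :: 'k alg_closure. v ^ 2 = t}"
      using fib by (metis finite.emptyI finite.insertI)
  qed (use \<open>finite (roots_in_closure F)\<close> in auto)
  also have "\<dots> = (\<Sum>t\<in>roots_in_closure F. 2)"
  proof (rule sum.cong)
    fix t assume "t \<in> roots_in_closure F"
    then obtain u where "u \<noteq> - u" "{v. v ^ 2 = t} = {u, - u}" using fib by blast
    then show "card {v :: 'k alg_closure. v ^ 2 = t} = 2" by simp
  qed simp
  finally show ?thesis by (simp add: card_roots)
qed

section \<open>Fibres of the first projection\<close>

lemma proj_pt_mem_root_points_iff:
  assumes "x $ 1 \<noteq> 0"
  shows "proj_pt x \<in> root_points F \<longleftrightarrow> x $ 2 / x $ 1 \<in> roots_in_closure F"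
proof -
  have nz: "x \<noteq> 0" "(vector [1, t] :: 'k alg_closure ^ 2) \<noteq> 0" for t
    using assms by (auto simp: vec2_nonzero)
  have "proj_pt x = proj_pt (vector [1, t]) \<longleftrightarrow> t = x $ 2 / x $ 1" for t
    using assms by (simp add: proj_pt_eq_iff_line nz) (auto simp: field_simps)
  then show ?thesis by auto
qed

lemma det_fibre_matrix_eq_0_iff:
  assumes "x \<noteq> 0"
  shows "det (fibre_matrix x) = 0 \<longleftrightarrow> proj_pt x \<in> root_points F"
proof (cases "x $ 1 = 0")
  \<comment> \<open>Over \<open>(0 : 1)\<close> the determinant is \<open>- t^6\<close>, so the
    fibre at infinity is not degenerate.\<close>
  case True
  then have "x $ 2 \<noteq> 0" using assms by (simp add: vec2_nonzero)
  moreover have "proj_pt x \<noteq> proj_pt (vector [1, t])" for t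
    using assms True \<open>x $ 2 \<noteq> 0\<close> by (simp add: proj_pt_eq_iff_line vec2_nonzero)
  ultimately show ?thesis
    using True by (auto simp: det_M_matrix)
next
  case False
  define s t where "s = x $ 1" and "t = x $ 2 / x $ 1"
  have x: "x $ 1 = s" "x $ 2 = s * t" "s \<noteq> 0"
    using False by (simp_all add: s_def t_def)
  have "det (fibre_matrix x) = - (s ^ 6 *
      ((t ^ 3 - (to_ac g0 + to_ac g1 * t + to_ac g2 * t ^ 2)) ^ 2 +
       t * (to_ac h0 + to_ac h1 * t + to_ac h2 * t ^ 2 - t ^ 4)))"
    by (simp add: det_M_matrix meval_bform[OF comm_ring_1_hom_to_ac] x(1,2) eval_nat_numeral algebra_simps)
  then show ?thesis
    using x(3) proj_pt_mem_root_points_iff[OF False] by (simp add: mem_roots_iff flip: t_def)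
qed

lemma mem_geom_points_iff:
  assumes "x \<noteq> 0" "y \<noteq> 0"
  shows "(proj_pt x, proj_pt y) \<in> geom_points f \<longleftrightarrow> quad_val (fibre_matrix x) y = 0"
proof -
  have "\<forall>p\<in>{over_closure f}. \<exists>d e. bihomogeneous d e p"
    using bihomogeneous_map_mpoly[OF bihomogeneous_B_equation] by blast
  from mem_zero_locus_iff[OF this assms] show ?thesis
    by (simp add: meval_map_mpoly[OF comm_ring_1_hom_to_ac comm_ring_1_hom_id]
      meval_B_equation[OF comm_ring_1_hom_to_ac] quad_val_def)
qed

lemma fibre1_geom_points:
  assumes "x \<noteq> 0"
  shows "fibre1 (geom_points f) (proj_pt x) =
    {(proj_pt x, proj_pt y) | y. y \<noteq> 0 \<and> quad_val (fibre_matrix x) y = 0}"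
proof (intro subset_antisym subsetI)
  fix z assume "z \<in> fibre1 (geom_points f) (proj_pt x)"
  then have z: "z \<in> geom_points f" "fst z = proj_pt x"
    by (auto simp: fibre1_def)
  then obtain y where "y \<noteq> 0" "z = (proj_pt x, proj_pt y)"
    by (auto simp: zero_locus_def)
  with z show "z \<in> {(proj_pt x, proj_pt y) | y. y \<noteq> 0 \<and> quad_val (fibre_matrix x) y = 0}"
    using mem_geom_points_iff assms by auto
qed (use assms mem_geom_points_iff in \<open>auto simp: fibre1_def\<close>)

lemma fibre2_geom_points:
  assumes "y \<noteq> 0"
  shows "fibre2 (geom_points f) (proj_pt y) =
    (\<lambda>p. (p, proj_pt y)) ` {proj_pt x | x. x \<noteq> 0 \<and> quad_val (fibre_matrix x) y = 0}"
proof (intro subset_antisym subsetI)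
  fix z assume "z \<in> fibre2 (geom_points f) (proj_pt y)"
  then have z: "z \<in> geom_points f" "snd z = proj_pt y"
    by (auto simp: fibre2_def)
  then obtain x where "x \<noteq> 0" "z = (proj_pt x, proj_pt y)"
    by (auto simp: zero_locus_def)
  with z show "z \<in> (\<lambda>p. (p, proj_pt y)) ` {proj_pt x | x. x \<noteq> 0 \<and> quad_val (fibre_matrix x) y = 0}"
    using mem_geom_points_iff assms by auto
qed (use assms mem_geom_points_iff in \<open>auto simp: fibre2_def\<close>)

lemma zariski_irreducible_fibre1:
  assumes "x \<noteq> 0" "proj_pt x \<notin> root_points F"
  shows "zariski_irreducible (fibre1 (geom_points f) (proj_pt x))"
  unfolding fibre1_geom_points[OF assms(1)]
  using assms det_fibre_matrix_eq_0_iff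
  by (intro zariski_irreducible_smooth_conic two_nonzero_ac transpose_M_matrix) auto

text \<open>
  For \<open>t = u\<^sup>2\<close> with \<open>F(t) = 0\<close>, the form on the fibre over \<open>(1 : t)\<close> is
  \<open>(t T\<^sub>0 + T\<^sub>1 + t\<^sup>2 T\<^sub>2)\<^sup>2 - (u T\<^sub>0 + (t\<^sup>3 - g(1, t)) / u T\<^sub>2)\<^sup>2\<close>. The coefficients below are those of
  one of its linear factors, multiplied by \<open>u\<close>.
\<close>

definition line_coeffs :: "'k alg_closure \<Rightarrow> 'k alg_closure ^ 3" where
  "line_coeffs u = vector [u ^ 3 + u ^ 2, u,
     u ^ 5 + u ^ 6 + (to_ac (- g0) + to_ac (- g1) * u ^ 2 + to_ac (- g2) * u ^ 4)]"

definition root_line :: "'k alg_closure \<Rightarrow> 'k alg_closure line_plane" where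
  "root_line u = vertical_line (vector [1, u ^ 2]) (line_coeffs u)"

lemma base_nonzero [simp]: "(vector [1, t] :: 'k alg_closure ^ 2) \<noteq> 0"
  by (simp add: vec2_nonzero)

lemma fibre1_over_root:
  assumes u: "u \<in> R"
  shows "fibre1 (geom_points f) (proj_pt (vector [1, u ^ 2])) = root_line u \<union> root_line (- u)"
proof -
  have u0: "u \<noteq> 0" using u R_nonzero by blast
  have factor: "quad_val (fibre_matrix (vector [1, u ^ 2])) y = 0 \<longleftrightarrow>
      (\<Sum>i\<in>UNIV. line_coeffs u $ i * y $ i) = 0 \<or> (\<Sum>i\<in>UNIV. line_coeffs (- u) $ i * y $ i) = 0" for y
  proof -
    define G where "G = to_ac g0 + to_ac g1 * u ^ 2 + to_ac g2 * u ^ 4"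
    define H where "H = to_ac h0 + to_ac h1 * u ^ 2 + to_ac h2 * u ^ 4"
    have F: "(u ^ 6 - G) ^ 2 + u ^ 2 * (H - u ^ 8) = 0"
      using u by (simp add: R_eq mem_roots_iff G_def H_def flip: power_mult)
    have q: "quad_val (fibre_matrix (vector [1, u ^ 2])) y =
        (u ^ 4 - u ^ 2) * (y $ 1) ^ 2 + 2 * u ^ 2 * (y $ 1 * y $ 2) + 2 * G * (y $ 1 * y $ 3) +
        y $ 2 ^ 2 + 2 * u ^ 4 * (y $ 2 * y $ 3) + H * y $ 3 ^ 2"
      by (simp add: quad_val_def sum_3 M_matrix_nth meval_bform[OF comm_ring_1_hom_to_ac]
        G_def H_def eval_nat_numeral algebra_simps)
    have l: "(\<Sum>i\<in>UNIV. line_coeffs u $ i * y $ i) =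
        u * (u ^ 2 * y $ 1 + y $ 2 + u ^ 4 * y $ 3) + (u ^ 2 * y $ 1 + (u ^ 6 - G) * y $ 3)"
      "(\<Sum>i\<in>UNIV. line_coeffs (- u) $ i * y $ i) =
        (u ^ 2 * y $ 1 + (u ^ 6 - G) * y $ 3) - u * (u ^ 2 * y $ 1 + y $ 2 + u ^ 4 * y $ 3)"
      by (simp_all add: line_coeffs_def sum_3 G_def eval_nat_numeral algebra_simps)
    \<comment> \<open>With \<open>L = u^2 y1 + y2 + u^4 y3\<close> and
      \<open>N = u^2 y1 + (u^6 - G) y3\<close>, the product is \<open>N^2 - u^2 L^2\<close>.
      Completing the square in the fibre form shows that this is \<open>F(u^2) y3^2\<close> minus
      \<open>u^2\<close> times that form.\<close>
    have "(\<Sum>i\<in>UNIV. line_coeffs u $ i * y $ i) * (\<Sum>i\<in>UNIV. line_coeffs (- u) $ i * y $ i) =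
        ((u ^ 6 - G) ^ 2 + u ^ 2 * (H - u ^ 8)) * y $ 3 ^ 2 -
        u ^ 2 * quad_val (fibre_matrix (vector [1, u ^ 2])) y"
      unfolding q l by (simp add: eval_nat_numeral algebra_simps)
    also have "\<dots> = - (u ^ 2 * quad_val (fibre_matrix (vector [1, u ^ 2])) y)"
      by (simp only: F) simp
    finally have prod: "(\<Sum>i\<in>UNIV. line_coeffs u $ i * y $ i) * (\<Sum>i\<in>UNIV. line_coeffs (- u) $ i * y $ i) =
        - (u ^ 2 * quad_val (fibre_matrix (vector [1, u ^ 2])) y)" .
    have "- (u ^ 2 * K) = 0 \<longleftrightarrow> K = 0" for K
      using u0 by simp
    then show ?thesis
      unfolding prod[symmetric] mult_eq_0_iff[symmetric] by (simp only: prod)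
  qed
  show ?thesis
    unfolding fibre1_geom_points[OF base_nonzero] root_line_def vertical_line_def factor
    by auto
qed

lemma zariski_root_line:
  "zariski_closed (root_line u)" "zariski_irreducible (root_line u)"
  unfolding root_line_def
  by (simp_all add: zariski_closed_vertical_line zariski_irreducible_vertical_line)

lemma root_line_not_subset:
  assumes "u \<in> R"
  shows "\<not> root_line u \<subseteq> root_line (- u)"
proof -
  \<comment> \<open>The point of \<open>root_line u\<close> with \<open>T2 = 0\<close>; its second
    coordinate distinguishes \<open>u\<close> from \<open>- u\<close>.\<close>
  define y :: "'k alg_closure ^ 3" where "y = vector [1, - (u ^ 2 + u), 0]"
  have y: "y \<noteq> 0" by (simp add: y_def vec3_nonzero)
  have "(\<Sum>i\<in>UNIV. line_coeffs u $ i * y $ i) = 0" "(\<Sum>i\<in>UNIV. line_coeffs (- u) $ i * y $ i) = 2 * u ^ 2"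
    by (simp_all add: line_coeffs_def y_def sum_3 power2_eq_square power3_eq_cube algebra_simps)
  then have "(proj_pt (vector [1, u ^ 2]), proj_pt y) \<in> root_line u - root_line (- u)"
    using y R_nonzero[OF assms] two_nonzero_ac by (simp add: root_line_def mem_vertical_line_iff)
  then show ?thesis by blast
qed

lemma root_line_not_subset':
  assumes "u \<in> R"
  shows "\<not> root_line (- u) \<subseteq> root_line u"
  using root_line_not_subset[OF R_uminus[OF assms]] by simp

lemma root_line_nonempty: "root_line u \<noteq> {}"
  using zariski_root_line(2)[of u] by (simp add: zariski_irreducible_def)

text \<open>The base point of the line determines \<open>u^2\<close>, and the two lines over it are
  distinct.\<close>

lemma inj_on_root_line: "inj_on root_line R"
proof (rule inj_onI)
  fix u v assume u: "u \<in> R" and v: "v \<in> R" and eq: "root_line u = root_line v"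
  obtain z where "z \<in> root_line u" "z \<in> root_line v"
    using root_line_nonempty[of u] eq by auto
  then have "proj_pt (vector [1, u ^ 2]) = proj_pt (vector [1, v ^ 2] :: 'k alg_closure ^ 2)"
    by (auto simp: root_line_def vertical_line_def)
  then have "u ^ 2 = v ^ 2"
    by (simp add: proj_pt_eq_iff_line)
  then show "u = v"
    using root_line_not_subset[OF v] eq by (auto simp: power2_eq_iff)
qed

lemma irreducible_components_fibre1:
  assumes "u \<in> R"
  shows "irreducible_components (fibre1 (geom_points f) (proj_pt (vector [1, u ^ 2]))) =
    {root_line u, root_line (- u)}"
  unfolding fibre1_over_root[OF assms]
  by (intro irreducible_components_Un zariski_root_line root_line_not_subset root_line_not_subset' assms)

lemma root_points_eq: "root_points F = (\<lambda>u. proj_pt (vector [1, u ^ 2])) ` R"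
proof (intro subset_antisym subsetI)
  fix p assume "p \<in> root_points F"
  then obtain t where t: "t \<in> roots_in_closure F" "p = proj_pt (vector [1, t])" by blast
  obtain u where "u ^ 2 = t" using nth_root_exists[of 2 t] by auto
  with t show "p \<in> (\<lambda>u. proj_pt (vector [1, u ^ 2])) ` R"
    by (auto simp: R_eq)
qed (auto simp: R_eq)

lemma reducible_fibre_points_eq: "reducible_fibre_points f = root_points F"
proof (intro subset_antisym subsetI)
  fix p assume p: "p \<in> reducible_fibre_points f"
  then obtain x where "x \<noteq> 0" "p = proj_pt x" by (auto simp: proj_space_def)
  with p show "p \<in> root_points F"
    using zariski_irreducible_fibre1 by blast
next
  fix p assume "p \<in> root_points F"
  then obtain u where u: "u \<in> R" "p = proj_pt (vector [1, u ^ 2])"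
    unfolding root_points_eq by blast
  have "\<not> zariski_irreducible (root_line u \<union> root_line (- u))"
    by (intro not_zariski_irreducible_Un zariski_root_line root_line_not_subset root_line_not_subset' u)
  then show "p \<in> reducible_fibre_points f"
    using u fibre1_over_root[OF u(1)] base_nonzero by (auto simp: proj_space_def)
qed

lemma card_root_points: "card (root_points F) = 6"
proof -
  have "root_points F = (\<lambda>t. proj_pt (vector [1, t])) ` roots_in_closure F" by blast
  moreover have "inj_on (\<lambda>t. proj_pt (vector [1, t] :: 'k alg_closure ^ 2)) (roots_in_closure F)"
    by (rule inj_onI) (simp add: proj_pt_eq_iff_line)
  ultimately show ?thesis by (simp add: card_image card_roots)
qed

lemma components_eq:
  "(\<Union>p\<in>reducible_fibre_points f. irreducible_components (fibre1 (geom_points f) p)) = root_line ` R"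
  unfolding reducible_fibre_points_eq root_points_eq
  using irreducible_components_fibre1 R_uminus by auto

section \<open>Galois action on the lines\<close>

lemma line_coeffs_mem:
  assumes "u \<in> R"
  shows "line_coeffs u $ i \<in> splitting_field (pcompose F (monom 1 2))"
    "(vector [1, u ^ 2] :: _ ^ 2) $ j \<in> splitting_field (pcompose F (monom 1 2))"
proof -
  let ?l = "splitting_field (pcompose F (monom 1 2))"
  have u: "u ^ n \<in> ?l" "u \<in> ?l" for n
    using assms splitting_field_closed(2) splitting_field_power by blast+
  have "\<forall>i. line_coeffs u $ i \<in> ?l"
    unfolding line_coeffs_def forall_3 vector_3 by (intro conjI splitting_field_closed u)
  then show "line_coeffs u $ i \<in> ?l" by blast
  have "1 \<in> ?l"
    using splitting_field_closed(1)[of 1] by simp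
  then have "\<forall>j. (vector [1, u ^ 2] :: _ ^ 2) $ j \<in> ?l"
    using u by (simp add: forall_2)
  then show "(vector [1, u ^ 2] :: _ ^ 2) $ j \<in> ?l" by blast
qed

lemma line_coeffs_nonzero: "u \<in> R \<Longrightarrow> line_coeffs u \<noteq> 0"
  using R_nonzero by (auto simp: line_coeffs_def vec3_nonzero)

lemma line_over_root_line:
  "u \<in> R \<Longrightarrow> line_over (splitting_field (pcompose F (monom 1 2))) (root_line u)"
  unfolding line_over_def root_line_def
  using line_coeffs_mem line_coeffs_nonzero base_nonzero by blast

text \<open>The scaling of \<open>line_coeffs\<close> by \<open>u\<close> removes all denominators,
  and the signs sit in constants such as \<open>to_ac (- g0)\<close>. So only sums and products
  occur, and applying \<open>\<sigma>\<close> merely replaces \<open>u\<close> by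
  \<open>\<sigma> u\<close>.\<close>

lemma galois_image_root_line:
  assumes \<sigma>: "\<sigma> \<in> galois_group (splitting_field (pcompose F (monom 1 2)))" and u: "u \<in> R"
  shows "galois_image (splitting_field (pcompose F (monom 1 2))) \<sigma> (root_line u) (root_line (\<sigma> u))"
proof -
  let ?l = "splitting_field (pcompose F (monom 1 2))"
  have add: "\<sigma> (x + y) = \<sigma> x + \<sigma> y" and mult: "\<sigma> (x * y) = \<sigma> x * \<sigma> y" if "x \<in> ?l" "y \<in> ?l" for x y
    using \<sigma> that by (auto simp: galois_group_def)
  have const: "\<sigma> (to_ac a) = to_ac a" for a
    using \<sigma> by (auto simp: galois_group_def)
  have one: "\<sigma> 1 = 1"
    using const[of 1] by simp
  have ul: "u \<in> ?l" "u ^ n \<in> ?l" for n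
    using u splitting_field_closed(2) splitting_field_power by blast+
  have pow: "\<sigma> (u ^ n) = \<sigma> u ^ n" for n
    by (induction n) (simp_all add: one mult ul)
  note mem = splitting_field_closed ul
  have "\<forall>i. \<sigma> (line_coeffs u $ i) = line_coeffs (\<sigma> u) $ i"
    unfolding forall_3 line_coeffs_def vector_3
    by (simp only: add mult const pow mem)
  then have "(\<chi> i. \<sigma> (line_coeffs u $ i)) = line_coeffs (\<sigma> u)"
    by (simp add: vec_eq_iff)
  moreover have "(\<chi> i. \<sigma> ((vector [1, u ^ 2] :: _ ^ 2) $ i)) = vector [1, \<sigma> u ^ 2]"
    by (simp add: vec_eq_iff forall_2 one pow)
  ultimately show ?thesis
    unfolding galois_image_def root_line_def
    using u line_coeffs_mem line_coeffs_nonzero base_nonzero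
    by (intro exI[of _ "vector [1, u ^ 2]"] exI[of _ "line_coeffs u"]) simp
qed

section \<open>Singular fibres and the generic fibre\<close>

lemma nonsingular_fibre1_iff:
  assumes "x \<noteq> 0"
  shows "nonsingular_curve (fibre1_form to_ac f x) \<longleftrightarrow> proj_pt x \<notin> root_points F"
  by (simp only: fibre1_form_B_equation[OF comm_ring_1_hom_to_ac] det_fibre_matrix_eq_0_iff[OF assms]
    nonsingular_curve_quad_form_iff[OF two_nonzero_ac transpose_M_matrix])

lemma singular_fibre_points:
  "{proj_pt x | x. x \<noteq> 0 \<and> \<not> nonsingular_curve (fibre1_form to_ac f x)} = root_points F"
proof (intro subset_antisym subsetI)
  fix p assume "p \<in> root_points F"
  then obtain t where "p = proj_pt (vector [1, t])" by blast
  with \<open>p \<in> root_points F\<close> show "p \<in> {proj_pt x | x. x \<noteq> 0 \<and> \<not> nonsingular_curve (fibre1_form to_ac f x)}"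
    using nonsingular_fibre1_iff base_nonzero by blast
qed (use nonsingular_fibre1_iff in auto)

text \<open>The determinant of the generic fibre is \<open>- F\<close> itself, a nonzero element of
  the function field.\<close>

lemma generic_fibre:
  "is_conic (generic_fibre_form f)" "nonsingular_curve (over_closure (generic_fibre_form f))"
proof -
  have hom: "comm_ring_1_hom (\<lambda>a. to_fract [:a:] :: 'k poly fract)"
    by (rule comm_ring_1_hom_compose[OF comm_ring_1_hom_pconst comm_ring_1_hom_to_fract])
  have hom': "comm_ring_1_hom (\<lambda>p. to_ac (to_fract p) :: 'k poly fract alg_closure)"
    by (rule comm_ring_1_hom_compose[OF comm_ring_1_hom_to_fract comm_ring_1_hom_to_ac])
  have hom'': "comm_ring_1_hom (\<lambda>a. to_ac (to_fract [:a:]) :: 'k poly fract alg_closure)"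
    by (rule comm_ring_1_hom_compose[OF hom comm_ring_1_hom_to_ac])
  define A where "A = M_matrix (\<lambda>a. to_fract [:a:]) (bform g0 g1 g2) (bform h0 h1 h2) 1 (to_fract [:0, 1:])"
  define A' where "A' = (\<chi> i j. to_ac (A $ i $ j))"
  have form: "generic_fibre_form f = quad_form A"
    by (simp add: generic_fibre_form_def fibre1_form_B_equation[OF hom] A_def)
  have "over_closure (quad_form A) = quad_form A'"
    by (simp add: quad_form_def A'_def sum_3 map_mpoly_simps[OF comm_ring_1_hom_to_ac])
  then have form': "over_closure (generic_fibre_form f) = quad_form A'"
    by (simp add: form)
  have A'_eq: "A' = (\<chi> i j. to_ac (to_fract (M_matrix (\<lambda>a. [:a:]) (bform g0 g1 g2) (bform h0 h1 h2) 1 [:0, 1:] $ i $ j)))"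
    by (simp add: A'_def A_def hom_M_matrix[OF comm_ring_1_hom_to_fract comm_ring_1_hom_pconst])
  have "det A' = to_ac (to_fract (- F))"
    unfolding A'_eq hom_det_3[OF hom', symmetric] det_M_matrix_pconst ..
  moreover have "F \<noteq> 0" by (simp add: sextic_poly_def)
  ultimately have det: "det A' \<noteq> 0" by simp
  have two: "(2 :: 'k poly fract alg_closure) \<noteq> 0"
    by (rule two_neq_0_hom[OF hom'' two_nonzero])
  have "transpose A = A"
    unfolding A_def by (rule transpose_M_matrix)
  then have "transpose A' = A'"
    by (simp add: A'_def transpose_def vec_eq_iff)
  with det two show "nonsingular_curve (over_closure (generic_fibre_form f))"
    by (simp add: form' nonsingular_curve_quad_form_iff)
  have "quad_val A (vector [0, 1, 0]) = 1"
    by (simp add: quad_val_def sum_3 A_def M_matrix_nth)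
  then have "quad_form A \<noteq> 0"
    by (auto simp: comm_ring_1_hom.meval_simps[OF comm_ring_1_hom_id] simp flip: meval_quad_form)
  moreover have "homogeneous 2 (quad_form A)"
  proof -
    have "homogeneous (1 + 0 + 1) (quad_form A)"
      unfolding quad_form_def sum_3
      by (intro homogeneous_add homogeneous_mult homogeneous_mconst homogeneous_mvar)
    then show ?thesis by (simp only: add_0_right one_add_one)
  qed
  ultimately show "is_conic (generic_fibre_form f)"
    by (simp add: is_conic_def form)
qed

text \<open>\<open>Q0 = Q2 = 0\<close> already has finitely many solutions. At
  \<open>T2 = 1\<close>, since \<open>g0 \<noteq> 0\<close>, \<open>Q0 = 0\<close> expresses
  \<open>T0\<close> as a quadratic polynomial \<open>q\<close> in \<open>T1\<close>; then
  \<open>Q2 = 0\<close> becomes \<open>p = 0\<close>, where \<open>p\<close> has a nonzero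
  coefficient in degree four.\<close>

lemma finite_common_zeros: "finite {proj_pt y | y. y \<noteq> 0 \<and> fibre2_form to_ac f y = 0}"
proof -
  define c where "c = to_ac g0"
  have c: "2 * c \<noteq> 0"
    using two_nonzero_ac g0_nonzero by (simp add: c_def)
  define q :: "'k alg_closure poly" where "q = [:- to_ac h0 / (2 * c), 0, - 1 / (2 * c):]"
  define p where "p = q ^ 2 + [:2 * to_ac g2:] * q + [:to_ac h2, 2:]"
  have "coeff p 4 = (1 / (2 * c)) ^ 2"
    by (simp add: p_def q_def power2_eq_square eval_nat_numeral)
  then have "p \<noteq> 0" using c by auto
  then have fin: "finite {b. poly p b = 0}" by (rule poly_roots_finite)
  have "{proj_pt y | y. y \<noteq> 0 \<and> fibre2_form to_ac f y = 0} \<subseteq>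
      (\<lambda>b. proj_pt (vector [poly q b, b, 1])) ` {b. poly p b = 0}"
  proof
    fix z assume "z \<in> {proj_pt y | y. y \<noteq> 0 \<and> fibre2_form to_ac f y = 0}"
    then obtain y where z: "z = proj_pt y" and y: "y \<noteq> 0"
      and Q: "surface_Q0 c (to_ac h0) (y $ 1) (y $ 2) (y $ 3) = 0"
        "surface_Q2 (to_ac g2) (to_ac h2) (y $ 1) (y $ 2) (y $ 3) = 0"
      by (auto simp: fibre2_form_B_equation[OF comm_ring_1_hom_to_ac] bform_eq_0_iff c_def)
    have y3: "y $ 3 \<noteq> 0"
      using Q y by (auto simp: surface_Q_defs vec3_nonzero)
    define a b where "a = y $ 1 / y $ 3" and "b = y $ 2 / y $ 3"
    have ab: "y $ 1 = a * y $ 3" "y $ 2 = b * y $ 3"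
      using y3 by (simp_all add: a_def b_def)
    have "y $ 3 ^ 2 * (2 * c * a + b ^ 2 + to_ac h0) = 0"
      "y $ 3 ^ 2 * (a ^ 2 + 2 * to_ac g2 * a + 2 * b + to_ac h2) = 0"
      using Q unfolding ab by (simp_all add: surface_Q_defs power2_eq_square algebra_simps)
    then have E: "2 * c * a + b ^ 2 + to_ac h0 = 0" "a ^ 2 + 2 * to_ac g2 * a + 2 * b + to_ac h2 = 0"
      using y3 by simp_all
    have "2 * c * a = 2 * c * poly q b"
    proof -
      have "2 * c * poly q b = - to_ac h0 - b ^ 2"
        using c by (simp add: q_def power2_eq_square field_simps)
      moreover have "2 * c * a = - to_ac h0 - b ^ 2"
      proof -
        have "2 * c * a = (2 * c * a + b ^ 2 + to_ac h0) - to_ac h0 - b ^ 2" by simp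
        then show ?thesis unfolding E(1) by simp
      qed
      ultimately show ?thesis by simp
    qed
    then have a: "a = poly q b" using c by simp
    have "poly p b = a ^ 2 + 2 * to_ac g2 * a + 2 * b + to_ac h2"
      by (simp add: p_def a algebra_simps)
    then have "poly p b = 0" using E(2) by simp
    moreover have "y = y $ 3 *s vector [a, b, 1]"
      using y3 by (simp add: vec_eq_iff forall_3 a_def b_def)
    then have "z = proj_pt (vector [a, b, 1])"
      unfolding z using y3 proj_pt_scale by metis
    ultimately show "z \<in> (\<lambda>b. proj_pt (vector [poly q b, b, 1])) ` {b. poly p b = 0}"
      using a by blast
  qed
  with fin show ?thesis by (meson finite_imageI finite_subset)
qed

text \<open>Over \<open>y\<close> lie the zeros of a binary quadratic form whose discriminant is the
  value of the quartic at \<open>y\<close>.\<close>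

lemma double_cover: "double_cover_branched_along f (branch_quartic g0 g1 g2 h0 h1 h2)"
proof -
  define C where "C = branch_quartic (to_ac g0) (to_ac g1) (to_ac g2) (to_ac h0) (to_ac h1) (to_ac h2)"
  have C: "over_closure (branch_quartic g0 g1 g2 h0 h1 h2) = C"
    by (simp add: C_def map_branch_quartic[OF comm_ring_1_hom_to_ac])
  have form: "fibre2_form to_ac f y = bform (surface_Q0 (to_ac g0) (to_ac h0) (y $ 1) (y $ 2) (y $ 3))
      (surface_Q1 (to_ac g1) (to_ac h1) (y $ 1) (y $ 2) (y $ 3))
      (surface_Q2 (to_ac g2) (to_ac h2) (y $ 1) (y $ 2) (y $ 3))" for y
    by (rule fibre2_form_B_equation[OF comm_ring_1_hom_to_ac])
  have disc: "meval id (($) y) C = surface_Q1 (to_ac g1) (to_ac h1) (y $ 1) (y $ 2) (y $ 3) ^ 2 -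
      4 * surface_Q0 (to_ac g0) (to_ac h0) (y $ 1) (y $ 2) (y $ 3) *
      surface_Q2 (to_ac g2) (to_ac h2) (y $ 1) (y $ 2) (y $ 3)" for y
    by (simp add: C_def meval_branch_quartic[OF comm_ring_1_hom_id])
  have "fibre2_form to_ac f y \<noteq> 0" if "nonsingular_curve C" "y \<noteq> 0" for y
    using nonsingular_branch_quartic_imp[OF that[unfolded C_def]] by (simp add: form bform_eq_0_iff)
  moreover have "homogeneous 2 (fibre2_form to_ac f y)" for y
    by (simp add: form homogeneous_bform)
  moreover have "meval id (($) y) C = 0" if "fibre2_form to_ac f y = 0" for y
    using that by (simp add: form bform_eq_0_iff disc)
  moreover have "card (fibre2 (geom_points f) (proj_pt y)) = (if meval id (($) y) C = 0 then 1 else 2)"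
    if "y \<noteq> 0" "fibre2_form to_ac f y \<noteq> 0" for y
  proof -
    have q: "quad_val (fibre_matrix x) y =
        surface_Q0 (to_ac g0) (to_ac h0) (y $ 1) (y $ 2) (y $ 3) * x $ 1 ^ 2 +
        surface_Q1 (to_ac g1) (to_ac h1) (y $ 1) (y $ 2) (y $ 3) * (x $ 1 * x $ 2) +
        surface_Q2 (to_ac g2) (to_ac h2) (y $ 1) (y $ 2) (y $ 3) * x $ 2 ^ 2" for x :: "'k alg_closure ^ 2"
      by (simp add: quad_val_def sum_M_matrix_bform[OF comm_ring_1_hom_to_ac])
    have "card (fibre2 (geom_points f) (proj_pt y)) =
        card {proj_pt x | x. x \<noteq> 0 \<and> quad_val (fibre_matrix x) y = 0}"
      unfolding fibre2_geom_points[OF that(1)] by (rule card_image) (simp add: inj_on_def)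
    also have "\<dots> = (if meval id (($) y) C = 0 then 1 else 2)"
      unfolding q disc using that(2)
      by (intro card_zeros_binary_quadratic two_nonzero_ac) (simp add: form bform_eq_0_iff)
    finally show ?thesis .
  qed
  ultimately show ?thesis
    unfolding double_cover_branched_along_def C using finite_common_zeros by simp
qed

end

theorem proposition3p5:
  assumes char_k: "CHAR('k::field) \<noteq> 2"
  shows
    "(\<forall>(F :: 'k poly) c. sextic_datum to_ac F c \<longrightarrow>
        card (form_pairs F) = 2 \<and>
        (\<lambda>(g, h). value_at_10 g) ` form_pairs F = {c, - c} \<and>
        (\<forall>g h. selected_pair F c g h \<longrightarrow>
          (let f = B_equation g h; C = discriminant_form f;
               l = splitting_field (pcompose F (monom 1 2));
               components = (\<Union>p\<in>reducible_fibre_points f.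
                 irreducible_components (fibre1 (geom_points f) p))
           in
             f \<noteq> 0 \<and> bihomogeneous 2 2 f \<and>
             \<comment> \<open>(i)\<close>
             is_conic (generic_fibre_form f) \<and>
             nonsingular_curve (over_closure (generic_fibre_form f)) \<and>
             {proj_pt x | x. x \<noteq> 0 \<and> \<not> nonsingular_curve (fibre1_form to_ac f x)} =
               root_points F \<and>
             \<comment> \<open>(ii)\<close>
             reducible_fibre_points f = root_points F \<and>
             card (reducible_fibre_points f) = 6 \<and>
             (\<forall>p\<in>reducible_fibre_points f. \<exists>L1 L2.
               irreducible_components (fibre1 (geom_points f) p) = {L1, L2} \<and> L1 \<noteq> L2 \<and>
               fibre1 (geom_points f) p = L1 \<union> L2 \<and>
               line_over l L1 \<and> line_over l L2) \<and>
             card components = 12 \<and>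
             (\<exists>\<phi>. bij_betw \<phi> (roots_in_closure (pcompose F (monom 1 2))) components \<and>
               (\<forall>\<sigma>\<in>galois_group l. \<forall>u\<in>roots_in_closure (pcompose F (monom 1 2)).
                 galois_image l \<sigma> (\<phi> u) (\<phi> (\<sigma> u)))) \<and>
             \<comment> \<open>(iii)\<close>
             is_quartic C \<and> double_cover_branched_along f C))) \<and>
     \<comment> \<open>(iii), generic choice of F\<close>
     (\<exists>P :: (6, 'k) mpoly. P \<noteq> 0 \<and>
        nonsingular_outside id to_ac P \<and>
        nonsingular_outside to_ac id P)"
proof -
  have two: "(2 :: 'k) \<noteq> 0"
  proof
    assume "(2 :: 'k) = 0"
    then have "CHAR('k) dvd 2"
      using of_nat_eq_0_iff_char_dvd[of 2, where 'a='k] by simp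
    moreover have "CHAR('k) \<noteq> 1"
      using of_nat_CHAR[where 'a='k] by auto
    ultimately show False
      using char_k by (metis prime_nat_iff two_is_prime_nat)
  qed
  have generic: "\<exists>P :: (6, 'k) mpoly. P \<noteq> 0 \<and> nonsingular_outside id to_ac P \<and> nonsingular_outside to_ac id P"
    by (intro exI[of _ elim_polynomial] conjI elim_polynomial_nonzero[OF two]
      nonsingular_outside_elim_polynomial[OF two] comm_ring_1_hom_id comm_ring_1_hom_to_ac)
  show ?thesis
    unfolding Let_def
  proof (intro conjI allI impI generic)
    fix F :: "'k poly" and c
    assume datum: "sextic_datum to_ac F c"
    note card_form_pairs[OF two datum]
    then show "card (form_pairs F) = 2" "(\<lambda>(g, h). value_at_10 g) ` form_pairs F = {c, - c}"
      by blast+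
    fix g h assume "selected_pair F c g h"
    then obtain g1 g2 h0 h1 h2 where gh: "g = bform c g1 g2" "h = bform h0 h1 h2"
      and F: "F = sextic_poly c g1 g2 h0 h1 h2"
      by (rule selected_pair_cases)
    interpret sextic_surface c g1 g2 h0 h1 h2
      using datum two by unfold_locales (simp_all add: sextic_datum_def F)
    note defs = gh F
    show "B_equation g h \<noteq> 0" "bihomogeneous 2 2 (B_equation g h)"
      unfolding defs by (rule B_equation_nonzero bihomogeneous_B_equation)+
    show "is_conic (generic_fibre_form (B_equation g h))"
      "nonsingular_curve (over_closure (generic_fibre_form (B_equation g h)))"
      unfolding defs by (rule generic_fibre)+
    show "{proj_pt x | x. x \<noteq> 0 \<and> \<not> nonsingular_curve (fibre1_form to_ac (B_equation g h) x)} = root_points F"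
      unfolding defs by (rule singular_fibre_points)
    show "reducible_fibre_points (B_equation g h) = root_points F"
      "card (reducible_fibre_points (B_equation g h)) = 6"
      unfolding defs reducible_fibre_points_eq by (rule refl card_root_points)+
    show "\<forall>p\<in>reducible_fibre_points (B_equation g h). \<exists>L1 L2.
        irreducible_components (fibre1 (geom_points (B_equation g h)) p) = {L1, L2} \<and> L1 \<noteq> L2 \<and>
        fibre1 (geom_points (B_equation g h)) p = L1 \<union> L2 \<and>
        line_over (splitting_field (pcompose F (monom 1 2))) L1 \<and>
        line_over (splitting_field (pcompose F (monom 1 2))) L2"
      unfolding defs reducible_fibre_points_eq root_points_eq
    proof (rule ballI, elim imageE)
      fix p :: "('k alg_closure ^ 2) set" and u assume p: "p = proj_pt (vector [1, u ^ 2])" and u: "u \<in> R"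
      show "\<exists>L1 L2. irreducible_components (fibre1 (geom_points f) p) = {L1, L2} \<and> L1 \<noteq> L2 \<and>
          fibre1 (geom_points f) p = L1 \<union> L2 \<and>
          line_over (splitting_field (pcompose (sextic_poly c g1 g2 h0 h1 h2) (monom 1 2))) L1 \<and>
          line_over (splitting_field (pcompose (sextic_poly c g1 g2 h0 h1 h2) (monom 1 2))) L2"
        unfolding p
        using irreducible_components_fibre1[OF u] fibre1_over_root[OF u] root_line_not_subset[OF u]
          line_over_root_line[OF u] line_over_root_line[OF R_uminus[OF u]]
        by (intro exI[of _ "root_line u"] exI[of _ "root_line (- u)"]) auto
    qed
    show "card (\<Union>p\<in>reducible_fibre_points (B_equation g h).
        irreducible_components (fibre1 (geom_points (B_equation g h)) p)) = 12"
      unfolding defs components_eq by (simp only: card_image[OF inj_on_root_line] card_R)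
    show "\<exists>\<phi>. bij_betw \<phi> (roots_in_closure (pcompose F (monom 1 2)))
          (\<Union>p\<in>reducible_fibre_points (B_equation g h).
            irreducible_components (fibre1 (geom_points (B_equation g h)) p)) \<and>
        (\<forall>\<sigma>\<in>galois_group (splitting_field (pcompose F (monom 1 2))).
          \<forall>u\<in>roots_in_closure (pcompose F (monom 1 2)).
            galois_image (splitting_field (pcompose F (monom 1 2))) \<sigma> (\<phi> u) (\<phi> (\<sigma> u)))"
      unfolding defs components_eq
      using inj_on_root_line galois_image_root_line
      by (intro exI[of _ root_line]) (auto simp: bij_betw_def)
    show "is_quartic (discriminant_form (B_equation g h))"
      unfolding defs discriminant_form_B_equation by (rule is_quartic_branch_quartic)
    show "double_cover_branched_along (B_equation g h) (discriminant_form (B_equation g h))"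
      unfolding defs discriminant_form_B_equation by (rule double_cover)
  qed
qed

end
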